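(* Let $n\ge1$ and let $\Gamma$ be a wedge sum of connected graphs $\Gamma_1$ and $\Gamma_2$, where the gluing map identifies a vertex of valence $1$ in $\Gamma_1$ with a vertex of valence $1$ in $\Gamma_2$ (to a vertex $v$ of $\Gamma$). Let $X_k=A_k\cup B_k$ ($0\le k\le n-1$) and $X'_k=A'_k\cup B'_k$ ($1\le k\le n-1$) be the subcomplexes of $D_n(\Gamma)$ defined in the context, and assume that for all $m\ge 2$ and all such $k$ the Mayer–Vietoris boundary maps $$\delta: H_m(X_k;\mathbb{Z})\to H_{m-1}(A_k\cap B_k;\mathbb{Z}),\qquad \delta': H_m(X'_k;\mathbb{Z})\to H_{m-1}(A'_k\cap B'_k;\mathbb{Z})$$ have trivial image. Then the rank of the second homology group $H_2(D_n(\Gamma);\mathbb{Z})$ is $$\beta_2^{(n)}(\Gamma)=\beta_2^{(n)}(\Gamma_2)+\beta_2^{(n)}(\Gamma_1)+\sum_{k=1}^{n}\left(\beta_1^{(k)}(\Gamma_1)-\beta_1^{(k-1)}(\Gamma_1)\right)\beta_1^{(n-k)}(\Gamma_2).$$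
   Context: A graph is a finite one-dimensional CW-complex. For a graph $G$, the discrete configuration space $D_n(G)$ of $n$ indistinguishable particles is the cubical complex whose $k$-cells are the unordered collections $\{\sigma_1,\dots,\sigma_n\}$ of pairwise disjoint closed cells of $G$ (vertices or closed edges), exactly $k$ of which are edges; $D_0(G)$ is a point. Notation: $\beta_p^{(k)}(G)=\operatorname{rank}H_p(D_k(G);\mathbb{Z})$ (so $\beta_1^{(0)}=0$). A graph is sufficiently subdivided for $n$ particles if each path between distinct vertices of degree not equal to $2$ passes through at least $n-1$ edges and each nontrivial loop passes through at least $n+1$ edges. $\Gamma_1,\Gamma_2$ are regarded as subgraphs of $\Gamma$ with $\Gamma_1\cup\Gamma_2=\Gamma$, $\Gamma_1\cap\Gamma_2=\{v\}$. The edge of $\Gamma_i$ incident to $v$ is subdivided one extra time, and $\tilde\Gamma_i$ is the subgraph of $\Gamma_i$ obtained by deleting $v$ and the open edge of $\Gamma_i$ incident to $v$. All of $\Gamma,\Gamma_i,\tilde\Gamma_i$ are assumed sufficiently subdivided for $n$ particles (so in particular $D_k(\tilde\Gamma_i)\simeq D_k(\Gamma_i)$ for $k\le n$). For disjoint subgraphs $G,G'$ of $\Gamma$, $D_k(G)\times D_l(G')$ with $k+l=n$ is regarded as the subcomplex of $D_n(\Gamma)$ of configurations with $k$ particles on $G$ and $l$ on $G'$. Set $A_k=D_{n-k}(\Gamma_1)\times D_k(\tilde\Gamma_2)$ for $0\le k\le n-1$, and $A'_k=D_{n-k}(\tilde\Gamma_1)\times D_k(\Gamma_2)$ for $1\le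 k\le n-1$. Set $B_{n-1}=D_n(\Gamma_2)$, $X_k=A_k\cup B_k$, $B'_k=X_k$, $X'_k=A'_k\cup B'_k$, and $B_{k-1}=X'_k$; that is, $B_k=D_n(\Gamma_2)\cup\bigcup_{j=k+1}^{n-1}(A'_j\cup A_j)$ and $B'_k=A_k\cup B_k$. Then $D_n(\Gamma)=X_0\supset X_1'\supset X_1\supset\dots\supset X_{n-1}=(\Gamma_1\times D_{n-1}(\tilde\Gamma_2))\cup D_n(\Gamma_2)$. *)

theory Defs
  imports
    "Graph_Theory.Graph_Theory"
    "HOL-Algebra.Free_Abelian_Groups"
begin

section \<open>Graphs\<close>

text \<open>
  A finite one-dimensional CW complex is represented by a \<^locale>\<open>fin_digraph\<close>: the attaching map of
  a 1-cell is given by its two end points, and loops and parallel edges are allowed. The direction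
  of an arc serves only to orient the corresponding 1-cell.
\<close>

definition valence :: "('a, 'b) pre_digraph \<Rightarrow> 'a \<Rightarrow> nat" where
  "valence G u = in_degree G u + out_degree G u"

text \<open>Undirected edge paths of a graph are walks in the graph in which every arc \<open>e\<close> is replaced by
  its two traversals \<open>(e, True)\<close> (from tail to head) and \<open>(e, False)\<close> (from head to tail).\<close>

definition both_ways :: "('a, 'b) pre_digraph \<Rightarrow> ('a, 'b \<times> bool) pre_digraph" where
  "both_ways G = \<lparr>verts = verts G, arcs = arcs G \<times> UNIV,
     tail = (\<lambda>(e, b). if b then tail G e else head G e),
     head = (\<lambda>(e, b). if b then head G e else tail G e)\<rparr>"

definition edge_path :: "('a, 'b) pre_digraph \<Rightarrow> 'a \<Rightarrow> ('b \<times> bool) list \<Rightarrow> 'a \<Rightarrow> bool" where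
  "edge_path G u p w \<longleftrightarrow> pre_digraph.awalk (both_ways G) u p w"

definition backtrack :: "('b \<times> bool) list \<Rightarrow> ('b \<times> bool) list \<Rightarrow> bool" where
  "backtrack p q \<longleftrightarrow> (\<exists>r e b s. p = r @ [(e, b), (e, \<not> b)] @ s \<and> q = r @ s)"

text \<open>A closed edge path is a nontrivial loop if it is not homotopic to the constant path; homotopy of
  edge paths is generated by the insertion and removal of backtracks.\<close>

definition nontrivial_loop :: "('a, 'b) pre_digraph \<Rightarrow> ('b \<times> bool) list \<Rightarrow> bool" where
  "nontrivial_loop G p \<longleftrightarrow> (\<exists>u. edge_path G u p u) \<and> \<not> equivclp backtrack p []"

definition sufficiently_subdivided :: "nat \<Rightarrow> ('a, 'b) pre_digraph \<Rightarrow> bool" where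
  "sufficiently_subdivided n G \<longleftrightarrow>
     (\<forall>u w p. edge_path G u p w \<and> u \<noteq> w \<and> valence G u \<noteq> 2 \<and> valence G w \<noteq> 2 \<longrightarrow> n - 1 \<le> length p) \<and>
     (\<forall>p. nontrivial_loop G p \<longrightarrow> n + 1 \<le> length p)"

section \<open>Discrete configuration spaces\<close>

datatype ('a, 'b) gcell = Vertex 'a | Edge 'b

fun closed_cell :: "('a, 'b) pre_digraph \<Rightarrow> ('a, 'b) gcell \<Rightarrow> ('a, 'b) gcell set" where
  "closed_cell G (Vertex u) = {Vertex u}"
| "closed_cell G (Edge e) = {Edge e, Vertex (tail G e), Vertex (head G e)}"

definition graph_cells :: "('a, 'b) pre_digraph \<Rightarrow> ('a, 'b) gcell set" where
  "graph_cells G = Vertex ` verts G \<union> Edge ` arcs G"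

text \<open>A cubical complex is given by its set of cells; subcomplexes are subsets.\<close>

definition conf_complex :: "nat \<Rightarrow> ('a, 'b) pre_digraph \<Rightarrow> ('a, 'b) gcell set set" where
  "conf_complex n G = {S. S \<subseteq> graph_cells G \<and> finite S \<and> card S = n \<and>
     pairwise (\<lambda>\<sigma> \<tau>. disjnt (closed_cell G \<sigma>) (closed_cell G \<tau>)) S}"

definition cube_dim :: "('a, 'b) gcell set \<Rightarrow> nat" where
  "cube_dim S = card {e. Edge e \<in> S}"

text \<open>The product of complexes of configurations on disjoint subgraphs, as a complex of configurations
  on the whole graph.\<close>

definition conf_prod :: "('a, 'b) gcell set set \<Rightarrow> ('a, 'b) gcell set set \<Rightarrow> ('a, 'b) gcell set set" where
  "conf_prod X Y = {S \<union> T | S T. S \<in> X \<and> T \<in> Y}"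

section \<open>Integral homology of cubical complexes\<close>

text \<open>A cube of configurations is the product of its edges. It is oriented by the directions of these
  edges together with their order; a linear order on all arcs is fixed for this purpose. A different
  choice changes the basis of the chain groups by signs only.\<close>

definition arc_order :: "'b rel" where
  "arc_order = (SOME r. linear_order r)"

definition cube_boundary ::
    "('a, 'b) pre_digraph \<Rightarrow> ('a, 'b) gcell set \<Rightarrow> (('a, 'b) gcell set \<Rightarrow>\<^sub>0 int)" where
  "cube_boundary G S = (\<Sum>e | Edge e \<in> S.
     frag_cmul ((- 1) ^ card {e'. Edge e' \<in> S \<and> e' \<noteq> e \<and> (e', e) \<in> arc_order})
       (frag_of (insert (Vertex (head G e)) (S - {Edge e}))
        - frag_of (insert (Vertex (tail G e)) (S - {Edge e}))))"

definition bd :: "('a, 'b) pre_digraph \<Rightarrow>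
    (('a, 'b) gcell set \<Rightarrow>\<^sub>0 int) \<Rightarrow> (('a, 'b) gcell set \<Rightarrow>\<^sub>0 int)" where
  "bd G = frag_extend (cube_boundary G)"

definition chain_group ::
    "nat \<Rightarrow> ('a, 'b) gcell set set \<Rightarrow> (('a, 'b) gcell set \<Rightarrow>\<^sub>0 int) monoid" where
  "chain_group p X = free_Abelian_group {S \<in> X. cube_dim S = p}"

definition cycle_group :: "('a, 'b) pre_digraph \<Rightarrow> nat \<Rightarrow> ('a, 'b) gcell set set \<Rightarrow>
    (('a, 'b) gcell set \<Rightarrow>\<^sub>0 int) monoid" where
  "cycle_group G p X = subgroup_generated (chain_group p X) {z. bd G z = 0}"

definition boundaries :: "('a, 'b) pre_digraph \<Rightarrow> nat \<Rightarrow> ('a, 'b) gcell set set \<Rightarrow>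
    (('a, 'b) gcell set \<Rightarrow>\<^sub>0 int) set" where
  "boundaries G p X = bd G ` carrier (chain_group (p + 1) X)"

text \<open>\<open>cubical_homology G p X\<close> is $H_p(X;\mathbb{Z})$ for a subcomplex \<open>X\<close> of a discrete configuration
  space of \<open>G\<close>.\<close>

definition cubical_homology :: "('a, 'b) pre_digraph \<Rightarrow> nat \<Rightarrow> ('a, 'b) gcell set set \<Rightarrow>
    (('a, 'b) gcell set \<Rightarrow>\<^sub>0 int) set monoid" where
  "cubical_homology G p X = cycle_group G p X Mod boundaries G p X"

text \<open>The Mayer--Vietoris boundary map $H_m(X \cup Y) \to H_{m-1}(X \cap Y)$ sends the class of a cycle
  \<open>a + b\<close>, with \<open>a\<close> a chain of \<open>X\<close> and \<open>b\<close> a chain of \<open>Y\<close>, to the class of the boundary of \<open>a\<close>. Homology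
  classes being cosets, the image of a class \<open>Z\<close> is the set of the boundaries of \<open>a\<close> for all
  decompositions \<open>a + b\<close> of all representatives: these fill exactly one coset, because \<open>a\<close> is determined
  by \<open>Z\<close> up to adding a boundary of \<open>X\<close> and a chain of \<open>X \<inter> Y\<close>.\<close>

definition mv_boundary :: "('a, 'b) pre_digraph \<Rightarrow> nat \<Rightarrow>
    ('a, 'b) gcell set set \<Rightarrow> ('a, 'b) gcell set set \<Rightarrow>
    (('a, 'b) gcell set \<Rightarrow>\<^sub>0 int) set \<Rightarrow> (('a, 'b) gcell set \<Rightarrow>\<^sub>0 int) set" where
  "mv_boundary G m X Y Z =
     {bd G a | a b. a \<in> carrier (chain_group m X) \<and> b \<in> carrier (chain_group m Y) \<and> a + b \<in> Z}"

definition mv_boundary_trivial :: "('a, 'b) pre_digraph \<Rightarrow> nat \<Rightarrow>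
    ('a, 'b) gcell set set \<Rightarrow> ('a, 'b) gcell set set \<Rightarrow> bool" where
  "mv_boundary_trivial G m X Y \<longleftrightarrow>
     mv_boundary G m X Y ` carrier (cubical_homology G m (X \<union> Y))
       = {\<one>\<^bsub>cubical_homology G (m - 1) (X \<inter> Y)\<^esub>}"

text \<open>The rank of a finitely generated commutative group; the set of cardinalities is then bounded.\<close>

definition group_rank :: "('c, 'd) monoid_scheme \<Rightarrow> nat" where
  "group_rank H = Sup {card B | B. finite B \<and> B \<subseteq> carrier H \<and>
     (\<forall>c :: 'c \<Rightarrow> int. finprod H (\<lambda>b. b [^]\<^bsub>H\<^esub> c b) B = \<one>\<^bsub>H\<^esub> \<longrightarrow> (\<forall>b\<in>B. c b = 0))}"

definition betti :: "nat \<Rightarrow> nat \<Rightarrow> ('a, 'b) pre_digraph \<Rightarrow> nat" where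
  "betti p k G = group_rank (cubical_homology G p (conf_complex k G))"

section \<open>The decomposition for a wedge of two graphs\<close>

text \<open>In the following, \<open>G1\<close> and \<open>G2\<close> are the two subgraphs meeting in the vertex \<open>v\<close>.\<close>

abbreviation tilde :: "('a, 'b) pre_digraph \<Rightarrow> 'a \<Rightarrow> ('a, 'b) pre_digraph" where
  "tilde G v \<equiv> pre_digraph.del_vert G v"

definition piece_A where
  "piece_A n G1 G2 v k = conf_prod (conf_complex (n - k) G1) (conf_complex k (tilde G2 v))"

definition piece_A' where
  "piece_A' n G1 G2 v k = conf_prod (conf_complex (n - k) (tilde G1 v)) (conf_complex k G2)"

definition piece_B where
  "piece_B n G1 G2 v k =
     conf_complex n G2 \<union> (\<Union>j\<in>{k+1..n-1}. piece_A' n G1 G2 v j \<union> piece_A n G1 G2 v j)"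

definition piece_B' where
  "piece_B' n G1 G2 v k = piece_A n G1 G2 v k \<union> piece_B n G1 G2 v k"

text \<open>The edge at the vertex \<open>v\<close> is subdivided one extra time: the end point of this edge other than
  \<open>v\<close> is an inserted vertex, which has valence 2.\<close>

definition extra_subdivided_at :: "('a, 'b) pre_digraph \<Rightarrow> 'a \<Rightarrow> bool" where
  "extra_subdivided_at G v \<longleftrightarrow>
     (\<forall>e\<in>arcs G. \<forall>w. {tail G e, head G e} = {v, w} \<longrightarrow> valence G w = 2)"

end

theory Submission
  imports Defs
begin

text \<open>
  Betti numbers are computed with rational chains: $\beta_p(X) = |X_p| - r_p(X) - r_{p+1}(X)$, where
  $r_p$ is the rank of the boundary map on $p$-chains. Triviality of the Mayer--Vietoris map
  $H_m(X \cup Y) \to H_{m-1}(X \cap Y)$ says exactly that $\partial C_m(X) \cap \partial C_m(Y) = \partial C_m(X \cap Y)$,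
  so $r_m$, and hence $\beta_2$, satisfies inclusion--exclusion along the filtration. The pieces and
  their intersections are products of configuration spaces, up to a particle resting at \<open>v\<close>, and the
  Kuenneth formula applies to them.

  That $D_k(\tilde\Gamma_i)$ and $D_k(\Gamma_i)$ have the same Betti numbers needs no general subdivision
  theorem: relative to $D_k(G - v)$, the cells of $D_k(G)$ form the mapping cone of
  $D_{k-1}(G - v - w) \subset D_{k-1}(G - v)$, where \<open>w\<close> is the neighbour of the leaf \<open>v\<close>. So the inclusion is a
  homology isomorphism by induction on \<open>k\<close>, as long as the edge path that starts at \<open>v\<close> does not branch too early.
  Finally $D_k(\Gamma_i)$ is connected because unlabelled particles can be rearranged on any connected graph,
  and the sum over the pieces telescopes.
\<close>

section \<open>Dimensions of subspaces\<close>

text \<open>The rank of an integral homology group ignores torsion, so a rational boundary may be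
  replaced by an integral one after clearing denominators. This passage is made twice: from
  \<open>group_rank\<close> to \<open>hrank\<close>, and from the integral Mayer-Vietoris hypothesis
  to rational boundary ranks. Every piece is described by the numbers of particles on
  \<open>L\<close> and \<open>R\<close> (the cells of the two graphs without \<open>v\<close>) and
  by which of \<open>v\<close>, \<open>e1\<close>, \<open>e2\<close> is occupied, at most one of
  them. Intersections become inequalities on these counts: in A_k \<inter> B_k one particle is
  forced to sit at \<open>v\<close>, in A'_k \<inter> B'_k none is left for it. Let
  \<open>F i j\<close> be the second Betti number of a product with i and j particles. In the step
  of A'_k the piece and the intersection both have F (n-k) k, so nothing changes; the step of A_k
  contributes F (n-k) k - F (n-k-1) k. Since the Betti numbers in degree 0 are 1, this is a summand
  of the theorem plus a telescoping difference of second Betti numbers of \<Gamma>1. Legs of length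
  n arise as the edge at \<open>v\<close> followed by the n-1 edges guaranteed in the tilde
  graph.\<close>

context vector_space
begin

text \<open>Spaces of chains may be infinite-dimensional, and \<open>dim\<close> is 0 by convention
  for a set without finite basis. The finite set \<open>F\<close> excludes this case.\<close>

lemma dim_mono_fin:
  assumes "U \<subseteq> span W" "W \<subseteq> span F" "finite F"
  shows "dim U \<le> dim W"
proof -
  obtain B where B: "B \<subseteq> U" "independent B" "U \<subseteq> span B" "card B = dim U"
    by (rule basis_exists)
  obtain D where D: "D \<subseteq> W" "independent D" "W \<subseteq> span D" "card D = dim W"
    by (rule basis_exists)
  have "finite D"
    using independent_span_bound[OF assms(3) D(2)] D(1) assms(2) by blast
  moreover have "B \<subseteq> span D"
    using B(1) assms(1) D(3) by (metis subset_trans span_minimal subspace_span)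
  ultimately show ?thesis
    using independent_span_bound[OF _ B(2)] B(4) D(4) by metis
qed

lemma subspace_projection:
  assumes "subspace U"
  obtains g where "Vector_Spaces.linear scale scale g" "range g \<subseteq> U" "\<And>u. u \<in> U \<Longrightarrow> g u = u"
proof -
  interpret vector_space_pair scale scale ..
  \<comment> \<open>A right inverse of the identity on \<open>U\<close>, with range in
    \<open>U\<close>, is a projection onto \<open>U\<close>.\<close>
  from linear_exists_right_inverse_on[OF linear_id assms]
  show ?thesis using that by auto
qed

end

text \<open>Rank-nullity on \<open>V\<close>: extend a basis \<open>B\<close> of the kernel to a
  basis \<open>D\<close> of \<open>V\<close>; then \<open>f\<close> maps \<open>D - B\<close>
  injectively onto a basis of the image.\<close>

lemma (in vector_space_pair) dim_image_kernel:
  assumes f: "Vector_Spaces.linear s1 s2 f" and V: "vs1.subspace V"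
    and F: "V \<subseteq> vs1.span F" "finite F"
  shows "vs1.dim V = vs2.dim (f ` V) + vs1.dim {x \<in> V. f x = 0}"
proof -
  let ?K = "{x \<in> V. f x = 0}"
  obtain B where B: "B \<subseteq> ?K" "vs1.independent B" "?K \<subseteq> vs1.span B" "card B = vs1.dim ?K"
    by (rule vs1.basis_exists)
  obtain D where D: "B \<subseteq> D" "D \<subseteq> V" "vs1.independent D" "V \<subseteq> vs1.span D"
    using vs1.maximal_independent_subset_extend[OF _ B(2), of V] B(1) by blast
  have finD: "finite D"
    using vs1.independent_span_bound[OF F(2) D(3)] D(2) F(1) by blast
  let ?C = "D - B"
  interpret f: Vector_Spaces.linear s1 s2 f by fact
  have inj: "inj_on f (vs1.span ?C)"
  proof (subst f.inj_on_iff_eq_0)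
    show "\<forall>x\<in>vs1.span ?C. f x = 0 \<longrightarrow> x = 0"
    proof (intro ballI impI)
      fix x assume x: "x \<in> vs1.span ?C" "f x = 0"
      have "x \<in> V"
        using x(1) D(2) vs1.span_minimal[OF _ V, of ?C] by blast
      then have xB: "x \<in> vs1.span B" using B(3) x(2) by blast
      \<comment> \<open>\<open>x\<close> lies in the span of \<open>D - B\<close> and in that of
        \<open>B\<close>; its unique coordinates over \<open>D\<close> vanish outside both sets,
        hence everywhere.\<close>
      have "vs1.representation D x b = 0" for b
        using vs1.representation_extend[OF D(3) x(1)] vs1.representation_extend[OF D(3) xB D(1)]
          vs1.representation_ne_zero by (metis DiffD2 Diff_subset)
      then show "x = 0"
        using vs1.sum_nonzero_representation_eq[OF D(3), of x] \<open>x \<in> V\<close> D(4) by auto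
    qed
  qed (rule vs1.subspace_span)
  have "vs2.independent (f ` ?C)"
    using inj D(3) vs1.independent_mono f.independent_injective_image by blast
  moreover have "f ` V \<subseteq> vs2.span (f ` ?C)"
  proof -
    have "V \<subseteq> vs1.span (?C \<union> B)" using D(1,4) by (simp add: Un_absorb2)
    moreover have "f y = 0" if "y \<in> vs1.span B" for y
      using f.eq_0_on_span[OF _ that] B(1) by blast
    ultimately show ?thesis
      unfolding f.span_image vs1.span_Un by (auto simp: f.add subset_iff)
  qed
  moreover have "f ` ?C \<subseteq> f ` V" using D(2) by blast
  ultimately have "vs2.dim (f ` V) = card (f ` ?C)" by (metis vs2.basis_card_eq_dim)
  also have "\<dots> = card ?C" by (meson card_image inj inj_on_subset vs1.span_superset)
  also have "\<dots> + card B = card D"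
    using D(1) finD by (metis card_Diff_subset card_mono finite_subset le_add_diff_inverse2)
  finally show ?thesis using B(4) vs1.basis_card_eq_dim[OF D(2,4,3)] by simp
qed

context vector_space
begin

text \<open>\<open>f\<close> plays the part of the quotient map modulo \<open>W\<close>, so that
  statements modulo \<open>W\<close> can be proved inside the same space.\<close>

lemma projection_complement:
  assumes W: "subspace W"
  obtains f where "Vector_Spaces.linear scale scale f" "\<And>x. f x = 0 \<longleftrightarrow> x \<in> W"
proof -
  interpret p: vector_space_pair scale scale ..
  obtain g where g: "Vector_Spaces.linear scale scale g" "range g \<subseteq> W" "\<And>u. u \<in> W \<Longrightarrow> g u = u"
    using subspace_projection[OF W] by blast
  have "Vector_Spaces.linear scale scale (\<lambda>x. x - g x)"
    by (intro p.linear_compose_sub linear_ident g(1))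
  moreover have "x - g x = 0 \<longleftrightarrow> x \<in> W" for x
    using g(2,3) by (metis eq_iff_diff_eq_0 range_subsetD)
  ultimately show ?thesis using that by blast
qed

text \<open>Take \<open>f\<close> with kernel \<open>U\<close>. It has the same image on the sum as
  on \<open>W\<close>, with kernels \<open>U\<close> and \<open>U \<inter> W\<close>, so
  rank-nullity applied twice gives the formula.\<close>

lemma dim_sum_Int:
  assumes U: "subspace U" and W: "subspace W"
    and F: "U \<subseteq> span F" "W \<subseteq> span F" "finite F"
  shows "dim {x + y |x y. x \<in> U \<and> y \<in> W} + dim (U \<inter> W) = dim U + dim W"
proof -
  interpret p: vector_space_pair scale scale ..
  let ?S = "{x + y |x y. x \<in> U \<and> y \<in> W}"
  obtain f where f: "Vector_Spaces.linear scale scale f" and ker: "\<And>x. f x = 0 \<longleftrightarrow> x \<in> U"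
    using projection_complement[OF U] by blast
  interpret f: Vector_Spaces.linear scale scale f by fact
  have S: "?S \<subseteq> span F"
    using F(1,2) span_add by fastforce
  have "dim ?S = dim (f ` ?S) + dim {x \<in> ?S. f x = 0}"
    by (rule p.dim_image_kernel[OF f subspace_sums[OF U W] S F(3)])
  moreover have "dim W = dim (f ` W) + dim {x \<in> W. f x = 0}"
    by (rule p.dim_image_kernel[OF f W F(2,3)])
  moreover have "f ` ?S = f ` W"
  proof
    have "f (x + y) = f y" if "x \<in> U" for x y
      using ker that by (simp add: f.add)
    then show "f ` ?S \<subseteq> f ` W" by auto
    show "f ` W \<subseteq> f ` ?S"
      using subspace_0[OF U] by force
  qed
  moreover have "{x \<in> ?S. f x = 0} = U"
    using ker subspace_0[OF W] by (auto, force)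
  moreover have "{x \<in> W. f x = 0} = U \<inter> W" using ker by auto
  ultimately show ?thesis by simp
qed

text \<open>With \<open>W\<close> the boundaries and \<open>V\<close> the cycles this bounds the
  number of independent homology classes. A family \<open>r\<close> is used because distinct indices
  are not known in advance to give distinct vectors.\<close>

lemma card_independent_mod_le:
  assumes W: "subspace W" and V: "subspace V" "W \<subseteq> V" and F: "V \<subseteq> span F" "finite F"
    and I: "finite I" "\<And>i. i \<in> I \<Longrightarrow> r i \<in> V"
    and indep: "\<And>c i. (\<Sum>i\<in>I. c i *s r i) \<in> W \<Longrightarrow> i \<in> I \<Longrightarrow> c i = 0"
  shows "card I + dim W \<le> dim V"
proof -
  interpret p: vector_space_pair scale scale ..
  obtain f where f: "Vector_Spaces.linear scale scale f" "\<And>x. f x = 0 \<longleftrightarrow> x \<in> W"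
    using projection_complement[OF W] by blast
  interpret f: Vector_Spaces.linear scale scale f by fact
  have zero: "c i = 0" if "(\<Sum>i\<in>I. c i *s f (r i)) = 0" "i \<in> I" for c i
    using indep[of c i] that by (simp add: f.sum f.scale flip: f(2))
  have inj: "inj_on (\<lambda>i. f (r i)) I"
  proof (rule inj_onI, rule ccontr)
    fix i j assume ij: "i \<in> I" "j \<in> I" "f (r i) = f (r j)" "i \<noteq> j"
    \<comment> \<open>Two indices with the same image would yield a nontrivial relation with
      coefficients 1 and -1.\<close>
    let ?c = "\<lambda>k. if k = i then 1 else if k = j then - 1 else 0"
    have "(\<Sum>k\<in>I. ?c k *s f (r k)) = (\<Sum>k\<in>{i, j}. ?c k *s f (r k))"
      by (rule sum.mono_neutral_right) (use ij I(1) in auto)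
    also have "\<dots> = 0" using ij by simp
    finally show False using zero[of ?c i] ij(1) by simp
  qed
  have "independent ((\<lambda>i. f (r i)) ` I)"
  proof (rule independent_if_scalars_zero)
    fix c x assume "(\<Sum>x\<in>(\<lambda>i. f (r i)) ` I. c x *s x) = 0" "x \<in> (\<lambda>i. f (r i)) ` I"
    then show "c x = 0"
      using zero[of "\<lambda>i. c (f (r i))"] by (auto simp: sum.reindex[OF inj])
  qed (use I(1) in simp)
  then have "card I = dim (span ((\<lambda>i. f (r i)) ` I))"
    using dim_span_eq_card_independent card_image[OF inj] by metis
  also have "\<dots> = dim ((\<lambda>i. f (r i)) ` I)" by simp
  also have "\<dots> \<le> dim (f ` V)"
  proof (rule dim_mono_fin[of _ _ "f ` F"])
    show "(\<lambda>i. f (r i)) ` I \<subseteq> span (f ` V)"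
      using I(2) by (auto intro!: span_base)
    show "f ` V \<subseteq> span (f ` F)"
      using F(1) by (auto simp: f.span_image)
  qed (use F(2) in simp)
  finally have "card I \<le> dim (f ` V)" .
  moreover have "{x \<in> V. f x = 0} = W" using V(2) f(2) by auto
  ultimately show ?thesis using p.dim_image_kernel[OF f(1) V(1) F] by simp
qed

text \<open>The independent vectors are taken from a prescribed spanning set \<open>T\<close>; with
  \<open>T\<close> the integral cycles this yields integral representatives of a rational homology
  basis.\<close>

lemma exists_independent_mod:
  assumes W: "subspace W" and V: "subspace V" "W \<subseteq> V" and F: "V \<subseteq> span F" "finite F"
    and T: "T \<subseteq> V" "V \<subseteq> span T"
  obtains R where "R \<subseteq> T" "finite R" "card R + dim W = dim V"
    "\<And>c r. (\<Sum>r\<in>R. c r *s r) \<in> W \<Longrightarrow> r \<in> R \<Longrightarrow> c r = 0"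
proof -
  interpret p: vector_space_pair scale scale ..
  obtain f where f: "Vector_Spaces.linear scale scale f" "\<And>x. f x = 0 \<longleftrightarrow> x \<in> W"
    using projection_complement[OF W] by blast
  interpret f: Vector_Spaces.linear scale scale f by fact
  obtain B where B: "B \<subseteq> f ` T" "independent B" "f ` T \<subseteq> span B" "card B = dim (f ` T)"
    by (rule basis_exists)
  have "finite B"
  proof -
    have "B \<subseteq> span (f ` F)"
      using B(1) T(1) F(1) f.span_image[of F] by blast
    then show ?thesis using independent_span_bound[of "f ` F" B] F(2) B(2) by blast
  qed
  obtain R where R: "R \<subseteq> T" "inj_on f R" "f ` R = B"
    using B(1) by (metis subset_image_inj)
  have finR: "finite R" using R(2,3) \<open>finite B\<close> by (metis finite_image_iff)
  have "span (f ` T) = span (f ` V)"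
  proof (rule antisym)
    show "span (f ` V) \<subseteq> span (f ` T)"
      by (rule span_minimal[OF _ subspace_span]) (use T(2) f.span_image[of T] in blast)
  qed (use T(1) in \<open>auto intro!: span_mono\<close>)
  then have "dim (f ` V) = card R"
    using B(4) R(2,3) card_image[OF R(2)] by (metis dim_span)
  moreover have "{x \<in> V. f x = 0} = W" using V(2) f(2) by auto
  ultimately have "card R + dim W = dim V"
    using p.dim_image_kernel[OF f(1) V(1) F] by simp
  moreover have "c r = 0" if c: "(\<Sum>r\<in>R. c r *s r) \<in> W" "r \<in> R" for c r
  proof -
    have "(\<Sum>r\<in>R. c r *s f r) = 0"
      using c(1) f(2) by (simp add: f.sum f.scale flip: f(2))
    then have "(\<Sum>b\<in>B. c (inv_into R f b) *s b) = 0"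
      unfolding R(3)[symmetric] sum.reindex[OF R(2)] using R(2) by simp
    then have "c (inv_into R f (f r)) = 0"
      using independentD[OF B(2) \<open>finite B\<close> subset_refl, of "\<lambda>b. c (inv_into R f b)" "f r"]
        c(2) R(3) by blast
    then show ?thesis using R(2) c(2) by simp
  qed
  ultimately show ?thesis using that R(1) finR by blast
qed

end

section \<open>Rational chains\<close>

definition qscale :: "rat \<Rightarrow> ('c \<Rightarrow>\<^sub>0 rat) \<Rightarrow> ('c \<Rightarrow>\<^sub>0 rat)" where
  "qscale r = Poly_Mapping.map ((*) r)"

lemma lookup_qscale [simp]: "Poly_Mapping.lookup (qscale r x) S = r * Poly_Mapping.lookup x S"
  by (simp add: qscale_def map.rep_eq when_def)

global_interpretation qv: vector_space qscale
  by standard (auto intro!: poly_mapping_eqI simp: lookup_add algebra_simps)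

abbreviation qlinear :: "(('c \<Rightarrow>\<^sub>0 rat) \<Rightarrow> ('c \<Rightarrow>\<^sub>0 rat)) \<Rightarrow> bool" where
  "qlinear \<equiv> Vector_Spaces.linear qscale qscale"

abbreviation qcell :: "'c \<Rightarrow> ('c \<Rightarrow>\<^sub>0 rat)" where
  "qcell S \<equiv> Poly_Mapping.single S 1"

definition qchains :: "'c set \<Rightarrow> ('c \<Rightarrow>\<^sub>0 rat) set" where
  "qchains X = {x. Poly_Mapping.keys x \<subseteq> X}"

definition qext :: "('c \<Rightarrow> ('c \<Rightarrow>\<^sub>0 rat)) \<Rightarrow> ('c \<Rightarrow>\<^sub>0 rat) \<Rightarrow> ('c \<Rightarrow>\<^sub>0 rat)" where
  "qext F x = (\<Sum>S\<in>Poly_Mapping.keys x. qscale (Poly_Mapping.lookup x S) (F S))"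

lemma qchains_iff: "x \<in> qchains X \<longleftrightarrow> (\<forall>S. Poly_Mapping.lookup x S \<noteq> 0 \<longrightarrow> S \<in> X)"
  by (auto simp: qchains_def in_keys_iff)

lemma subspace_qchains [simp]: "qv.subspace (qchains X)"
  by (rule qv.subspaceI) (auto simp: qchains_iff lookup_add, metis add.right_neutral)

lemmas qchains_closed =
  qv.subspace_add[OF subspace_qchains] qv.subspace_diff[OF subspace_qchains]
  qv.subspace_neg[OF subspace_qchains] qv.subspace_scale[OF subspace_qchains]
  qv.subspace_0[OF subspace_qchains] qv.subspace_sum[OF subspace_qchains]

lemma qcell_in_qchains [simp]: "qcell S \<in> qchains X \<longleftrightarrow> S \<in> X"
  by (simp add: qchains_def)

lemma qchains_mono: "X \<subseteq> Y \<Longrightarrow> qchains X \<subseteq> qchains Y"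
  by (auto simp: qchains_def)

lemma qext_superset:
  "finite A \<Longrightarrow> Poly_Mapping.keys x \<subseteq> A \<Longrightarrow>
    qext F x = (\<Sum>S\<in>A. qscale (Poly_Mapping.lookup x S) (F S))"
  unfolding qext_def by (rule sum.mono_neutral_left) (auto simp: in_keys_iff)

lemma qlinear_qext:
  fixes F :: "'c \<Rightarrow> ('c \<Rightarrow>\<^sub>0 rat)"
  shows "qlinear (qext F)"
proof -
  interpret vector_space_pair "qscale :: rat \<Rightarrow> ('c \<Rightarrow>\<^sub>0 rat) \<Rightarrow> _" "qscale :: rat \<Rightarrow> ('c \<Rightarrow>\<^sub>0 rat) \<Rightarrow> _" ..
  show ?thesis
  proof (unfold Vector_Spaces.linear_iff, intro conjI allI)
    fix x y :: "'c \<Rightarrow>\<^sub>0 rat" and r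
    let ?A = "Poly_Mapping.keys x \<union> Poly_Mapping.keys y"
    show "qext F (x + y) = qext F x + qext F y"
      using qext_superset[of ?A "x + y" F] qext_superset[of ?A x F] qext_superset[of ?A y F]
        keys_add[of x y]
      by (simp add: lookup_add qv.scale_left_distrib sum.distrib)
    have "Poly_Mapping.keys (qscale r x) \<subseteq> Poly_Mapping.keys x"
      by (auto simp: in_keys_iff)
    then show "qext F (qscale r x) = qscale r (qext F x)"
      using qext_superset[of "Poly_Mapping.keys x" "qscale r x" F]
      by (simp add: qext_def qv.scale_sum_right)
  qed (unfold_locales)
qed

lemma qext_simps:
  "qext F 0 = 0" "qext F (x + y) = qext F x + qext F y" "qext F (x - y) = qext F x - qext F y"
  "qext F (- x) = - qext F x" "qext F (qscale r x) = qscale r (qext F x)"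
  "qext F (sum g A) = (\<Sum>a\<in>A. qext F (g a))"
proof -
  interpret Vector_Spaces.linear qscale qscale "qext F" by (rule qlinear_qext)
  show "qext F 0 = 0" "qext F (x + y) = qext F x + qext F y" "qext F (x - y) = qext F x - qext F y"
    "qext F (- x) = - qext F x" "qext F (qscale r x) = qscale r (qext F x)"
    "qext F (sum g A) = (\<Sum>a\<in>A. qext F (g a))"
    by (rule zero add diff neg scale sum)+
qed

lemma qext_cell [simp]: "qext F (qcell S) = F S"
  by (simp add: qext_def)

lemma chain_expansion: "x = (\<Sum>S\<in>Poly_Mapping.keys x. qscale (Poly_Mapping.lookup x S) (qcell S))"
proof (rule poly_mapping_eqI)
  fix T
  have "(\<Sum>S\<in>Poly_Mapping.keys x. Poly_Mapping.lookup x S * (if S = T then 1 else 0))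
      = (\<Sum>S\<in>Poly_Mapping.keys x. if S = T then Poly_Mapping.lookup x S else 0)"
    by (rule sum.cong) auto
  also have "\<dots> = Poly_Mapping.lookup x T"
    by (simp add: sum.delta' in_keys_iff)
  finally show "Poly_Mapping.lookup x T
      = Poly_Mapping.lookup (\<Sum>S\<in>Poly_Mapping.keys x. qscale (Poly_Mapping.lookup x S) (qcell S)) T"
    by (simp add: lookup_sum lookup_single when_def)
qed

lemma qchains_eq_span: "qchains X = qv.span (qcell ` X)"
proof (rule antisym)
  show "qv.span (qcell ` X) \<subseteq> qchains X"
    by (rule qv.span_minimal) auto
  show "qchains X \<subseteq> qv.span (qcell ` X)"
  proof
    fix x assume "x \<in> qchains X"
    then have "(\<Sum>S\<in>Poly_Mapping.keys x. qscale (Poly_Mapping.lookup x S) (qcell S)) \<in> qv.span (qcell ` X)"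
      by (intro qv.span_sum qv.span_scale qv.span_base) (auto simp: qchains_def)
    then show "x \<in> qv.span (qcell ` X)" using chain_expansion[of x] by simp
  qed
qed

lemma qchains_induct [consumes 1, case_names zero cell add scale]:
  assumes "x \<in> qchains X" "P 0" "\<And>S. S \<in> X \<Longrightarrow> P (qcell S)"
    "\<And>x y. x \<in> qchains X \<Longrightarrow> y \<in> qchains X \<Longrightarrow> P x \<Longrightarrow> P y \<Longrightarrow> P (x + y)"
    "\<And>r x. x \<in> qchains X \<Longrightarrow> P x \<Longrightarrow> P (qscale r x)"
  shows "P x"
proof -
  have "x \<in> qv.span (qcell ` X)" using assms(1) qchains_eq_span by blast
  then have "x \<in> qchains X \<and> P x"
    by (induction rule: qv.span_induct_alt)
      (auto intro!: assms(2-5) qchains_closed)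
  then show ?thesis by blast
qed

lemma qlinear_eq_on_qchains:
  assumes "qlinear f" "qlinear g" "\<And>S. S \<in> X \<Longrightarrow> f (qcell S) = g (qcell S)" "x \<in> qchains X"
  shows "f x = g x"
proof -
  interpret f: Vector_Spaces.linear qscale qscale f by fact
  interpret g: Vector_Spaces.linear qscale qscale g by fact
  show ?thesis using assms(4)
    by (induction rule: qchains_induct) (auto simp: assms(3) f.add g.add f.scale g.scale)
qed

text \<open>Often used with \<open>f\<close> the identity: a subspace that contains the cells of
  \<open>X\<close> contains all chains of \<open>X\<close>.\<close>

lemma qlinear_qchains_into:
  assumes "qlinear f" "\<And>S. S \<in> X \<Longrightarrow> f (qcell S) \<in> U" "qv.subspace U" "x \<in> qchains X"
  shows "f x \<in> U"
proof -
  interpret f: Vector_Spaces.linear qscale qscale f by fact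
  show ?thesis using assms(4)
    by (induction rule: qchains_induct)
      (auto simp: assms(2) f.add f.scale intro: qv.subspace_0 qv.subspace_add qv.subspace_scale assms(3))
qed

lemma qext_in_qchains: "(\<And>S. S \<in> X \<Longrightarrow> F S \<in> qchains Y) \<Longrightarrow> x \<in> qchains X \<Longrightarrow> qext F x \<in> qchains Y"
  by (rule qlinear_qchains_into[OF qlinear_qext]) auto

lemma dim_qchains:
  assumes "finite X"
  shows "qv.dim (qchains X) = card X"
proof -
  have inj: "inj_on qcell X" by (auto simp: inj_on_def dest: arg_cong[of _ _ Poly_Mapping.keys])
  have "qv.independent (qcell ` X)"
  proof (rule qv.independent_if_scalars_zero)
    fix f x assume s: "(\<Sum>x\<in>qcell ` X. qscale (f x) x) = 0" and x: "x \<in> qcell ` X"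
    then obtain S where S: "S \<in> X" "x = qcell S" by blast
    have "(\<Sum>T\<in>X. f (qcell T) * (if T = S then 1 else 0)) = 0"
      using arg_cong[OF s, of "\<lambda>z. Poly_Mapping.lookup z S"] inj
      by (simp add: sum.reindex lookup_sum lookup_single when_def)
    moreover have "(\<Sum>T\<in>X. f (qcell T) * (if T = S then 1 else 0)) = (\<Sum>T\<in>X. if T = S then f (qcell T) else 0)"
      by (rule sum.cong) auto
    ultimately show "f x = 0" using S assms by (simp add: sum.delta')
  qed (use assms in simp)
  then have "qv.dim (qv.span (qcell ` X)) = card (qcell ` X)"
    by (rule qv.dim_span_eq_card_independent)
  then show ?thesis using qchains_eq_span[of X] inj by (simp add: card_image)
qed

lemma q_dim_image_kernel:
  assumes "qlinear f" "qv.subspace V" "V \<subseteq> qchains X" "finite X"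
  shows "qv.dim V = qv.dim (f ` V) + qv.dim {x \<in> V. f x = 0}"
proof -
  interpret vector_space_pair "qscale :: rat \<Rightarrow> ('a \<Rightarrow>\<^sub>0 rat) \<Rightarrow> _" "qscale :: rat \<Rightarrow> ('a \<Rightarrow>\<^sub>0 rat) \<Rightarrow> _" ..
  show ?thesis
    by (rule dim_image_kernel[of f V "qcell ` X"]) (use assms qchains_eq_span[of X] in auto)
qed

lemma q_dim_sum_Int:
  assumes "qv.subspace U" "qv.subspace W" "U \<subseteq> qchains X" "W \<subseteq> qchains X" "finite X"
  shows "qv.dim {x + y |x y. x \<in> U \<and> y \<in> W} + qv.dim (U \<inter> W) = qv.dim U + qv.dim W"
  by (rule qv.dim_sum_Int[of U W "qcell ` X"]) (use assms qchains_eq_span[of X] in auto)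

subsection \<open>Comparison with integral chains\<close>

definition ratify :: "('c \<Rightarrow>\<^sub>0 int) \<Rightarrow> ('c \<Rightarrow>\<^sub>0 rat)" where
  "ratify = Poly_Mapping.map of_int"

lemma lookup_ratify [simp]: "Poly_Mapping.lookup (ratify x) S = of_int (Poly_Mapping.lookup x S)"
  by (simp add: ratify_def map.rep_eq when_def)

lemma ratify_simps [simp]:
  "ratify 0 = 0" "ratify (x + y) = ratify x + ratify y" "ratify (x - y) = ratify x - ratify y"
  "ratify (- x) = - ratify x" "ratify (frag_cmul c x) = qscale (of_int c) (ratify x)"
  "ratify (sum f A) = (\<Sum>a\<in>A. ratify (f a))" "ratify (frag_of S) = qcell S"
  by (auto intro!: poly_mapping_eqI simp: lookup_add lookup_minus lookup_sum lookup_single when_def)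

lemma keys_ratify [simp]: "Poly_Mapping.keys (ratify x) = Poly_Mapping.keys x"
  by (auto simp: in_keys_iff)

lemma ratify_eq_iff [simp]: "ratify x = ratify y \<longleftrightarrow> x = y"
  by (metis lookup_ratify of_int_eq_iff poly_mapping_eqI)

lemma ratify_eq_0_iff [simp]: "ratify x = 0 \<longleftrightarrow> x = 0"
  using ratify_eq_iff[of x 0] by simp

lemma ratify_in_qchains [simp]: "ratify x \<in> qchains X \<longleftrightarrow> Poly_Mapping.keys x \<subseteq> X"
  by (simp add: qchains_def)

lemma ratify_frag_extend: "ratify (frag_extend F x) = qext (\<lambda>S. ratify (F S)) (ratify x)"
  by (simp add: frag_extend_def qext_def)

text \<open>Only finitely many coefficients are nonzero, so the product of their denominators is a
  common one.\<close>

lemma clear_denominators: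
  obtains N y where "N > (0::int)" "qscale (of_int N) x = ratify y"
proof -
  have "\<exists>N > (0::int). \<forall>S\<in>Poly_Mapping.keys x. of_int N * Poly_Mapping.lookup x S \<in> \<int>"
    if "finite A" "A = Poly_Mapping.keys x" for A
  proof -
    let ?d = "\<lambda>S. snd (quotient_of (Poly_Mapping.lookup x S))"
    have pos: "?d S > 0" for S by (rule quotient_of_denom_pos')
    show ?thesis
    proof (intro exI conjI ballI)
      show "prod ?d A > 0" by (rule prod_pos) (use pos in auto)
      fix S assume S: "S \<in> Poly_Mapping.keys x"
      have "Poly_Mapping.lookup x S = of_int (fst (quotient_of (Poly_Mapping.lookup x S))) / of_int (?d S)"
        by (metis prod.collapse quotient_of_div)
      then have "of_int (?d S) * Poly_Mapping.lookup x S = of_int (fst (quotient_of (Poly_Mapping.lookup x S)))"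
        using pos[of S] by (simp add: field_simps)
      moreover have "prod ?d A = prod ?d (A - {S}) * ?d S"
        using that S by (simp add: prod.remove mult.commute)
      ultimately show "of_int (prod ?d A) * Poly_Mapping.lookup x S \<in> \<int>"
        by (simp add: mult.assoc) (metis Ints_mult Ints_of_int of_int_prod)
    qed
  qed
  then obtain N :: int where N: "N > 0" "\<And>S. S\<in>Poly_Mapping.keys x \<Longrightarrow> of_int N * Poly_Mapping.lookup x S \<in> \<int>"
    by auto
  have N': "of_int N * Poly_Mapping.lookup x S \<in> \<int>" for S
    using N(2)[of S] by (cases "S \<in> Poly_Mapping.keys x") (auto simp: in_keys_iff)
  \<comment> \<open>The values are integers by \<open>N'\<close>; the floor merely changes their
    type from \<open>rat\<close> to \<open>int\<close>.\<close>
  define y where "y = Poly_Mapping.map (\<lambda>q. \<lfloor>of_int N * q\<rfloor>) x"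
  have "qscale (of_int N) x = ratify y"
    using N' by (intro poly_mapping_eqI) (auto simp: y_def map.rep_eq when_def elim!: Ints_cases)
  then show ?thesis using that N(1) by blast
qed

section \<open>The rational cubical chain complex\<close>

definition edges :: "('a, 'b) gcell set \<Rightarrow> 'b set" where
  "edges S = {e. Edge e \<in> S}"

definition esgn :: "'b set \<Rightarrow> 'b \<Rightarrow> rat" where
  "esgn E e = (- 1) ^ card {e' \<in> E. e' \<noteq> e \<and> (e', e) \<in> arc_order}"

definition face :: "('b \<Rightarrow> 'a) \<Rightarrow> ('a, 'b) gcell set \<Rightarrow> 'b \<Rightarrow> ('a, 'b) gcell set" where
  "face h S e = insert (Vertex (h e)) (S - {Edge e})"

definition qbd :: "('a, 'b) pre_digraph \<Rightarrow> (('a, 'b) gcell set \<Rightarrow>\<^sub>0 rat) \<Rightarrow> (('a, 'b) gcell set \<Rightarrow>\<^sub>0 rat)" where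
  "qbd G = qext (\<lambda>S. ratify (cube_boundary G S))"

text \<open>Finiteness of each cell is demanded because \<open>cube_dim\<close> is a
  \<open>card\<close>: an infinite set of edges would count as dimension 0.\<close>

definition cube_complex :: "('a, 'b) pre_digraph \<Rightarrow> ('a, 'b) gcell set set \<Rightarrow> bool" where
  "cube_complex G X \<longleftrightarrow> finite X \<and>
    (\<forall>S\<in>X. finite S \<and> (\<forall>e\<in>edges S. face (head G) S e \<in> X \<and> face (tail G) S e \<in> X))"

definition cells :: "nat \<Rightarrow> ('a, 'b) gcell set set \<Rightarrow> ('a, 'b) gcell set set" where
  "cells p X = {S \<in> X. cube_dim S = p}"

lemma ratify_bd: "ratify (bd G x) = qbd G (ratify x)"
  by (simp add: bd_def qbd_def ratify_frag_extend)

lemma qlinear_qbd: "qlinear (qbd G)"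
  unfolding qbd_def by (rule qlinear_qext)

lemmas qbd_simps = qext_simps[of "\<lambda>S. ratify (cube_boundary G S)" for G, folded qbd_def]

lemma qbd_cell:
  "qbd G (qcell S) = (\<Sum>e\<in>edges S. qscale (esgn (edges S) e)
     (qcell (face (head G) S e) - qcell (face (tail G) S e)))"
  by (simp add: qbd_def cube_boundary_def edges_def esgn_def face_def)

lemma cube_dim_edges: "cube_dim S = card (edges S)"
  by (simp add: cube_dim_def edges_def)

lemma finite_edges: "finite S \<Longrightarrow> finite (edges S)"
  using finite_vimageI[of S Edge] by (simp add: edges_def vimage_def inj_on_def)

lemma edges_face [simp]: "edges (face h S e) = edges S - {e}"
  by (auto simp: edges_def face_def)

lemma finite_cells: "finite X \<Longrightarrow> finite (cells p X)"
  by (simp add: cells_def)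

lemma cells_mono: "X \<subseteq> Y \<Longrightarrow> cells p X \<subseteq> cells p Y"
  by (auto simp: cells_def)

lemma cells_Int: "cells p (X \<inter> Y) = cells p X \<inter> cells p Y"
  by (auto simp: cells_def)

lemma cells_Un: "cells p (X \<union> Y) = cells p X \<union> cells p Y"
  by (auto simp: cells_def)

lemma face_cells:
  assumes "cube_complex G X" "S \<in> cells (Suc p) X" "e \<in> edges S"
  shows "face (head G) S e \<in> cells p X" "face (tail G) S e \<in> cells p X"
  using assms by (auto simp: cube_complex_def cells_def cube_dim_edges finite_edges)

lemma qbd_in_cells:
  assumes "cube_complex G X" "x \<in> qchains (cells (Suc p) X)"
  shows "qbd G x \<in> qchains (cells p X)"
  by (rule qlinear_qchains_into[OF qlinear_qbd _ _ assms(2)])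
    (auto simp: qbd_cell intro!: qchains_closed face_cells[OF assms(1)])

lemma qbd_in_complex:
  assumes "cube_complex G X" "x \<in> qchains X"
  shows "qbd G x \<in> qchains X"
  by (rule qlinear_qchains_into[OF qlinear_qbd _ _ assms(2)])
    (use assms(1) in \<open>auto simp: qbd_cell cube_complex_def intro!: qchains_closed\<close>)

lemma qbd_cells_0:
  assumes "cube_complex G X" "x \<in> qchains (cells 0 X)"
  shows "qbd G x = 0"
proof -
  have "qbd G x \<in> {0}"
    by (rule qlinear_qchains_into[OF qlinear_qbd _ _ assms(2)])
      (use assms(1) in \<open>auto simp: qbd_cell cube_complex_def cells_def cube_dim_edges finite_edges\<close>)
  then show ?thesis by simp
qed

section \<open>Incidence signs, and the boundary of a boundary\<close>

lemma linear_order_arc_order: "linear_order (arc_order :: 'b rel)"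
proof -
  \<comment> \<open>A well-order of all arcs is a linear order, so the choice in
    \<open>arc_order\<close> has a witness.\<close>
  obtain r :: "'b rel" where "well_order_on UNIV r"
    using well_order_on by blast
  then have "linear_order r" by (simp add: well_order_on_def)
  then show ?thesis unfolding arc_order_def by (rule someI)
qed

lemma arc_order_total: "e \<noteq> f \<Longrightarrow> (e, f) \<notin> arc_order \<longleftrightarrow> (f, e) \<in> arc_order"
  using linear_order_arc_order
  by (auto simp: linear_order_on_def partial_order_on_def total_on_def antisym_def)

text \<open>The exponent counts the edges before \<open>f\<close>; it drops by one exactly if
  \<open>e\<close> was among them.\<close>

lemma esgn_delete:
  assumes "finite E" "e \<in> E" "e \<noteq> f"
  shows "esgn (E - {e}) f = (if (e, f) \<in> arc_order then - esgn E f else esgn E f)"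
proof (cases "(e, f) \<in> arc_order")
  case True
  then have "{e' \<in> E. e' \<noteq> f \<and> (e', f) \<in> arc_order}
      = insert e {e' \<in> E - {e}. e' \<noteq> f \<and> (e', f) \<in> arc_order}"
    using assms by auto
  then show ?thesis using True assms(1) by (simp add: esgn_def)
next
  case False
  then have "{e' \<in> E. e' \<noteq> f \<and> (e', f) \<in> arc_order}
      = {e' \<in> E - {e}. e' \<noteq> f \<and> (e', f) \<in> arc_order}"
    by auto
  then show ?thesis using False by (simp add: esgn_def)
qed

text \<open>Of two distinct edges exactly one precedes the other, so exactly one of the two
  deletions changes a sign.\<close>

lemma esgn_delete_antisym:
  assumes "finite E" "e \<in> E" "f \<in> E" "e \<noteq> f"
  shows "esgn E e * esgn (E - {e}) f = - (esgn E f * esgn (E - {f}) e)"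
  using assms arc_order_total[of e f] by (auto simp: esgn_delete)

lemma sum_antisym_zero:
  fixes g :: "'e \<Rightarrow> 'e \<Rightarrow> rat"
  assumes "\<And>e f. e \<in> E \<Longrightarrow> f \<in> E \<Longrightarrow> e \<noteq> f \<Longrightarrow> g e f = - g f e" "finite E"
  shows "(\<Sum>e\<in>E. \<Sum>f\<in>E - {e}. g e f) = 0"
proof -
  \<comment> \<open>Filling the diagonal with zeros gives a square index set, on which exchanging
    the two sums turns the total into its negative.\<close>
  let ?g = "\<lambda>e f. if e = f then 0 else g e f"
  have *: "(\<Sum>f\<in>E - {e}. g e f) = (\<Sum>f\<in>E. ?g e f)" if "e \<in> E" for e
    by (rule sum.mono_neutral_cong_left) (use assms(2) in auto)
  have "(\<Sum>e\<in>E. \<Sum>f\<in>E. ?g e f) = (\<Sum>f\<in>E. \<Sum>e\<in>E. ?g e f)"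
    by (rule sum.swap)
  also have "\<dots> = (\<Sum>f\<in>E. \<Sum>e\<in>E. - ?g f e)"
  proof (intro sum.cong refl)
    fix e f assume "e \<in> E" "f \<in> E"
    then show "?g e f = - ?g f e" using assms(1)[of e f] by simp
  qed
  finally have "(\<Sum>e\<in>E. \<Sum>f\<in>E. ?g e f) = 0"
    by (simp add: sum_negf)
  then show ?thesis using * by simp
qed

text \<open>Faces along two edges commute, so the second difference \<open>?D e f\<close> is
  symmetric while its sign is antisymmetric, and the terms cancel in pairs.\<close>

lemma qbd_qbd_cell:
  fixes G :: "('a, 'b) pre_digraph"
  assumes "finite S"
  shows "qbd G (qbd G (qcell S)) = 0"
proof (rule poly_mapping_eqI)
  fix T :: "('a, 'b) gcell set"
  let ?E = "edges S" and ?L = "\<lambda>x. Poly_Mapping.lookup x T"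
  let ?D = "\<lambda>e f. ?L (qcell (face (head G) (face (head G) S e) f))
    - ?L (qcell (face (tail G) (face (head G) S e) f))
    - ?L (qcell (face (head G) (face (tail G) S e) f))
    + ?L (qcell (face (tail G) (face (tail G) S e) f))"
  have comm: "face h (face h' S e) f = face h' (face h S f) e" for h h' e f
    by (auto simp: face_def)
  have D: "?D e f = ?D f e" for e f
    unfolding comm[of "head G" "head G" e f] comm[of "head G" "tail G" e f]
      comm[of "tail G" "head G" e f] comm[of "tail G" "tail G" e f] by simp
  have "?L (qbd G (qbd G (qcell S))) = (\<Sum>e\<in>?E. esgn ?E e *
      ((\<Sum>f\<in>?E - {e}. esgn (?E - {e}) f * (?L (qcell (face (head G) (face (head G) S e) f))
          - ?L (qcell (face (tail G) (face (head G) S e) f))))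
        - (\<Sum>f\<in>?E - {e}. esgn (?E - {e}) f * (?L (qcell (face (head G) (face (tail G) S e) f))
          - ?L (qcell (face (tail G) (face (tail G) S e) f))))))"
    by (simp only: qbd_cell qbd_simps lookup_sum lookup_minus lookup_qscale edges_face)
  also have "\<dots> = (\<Sum>e\<in>?E. \<Sum>f\<in>?E - {e}. esgn ?E e * esgn (?E - {e}) f * ?D e f)"
    unfolding sum_subtractf[symmetric] sum_distrib_left
    by (intro sum.cong refl) (simp only: algebra_simps)
  also have "\<dots> = 0"
  proof (rule sum_antisym_zero)
    fix e f assume ef: "e \<in> ?E" "f \<in> ?E" "e \<noteq> f"
    show "esgn ?E e * esgn (?E - {e}) f * ?D e f = - (esgn ?E f * esgn (?E - {f}) e * ?D f e)"
      using esgn_delete_antisym[OF finite_edges[OF assms] ef] D[of e f] by simp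
  qed (rule finite_edges[OF assms])
  finally show "?L (qbd G (qbd G (qcell S))) = ?L 0" by simp
qed

lemma qbd_qbd:
  assumes "cube_complex G X" "x \<in> qchains X"
  shows "qbd G (qbd G x) = 0"
proof -
  have "(qbd G \<circ> qbd G) x \<in> {0}"
    by (rule qlinear_qchains_into[OF Vector_Spaces.linear_compose[OF qlinear_qbd qlinear_qbd] _ _ assms(2)])
      (use assms(1) in \<open>auto simp: cube_complex_def qbd_qbd_cell\<close>)
  then show ?thesis by simp
qed

subsection \<open>Ranks and Mayer--Vietoris\<close>

definition bd_rank :: "('a, 'b) pre_digraph \<Rightarrow> nat \<Rightarrow> ('a, 'b) gcell set set \<Rightarrow> nat" where
  "bd_rank G p X = qv.dim (qbd G ` qchains (cells p X))"

definition cycles :: "('a, 'b) pre_digraph \<Rightarrow> nat \<Rightarrow> ('a, 'b) gcell set set \<Rightarrow> (('a, 'b) gcell set \<Rightarrow>\<^sub>0 rat) set" where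
  "cycles G p X = {x \<in> qchains (cells p X). qbd G x = 0}"

text \<open>Integer-valued, so that differences of Betti numbers are not truncated.\<close>

definition hrank :: "('a, 'b) pre_digraph \<Rightarrow> nat \<Rightarrow> ('a, 'b) gcell set set \<Rightarrow> int" where
  "hrank G p X = int (qv.dim (cycles G p X)) - int (bd_rank G (Suc p) X)"

lemma subspace_cycles [simp]: "qv.subspace (cycles G p X)"
  by (rule qv.subspaceI) (auto simp: cycles_def qbd_simps intro: qchains_closed)

lemma subspace_qlinear_image: "qlinear f \<Longrightarrow> qv.subspace U \<Longrightarrow> qv.subspace (f ` U)"
  using module_hom.subspace_image[of qscale qscale f U] by (simp add: module_hom_iff_linear)

lemma subspace_boundaries [simp]: "qv.subspace (qbd G ` qchains X)"
  by (rule subspace_qlinear_image[OF qlinear_qbd subspace_qchains])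

lemma boundaries_subset_cycles:
  "cube_complex G X \<Longrightarrow> qbd G ` qchains (cells (Suc p) X) \<subseteq> cycles G p X"
  using qchains_mono[of "cells (Suc p) X" X]
  by (auto simp: cycles_def cells_def qbd_in_cells[unfolded cells_def] qbd_qbd)

text \<open>Rank-nullity eliminates the cycles. Besides boundary ranks only a number of cells
  remains, for which inclusion-exclusion is immediate.\<close>

lemma hrank_eq:
  assumes "finite X"
  shows "hrank G p X = int (card (cells p X)) - int (bd_rank G p X) - int (bd_rank G (Suc p) X)"
proof -
  have "card (cells p X) = bd_rank G p X + qv.dim (cycles G p X)"
    using q_dim_image_kernel[OF qlinear_qbd subspace_qchains subset_refl finite_cells[OF assms]]
      dim_qchains[OF finite_cells[OF assms]]
    by (metis bd_rank_def cycles_def)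
  then show ?thesis by (simp add: hrank_def)
qed

lemma qchains_Un: "qchains (X \<union> Y) = {x + y |x y. x \<in> qchains X \<and> y \<in> qchains Y}"
  by (simp add: qchains_eq_span image_Un qv.span_Un)

text \<open>\<open>X\<close> and \<open>Y\<close> need not be closed under faces, so the finite
  support of all boundaries is collected from the cells themselves. It serves as the
  finite-dimensional ambient space.\<close>

lemma qchains_finite_image:
  assumes "finite X" "finite Y"
  obtains W where "finite W" "qbd G ` qchains X \<subseteq> qchains W" "qbd G ` qchains Y \<subseteq> qchains W"
proof -
  let ?W = "\<Union>S\<in>X \<union> Y. Poly_Mapping.keys (cube_boundary G S)"
  have "qbd G x \<in> qchains ?W" if "x \<in> qchains (X \<union> Y)" for x
    unfolding qbd_def by (rule qext_in_qchains[OF _ that]) auto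
  then show ?thesis
    using that[of ?W] assms qchains_mono[of X "X \<union> Y"] qchains_mono[of Y "X \<union> Y"] by auto
qed

text \<open>The hypothesis makes the boundary spaces of \<open>X\<close> and \<open>Y\<close> meet
  in that of \<open>X \<inter> Y\<close>; their sum is that of the union, and the dimension formula
  for sums applies.\<close>

lemma bd_rank_Un:
  assumes fin: "finite X" "finite Y"
    and mv: "\<And>a b. a \<in> qchains (cells p X) \<Longrightarrow> b \<in> qchains (cells p Y) \<Longrightarrow> qbd G a = qbd G b \<Longrightarrow>
      qbd G a \<in> qbd G ` qchains (cells p (X \<inter> Y))"
  shows "bd_rank G p (X \<union> Y) + bd_rank G p (X \<inter> Y) = bd_rank G p X + bd_rank G p Y"
proof -
  let ?d = "\<lambda>X. qbd G ` qchains (cells p X)"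
  obtain W where W: "finite W" "?d X \<subseteq> qchains W" "?d Y \<subseteq> qchains W"
    using qchains_finite_image[OF finite_cells[OF fin(1)] finite_cells[OF fin(2)]] by metis
  have "?d X \<inter> ?d Y = ?d (X \<inter> Y)"
    using mv qchains_mono[OF cells_mono[of "X \<inter> Y" X p]] qchains_mono[OF cells_mono[of "X \<inter> Y" Y p]]
    by auto
  moreover have "?d (X \<union> Y) = {x + y |x y. x \<in> ?d X \<and> y \<in> ?d Y}"
    unfolding cells_Un qchains_Un by (force simp: qbd_simps)
  ultimately show ?thesis
    using q_dim_sum_Int[OF subspace_boundaries subspace_boundaries W(2,3,1)]
    by (simp add: bd_rank_def)
qed

text \<open>The pair \<open>a\<close>, \<open>b\<close> is one of the decompositions over which
  \<open>mv_boundary\<close> ranges, so the boundary of \<open>a\<close> lies in the image of the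
  class of \<open>a + b\<close>. That image is the neutral coset, which consists of the boundaries
  of \<open>X \<inter> Y\<close>.\<close>

lemma mv_boundary_trivialD:
  assumes mv: "mv_boundary_trivial G m X Y"
    and ab: "Poly_Mapping.keys a \<subseteq> cells m X" "Poly_Mapping.keys b \<subseteq> cells m Y" "bd G (a + b) = 0"
    and m: "m > 0"
  shows "\<exists>c. Poly_Mapping.keys c \<subseteq> cells m (X \<inter> Y) \<and> bd G a = bd G c"
proof -
  let ?K = "cycle_group G m (X \<union> Y)" and ?B = "boundaries G m (X \<union> Y)"
  let ?Z = "?B #>\<^bsub>?K\<^esub> (a + b)"
  have keys: "Poly_Mapping.keys (a + b) \<subseteq> {S \<in> X \<union> Y. cube_dim S = m}"
    using keys_add[of a b] ab(1,2) by (auto simp: cells_def)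
  then have "a + b \<in> carrier ?K"
    using ab(3) by (simp add: cycle_group_def chain_group_def carrier_subgroup_generated generate.incl)
  then have Z: "?Z \<in> carrier (cubical_homology G m (X \<union> Y))"
    by (auto simp: cubical_homology_def carrier_FactGroup)
  have "0 \<in> ?B"
    by (auto simp: boundaries_def bd_def chain_group_def intro!: image_eqI[of _ _ 0])
  then have "a + b \<in> ?Z"
    by (force simp: r_coset_def cycle_group_def chain_group_def)
  then have "bd G a \<in> mv_boundary G m X Y ?Z"
    using ab(1,2) by (auto simp: mv_boundary_def chain_group_def cells_def)
  moreover have "mv_boundary G m X Y ?Z = boundaries G (m - 1) (X \<inter> Y)"
    using mv Z by (auto simp: mv_boundary_trivial_def cubical_homology_def)
  \<comment> \<open>Since \<open>m > 0\<close>, boundaries in degree \<open>m - 1\<close> come from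
    chains of degree \<open>m - 1 + 1 = m\<close>.\<close>
  ultimately show ?thesis
    using m by (auto simp: boundaries_def chain_group_def cells_def) blast
qed

lemma mv_boundary_trivial_bd_rank:
  assumes mv: "mv_boundary_trivial G m X Y" and m: "m > 0" and fin: "finite X" "finite Y"
  shows "bd_rank G m (X \<union> Y) + bd_rank G m (X \<inter> Y) = bd_rank G m X + bd_rank G m Y"
proof (rule bd_rank_Un[OF fin])
  fix a b assume ab: "a \<in> qchains (cells m X)" "b \<in> qchains (cells m Y)" "qbd G a = qbd G b"
  obtain N a' where a': "N > 0" "qscale (of_int N) a = ratify a'" by (rule clear_denominators)
  obtain M b' where b': "M > 0" "qscale (of_int M) b = ratify b'" by (rule clear_denominators)
  \<comment> \<open>The extra factors bring both chains to the multiple \<open>M * N\<close>: the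
    integral chain \<open>?a + ?b\<close> is \<open>M * N\<close> times \<open>a - b\<close>, hence
    a cycle.\<close>
  let ?a = "frag_cmul M a'" and ?b = "- frag_cmul N b'"
  have rab: "ratify ?a = qscale (of_int (M * N)) a" "ratify ?b = - qscale (of_int (M * N)) b"
    using a' b' by (simp_all flip: a'(2) b'(2) add: mult.commute)
  have "Poly_Mapping.keys ?a \<subseteq> cells m X" "Poly_Mapping.keys ?b \<subseteq> cells m Y"
    using ab(1,2) rab by (metis ratify_in_qchains qchains_closed(3,4))+
  moreover have "ratify (bd G (?a + ?b)) = 0"
    unfolding ratify_bd ratify_simps(2) rab qbd_simps ab(3) by simp
  then have "bd G (?a + ?b) = 0" by simp
  ultimately obtain c where c: "Poly_Mapping.keys c \<subseteq> cells m (X \<inter> Y)" "bd G ?a = bd G c"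
    using mv_boundary_trivialD[OF mv _ _ _ m] by blast
  have "qscale (of_int (M * N)) (qbd G a) = qbd G (ratify c)"
    using arg_cong[OF c(2), of ratify] unfolding ratify_bd rab qbd_simps .
  then have "qbd G a = qbd G (qscale (1 / of_int (M * N)) (ratify c))"
    using a'(1) b'(1) unfolding qbd_simps by (metis (no_types, opaque_lifting) divide_self_if
        mult_pos_pos of_int_eq_0_iff order_less_irrefl qv.scale_one qv.scale_scale times_divide_eq_left mult_1)
  then show "qbd G a \<in> qbd G ` qchains (cells m (X \<inter> Y))"
    using c(1) by (auto intro!: imageI qchains_closed)
qed

text \<open>In degree 2 the formula \<open>hrank_eq\<close> contains the boundary ranks of degrees 2
  and 3; the hypothesis supplies inclusion-exclusion for both.\<close>

lemma mv_hrank: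
  assumes mv: "\<And>m. m \<ge> 2 \<Longrightarrow> mv_boundary_trivial G m X Y" and fin: "finite X" "finite Y"
  shows "hrank G 2 (X \<union> Y) + hrank G 2 (X \<inter> Y) = hrank G 2 X + hrank G 2 Y"
proof -
  have "card (cells 2 (X \<union> Y)) + card (cells 2 (X \<inter> Y)) = card (cells 2 X) + card (cells 2 Y)"
    using card_Un_Int[of "cells 2 X" "cells 2 Y"] fin by (simp add: cells_Un cells_Int finite_cells)
  moreover note mv_boundary_trivial_bd_rank[OF mv[of 2] _ fin] mv_boundary_trivial_bd_rank[OF mv[of 3] _ fin]
  ultimately show ?thesis
    using fin by (simp add: hrank_eq eval_nat_numeral)
qed

section \<open>Betti numbers as dimensions\<close>

text \<open>The cycles already form a subgroup, so the subgroup generated by them has no further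
  elements.\<close>

lemma int_cycles_iff:
  "z \<in> carrier (cycle_group G p X) \<longleftrightarrow> Poly_Mapping.keys z \<subseteq> cells p X \<and> bd G z = 0"
proof -
  let ?C = "chain_group p X"
  interpret C: group ?C by (simp add: chain_group_def)
  let ?H = "carrier ?C \<inter> {z. bd G z = 0}"
  have sub: "subgroup ?H ?C"
  proof (rule C.subgroupI)
    show "inv\<^bsub>?C\<^esub> a \<in> ?H" if "a \<in> ?H" for a
      using that by (simp add: chain_group_def bd_def frag_extend_minus)
    show "a \<otimes>\<^bsub>?C\<^esub> b \<in> ?H" if "a \<in> ?H" "b \<in> ?H" for a b
      using that keys_add[of a b] by (auto simp: chain_group_def bd_def frag_extend_add)
    have "0 \<in> ?H" by (simp add: chain_group_def bd_def)
    then show "?H \<noteq> {}" by blast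
  qed auto
  have "carrier (cycle_group G p X) = ?H"
    using subgroup.carrier_subgroup_generated_subgroup[OF sub]
    by (simp add: cycle_group_def)
  then show ?thesis by (auto simp: chain_group_def cells_def)
qed

lemma comm_group_cycle_group: "comm_group (cycle_group G p X)"
  unfolding cycle_group_def chain_group_def
  by (intro group.abelian_subgroup_generated abelian_free_Abelian_group) simp

lemma int_pow_cycle_group:
  assumes "z \<in> carrier (cycle_group G p X)"
  shows "z [^]\<^bsub>cycle_group G p X\<^esub> (k::int) = frag_cmul k z"
proof -
  interpret C: group "chain_group p X" by (simp add: chain_group_def)
  show ?thesis
    using assms C.int_pow_subgroup_generated[of z "{z. bd G z = 0}" k] int_cycles_iff[of z G p X]
    unfolding cycle_group_def by (simp add: chain_group_def cells_def)
qed

text \<open>Integral independence of classes is compared with rational independence modulo rational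
  boundaries. Lifting classes to cycles bounds the supremum by
  \<open>qv.dim ?Z - qv.dim ?BQ\<close>, and a rational basis with integral representatives attains
  it.\<close>

lemma hrank_eq_group_rank:
  assumes X: "cube_complex G X"
  shows "int (group_rank (cubical_homology G p X)) = hrank G p X"
proof -
  let ?K = "cycle_group G p X" and ?B = "boundaries G p X" and ?H = "cubical_homology G p X"
  let ?Z = "cycles G p X" and ?BQ = "qbd G ` qchains (cells (Suc p) X)"
  have finX: "finite X" using X by (simp add: cube_complex_def)
  interpret K: comm_group ?K by (rule comm_group_cycle_group)
  have B_iff: "z \<in> ?B \<longleftrightarrow> (\<exists>y. Poly_Mapping.keys y \<subseteq> cells (Suc p) X \<and> z = bd G y)" for z
    by (auto simp: boundaries_def chain_group_def cells_def) blast
  have Z_iff: "z \<in> carrier ?K \<longleftrightarrow> ratify z \<in> ?Z" for z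
    by (simp add: int_cycles_iff cycles_def flip: ratify_bd)
  have B_sub: "?B \<subseteq> carrier ?K"
    by (auto simp: B_iff Z_iff ratify_bd intro!: subsetD[OF boundaries_subset_cycles[OF X]] imageI)
  have mult: "a \<otimes>\<^bsub>?K\<^esub> b = a + b" and one: "\<one>\<^bsub>?K\<^esub> = 0" for a b
    by (simp_all add: cycle_group_def chain_group_def)
  have inv: "inv\<^bsub>?K\<^esub> a = - a" if "a \<in> carrier ?K" for a
  proof (rule K.inv_equality)
    show "- a \<in> carrier ?K" using that by (simp add: int_cycles_iff bd_def frag_extend_minus)
  qed (use that in \<open>simp_all add: mult one\<close>)
  have subB: "subgroup ?B ?K"
  proof (rule K.subgroupI[OF B_sub])
    show "?B \<noteq> {}" using B_iff[of 0] by (force simp: bd_def intro!: exI[of _ 0])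
    show "inv\<^bsub>?K\<^esub> a \<in> ?B" if a: "a \<in> ?B" for a
    proof -
      obtain y where y: "Poly_Mapping.keys y \<subseteq> cells (Suc p) X" "a = bd G y"
        using a B_iff by metis
      have "inv\<^bsub>?K\<^esub> a = bd G (- y)"
        using inv[OF subsetD[OF B_sub a]] y(2) by (simp add: bd_def frag_extend_minus)
      then show ?thesis using y(1) unfolding B_iff by (metis keys_minus)
    qed
    show "a \<otimes>\<^bsub>?K\<^esub> b \<in> ?B" if ab: "a \<in> ?B" "b \<in> ?B" for a b
    proof -
      obtain y z where yz: "Poly_Mapping.keys y \<subseteq> cells (Suc p) X" "a = bd G y"
        "Poly_Mapping.keys z \<subseteq> cells (Suc p) X" "b = bd G z"
        using ab B_iff by metis
      have "a + b = bd G (y + z)" "Poly_Mapping.keys (y + z) \<subseteq> cells (Suc p) X"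
        using yz keys_add[of y z] by (auto simp: bd_def frag_extend_add)
      then show ?thesis unfolding mult B_iff by blast
    qed
  qed
  \<comment> \<open>An integral chain that bounds rationally represents a torsion class; here
    torsion drops out of the rank.\<close>
  have BQ: "ratify z \<in> ?BQ \<longleftrightarrow> (\<exists>N>0. frag_cmul N z \<in> ?B)" for z
  proof
    assume "ratify z \<in> ?BQ"
    then obtain y where y: "ratify z = qbd G y" "y \<in> qchains (cells (Suc p) X)" by blast
    obtain N w where w: "N > 0" "qscale (of_int N) y = ratify w" by (rule clear_denominators)
    have "ratify (frag_cmul N z) = ratify (bd G w)"
      using y(1) w(2) by (simp add: ratify_bd qbd_simps flip: w(2))
    then have "frag_cmul N z = bd G w" by (simp only: ratify_eq_iff)
    moreover have "Poly_Mapping.keys w \<subseteq> cells (Suc p) X"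
      using qchains_closed(4)[OF y(2), of "of_int N"] w(2) by simp
    ultimately show "\<exists>N>0. frag_cmul N z \<in> ?B"
      using w(1) by (auto simp: B_iff)
  next
    assume "\<exists>N>0. frag_cmul N z \<in> ?B"
    then obtain N w where w: "N > 0" "frag_cmul N z = bd G w" "Poly_Mapping.keys w \<subseteq> cells (Suc p) X"
      by (auto simp: B_iff)
    have "qscale (of_int N) (ratify z) = qbd G (ratify w)"
      using arg_cong[OF w(2), of ratify] by (simp add: ratify_bd)
    then have "ratify z = qbd G (qscale (1 / of_int N) (ratify w))"
      using w(1) by (simp add: qbd_simps flip: \<open>qscale (of_int N) (ratify z) = qbd G (ratify w)\<close>)
    then show "ratify z \<in> ?BQ" using w(3) by (auto intro!: imageI qchains_closed)
  qed
  interpret N: normal ?B ?K using K.subgroup_imp_normal[OF subB] .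
  interpret H: comm_group ?H
    unfolding cubical_homology_def by (rule K.abelian_FactGroup[OF subB])
  let ?\<pi> = "\<lambda>z. ?B #>\<^bsub>?K\<^esub> z"
  have hom: "?\<pi> \<in> hom ?K ?H"
    unfolding cubical_homology_def by (rule N.r_coset_hom_Mod)
  interpret \<pi>: group_hom ?K ?H ?\<pi>
    by unfold_locales (rule hom)
  have carrier_H: "carrier ?H = ?\<pi> ` carrier ?K"
    by (simp add: cubical_homology_def carrier_FactGroup)
  have one_iff: "?\<pi> z = \<one>\<^bsub>?H\<^esub> \<longleftrightarrow> z \<in> ?B" if "z \<in> carrier ?K" for z
    using that K.coset_join1[OF _ that subB] K.coset_join2[OF that subB] B_sub
    by (auto simp: cubical_homology_def)
  have closed: "(\<Sum>i\<in>I. frag_cmul (c i) (z i)) \<in> carrier ?K"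
    if "finite I" "\<And>i. i \<in> I \<Longrightarrow> z i \<in> carrier ?K"
    for I :: "(('a, 'b) gcell set \<Rightarrow>\<^sub>0 int) set set" and c z
    using that by (simp add: Z_iff qv.subspace_sum qv.subspace_scale)
  \<comment> \<open>Translates a multiplicative relation among cosets into the coset of an integral
    linear combination of representatives.\<close>
  have prod: "finprod ?H (\<lambda>b. b [^]\<^bsub>?H\<^esub> c b) I = ?\<pi> (\<Sum>b\<in>I. frag_cmul (c b) (z b))"
    if "finite I" "\<And>b. b \<in> I \<Longrightarrow> z b \<in> carrier ?K \<and> ?\<pi> (z b) = b" for I z and c :: "_ \<Rightarrow> int"
    using that
  proof (induction I)
    case empty
    show ?case using \<pi>.hom_one one by simp
  next
    case (insert b I)
    have zb: "z b \<in> carrier ?K" "?\<pi> (z b) = b" using insert.prems by auto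
    have bH: "b' \<in> carrier ?H" if "b' \<in> insert b I" for b'
      using insert.prems[OF that] carrier_H by blast
    have "finprod ?H (\<lambda>b. b [^]\<^bsub>?H\<^esub> c b) (insert b I)
        = b [^]\<^bsub>?H\<^esub> c b \<otimes>\<^bsub>?H\<^esub> finprod ?H (\<lambda>b. b [^]\<^bsub>?H\<^esub> c b) I"
      by (rule H.finprod_insert) (use insert.hyps bH in \<open>auto intro: H.int_pow_closed\<close>)
    also have "finprod ?H (\<lambda>b. b [^]\<^bsub>?H\<^esub> c b) I = ?\<pi> (\<Sum>b\<in>I. frag_cmul (c b) (z b))"
      by (rule insert.IH) (use insert.prems in auto)
    also have "b [^]\<^bsub>?H\<^esub> c b = ?\<pi> (frag_cmul (c b) (z b))"
      using \<pi>.hom_int_pow[OF zb(1), of "c b"] zb(2) int_pow_cycle_group[OF zb(1)] by simp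
    also have "\<dots> \<otimes>\<^bsub>?H\<^esub> ?\<pi> (\<Sum>b\<in>I. frag_cmul (c b) (z b))
        = ?\<pi> (frag_cmul (c b) (z b) + (\<Sum>b\<in>I. frag_cmul (c b) (z b)))"
      using \<pi>.hom_mult[of "frag_cmul (c b) (z b)" "\<Sum>b\<in>I. frag_cmul (c b) (z b)"]
        closed[of "{b}" z c] closed[of I z c] insert.prems insert.hyps by (simp add: mult)
    finally show ?case using insert.hyps by simp
  qed
  have ZF: "?Z \<subseteq> qv.span (qcell ` cells p X)" "finite (qcell ` cells p X)"
    using finite_cells[OF finX] qchains_eq_span[of "cells p X"] by (auto simp: cycles_def)
  have BZ: "?BQ \<subseteq> ?Z" by (rule boundaries_subset_cycles[OF X])
  let ?indep = "\<lambda>I. finite I \<and> I \<subseteq> carrier ?H \<and>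
     (\<forall>c :: _ \<Rightarrow> int. finprod ?H (\<lambda>b. b [^]\<^bsub>?H\<^esub> c b) I = \<one>\<^bsub>?H\<^esub> \<longrightarrow> (\<forall>b\<in>I. c b = 0))"
  have upper: "card I + qv.dim ?BQ \<le> qv.dim ?Z" if I: "?indep I" for I
  proof -
    let ?z = "inv_into (carrier ?K) ?\<pi>"
    have "I \<subseteq> ?\<pi> ` carrier ?K" using I unfolding carrier_H by blast
    then have z: "?z b \<in> carrier ?K \<and> ?\<pi> (?z b) = b" if "b \<in> I" for b
      using that inv_into_into[of b ?\<pi> "carrier ?K"] f_inv_into_f[of b ?\<pi> "carrier ?K"] by blast
    define z where "z = ?z"
    note z = z[folded z_def]
    show ?thesis
    proof (rule qv.card_independent_mod_le[of ?BQ ?Z _ I "\<lambda>b. ratify (z b)"])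
      fix c i assume c: "(\<Sum>b\<in>I. qscale (c b) (ratify (z b))) \<in> ?BQ" and i: "i \<in> I"
      \<comment> \<open>The coefficients form a chain over the finite set \<open>I\<close> of
        cosets, so a single \<open>N\<close> clears all their denominators.\<close>
      obtain N y where y: "N > 0" "qscale (of_int N) (\<Sum>b\<in>I. qscale (c b) (qcell b)) = ratify y"
        by (rule clear_denominators)
      have Nc: "of_int N * c b = of_int (Poly_Mapping.lookup y b)" if "b \<in> I" for b
      proof -
        have "(\<Sum>x\<in>I. c x * (if x = b then 1 else 0)) = (\<Sum>x\<in>I. if x = b then c x else 0)"
          by (rule sum.cong) auto
        also have "\<dots> = c b" using I that by (simp add: sum.delta')
        finally show ?thesis
          using arg_cong[OF y(2), of "\<lambda>x. Poly_Mapping.lookup x b"]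
          by (simp add: lookup_sum lookup_single when_def)
      qed
      let ?s = "\<Sum>b\<in>I. frag_cmul (Poly_Mapping.lookup y b) (z b)"
      have "ratify ?s = qscale (of_int N) (\<Sum>b\<in>I. qscale (c b) (ratify (z b)))"
        by (simp add: qv.scale_sum_right Nc[symmetric])
      then have "ratify ?s \<in> ?BQ"
        using qv.subspace_scale[OF subspace_boundaries c, of "of_int N"] by (simp only:)
      then obtain M where M: "M > 0" "frag_cmul M ?s \<in> ?B" using BQ by blast
      let ?k = "\<lambda>b. M * Poly_Mapping.lookup y b"
      have "frag_cmul M ?s = (\<Sum>b\<in>I. frag_cmul (?k b) (z b))"
        using I by (simp add: frag_cmul_sum)
      then have one': "?\<pi> (\<Sum>b\<in>I. frag_cmul (?k b) (z b)) = \<one>\<^bsub>?H\<^esub>"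
        using M(2) one_iff B_sub by auto
      have finI: "finite I" and ind: "\<forall>c :: _ \<Rightarrow> int. finprod ?H (\<lambda>b. b [^]\<^bsub>?H\<^esub> c b) I = \<one>\<^bsub>?H\<^esub>
          \<longrightarrow> (\<forall>b\<in>I. c b = 0)"
        using I by blast+
      have "finprod ?H (\<lambda>b. b [^]\<^bsub>?H\<^esub> ?k b) I = \<one>\<^bsub>?H\<^esub>"
        unfolding one'[symmetric] by (rule prod[OF finI z])
      from ind[rule_format, OF this i] have "?k i = 0" .
      then show "c i = 0" using M(1) y(1) Nc[OF i] by simp
    qed (use I z ZF BZ Z_iff in auto)
  qed
  obtain I where I: "?indep I" "card I + qv.dim ?BQ = qv.dim ?Z"
  proof -
    \<comment> \<open>A rational cycle is a rational multiple of an integral one; hence the integral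
      cycles span, and the independent family can be chosen among them.\<close>
    have T: "ratify ` carrier ?K \<subseteq> ?Z" "?Z \<subseteq> qv.span (ratify ` carrier ?K)"
    proof -
      show "ratify ` carrier ?K \<subseteq> ?Z" using Z_iff by blast
      show "?Z \<subseteq> qv.span (ratify ` carrier ?K)"
      proof
        fix x assume x: "x \<in> ?Z"
        obtain N y where y: "N > 0" "qscale (of_int N) x = ratify y" by (rule clear_denominators)
        have "y \<in> carrier ?K"
          using qv.subspace_scale[OF subspace_cycles x, of "of_int N"] y(2) Z_iff by simp
        moreover have "x = qscale (1 / of_int N) (ratify y)"
          using y(1) by (simp flip: y(2))
        ultimately show "x \<in> qv.span (ratify ` carrier ?K)"
          by (auto intro: qv.span_base qv.span_scale)
      qed
    qed
    obtain R where R: "R \<subseteq> ratify ` carrier ?K" "finite R" "card R + qv.dim ?BQ = qv.dim ?Z"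
      "\<And>c r. (\<Sum>r\<in>R. qscale (c r) r) \<in> ?BQ \<Longrightarrow> r \<in> R \<Longrightarrow> c r = 0"
      using qv.exists_independent_mod[OF subspace_boundaries subspace_cycles BZ ZF T] by blast
    obtain Y where Y: "Y \<subseteq> carrier ?K" "R = ratify ` Y"
      using R(1) by (meson subset_imageE)
    have injr: "inj_on ratify Y" by (simp add: inj_on_def)
    have finY: "finite Y" using R(2) Y(2) injr by (metis finite_image_iff)
    have indY: "c y = 0" if "(\<Sum>y\<in>Y. frag_cmul (c y) y) \<in> ?B" "y \<in> Y" for c y
    proof -
      have "ratify (\<Sum>y\<in>Y. frag_cmul (c y) y) \<in> ?BQ"
        unfolding BQ using that(1) by (intro exI[of _ 1]) simp
      moreover have "ratify (\<Sum>y\<in>Y. frag_cmul (c y) y)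
          = (\<Sum>r\<in>R. qscale (of_int (c (inv_into Y ratify r))) r)"
        unfolding Y(2) sum.reindex[OF injr] using injr by simp
      ultimately have "of_int (c (inv_into Y ratify (ratify y))) = (0 :: rat)"
        using R(4)[of "\<lambda>r. of_int (c (inv_into Y ratify r))" "ratify y"] that(2) Y(2) by auto
      then show ?thesis using injr that(2) by simp
    qed
    \<comment> \<open>Two representatives of one coset would differ by a boundary, a relation with
      coefficients 1 and -1. So there are as many classes as representatives.\<close>
    have inj: "inj_on ?\<pi> Y"
    proof (rule inj_onI, rule ccontr)
      fix x y assume xy: "x \<in> Y" "y \<in> Y" "?\<pi> x = ?\<pi> y" "x \<noteq> y"
      have "x \<in> ?\<pi> y" using K.rcos_self[of x ?B] xy Y(1) subB by auto
      then obtain b where b: "b \<in> ?B" "x = b + y" by (auto simp: r_coset_def mult)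
      let ?c = "\<lambda>k. if k = x then 1 else if k = y then - 1 else 0"
      have "(\<Sum>k\<in>Y. frag_cmul (?c k) k) = (\<Sum>k\<in>{x, y}. frag_cmul (?c k) k)"
        by (rule sum.mono_neutral_right) (use xy finY in auto)
      also have "\<dots> = b" using xy(4) b by simp
      finally show False using indY[of ?c x] xy(1) b(1) by simp
    qed
    have "?indep (?\<pi> ` Y)"
    proof (intro conjI allI impI ballI)
      fix c :: "_ \<Rightarrow> int" and b
      assume c: "finprod ?H (\<lambda>b. b [^]\<^bsub>?H\<^esub> c b) (?\<pi> ` Y) = \<one>\<^bsub>?H\<^esub>" and b: "b \<in> ?\<pi> ` Y"
      let ?z = "inv_into Y ?\<pi>"
      have z: "b \<in> ?\<pi> ` Y \<Longrightarrow> ?z b \<in> carrier ?K \<and> ?\<pi> (?z b) = b" for b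
        using Y(1) inj by auto
      have "?\<pi> (\<Sum>b\<in>?\<pi> ` Y. frag_cmul (c b) (?z b)) = \<one>\<^bsub>?H\<^esub>"
        using c prod[of "?\<pi> ` Y" ?z c] z finY by simp
      moreover have "(\<Sum>b\<in>?\<pi> ` Y. frag_cmul (c b) (?z b)) = (\<Sum>y\<in>Y. frag_cmul (c (?\<pi> y)) y)"
        unfolding sum.reindex[OF inj] using inj by simp
      ultimately have "(\<Sum>y\<in>Y. frag_cmul (c (?\<pi> y)) y) \<in> ?B"
        using one_iff closed[of "?\<pi> ` Y" ?z c] z finY by simp
      then show "c b = 0" using indY[of "\<lambda>y. c (?\<pi> y)"] b by auto
    next
      show "finite (?\<pi> ` Y)" using finY by simp
      show "?\<pi> ` Y \<subseteq> carrier ?H" unfolding carrier_H using Y(1) by blast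
    qed
    moreover have "card (?\<pi> ` Y) + qv.dim ?BQ = qv.dim ?Z"
      using card_image[OF inj] card_image[OF injr] Y(2) R(3) by simp
    ultimately show ?thesis by (rule that)
  qed
  have "group_rank ?H = card I"
    unfolding group_rank_def
  proof (rule cSup_eq_maximum)
    show "card I \<in> {card B |B. ?indep B}" using I(1) by blast
    show "x \<le> card I" if "x \<in> {card B |B. ?indep B}" for x
      using that upper I(2) by force
  qed
  then show ?thesis
    using I(2) by (simp add: hrank_def bd_rank_def)
qed

section \<open>The cross product\<close>

definition ord_sgn :: "'b \<Rightarrow> 'b \<Rightarrow> rat" where
  "ord_sgn f e = (if (f, e) \<in> arc_order then - 1 else 1)"

text \<open>The sign of the permutation that sorts the edges of \<open>E\<close> followed by those
  of \<open>F\<close> into \<open>arc_order\<close>: one factor -1 for each inversion.\<close>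

definition shuffle_sgn :: "'b set \<Rightarrow> 'b set \<Rightarrow> rat" where
  "shuffle_sgn E F = (\<Prod>e\<in>E. \<Prod>f\<in>F. ord_sgn f e)"

lemma ord_sgn_swap: "e \<noteq> f \<Longrightarrow> ord_sgn e f = - ord_sgn f e"
  using arc_order_total[of e f] by (auto simp: ord_sgn_def)

lemma ord_sgn_sq: "ord_sgn e f * ord_sgn e f = 1"
  by (simp add: ord_sgn_def)

lemma prod_ord_sgn_sq: "(\<Prod>x\<in>A. ord_sgn (g x) (h x)) * (\<Prod>x\<in>A. ord_sgn (g x) (h x)) = 1"
  by (simp add: prod.distrib[symmetric] ord_sgn_sq)

lemma shuffle_sgn_sq: "shuffle_sgn E F * shuffle_sgn E F = 1"
  by (simp add: shuffle_sgn_def prod.distrib[symmetric] ord_sgn_sq)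

lemma esgn_eq_prod:
  assumes "finite E"
  shows "esgn E e = (\<Prod>e'\<in>E - {e}. ord_sgn e' e)"
proof -
  have "(\<Prod>e'\<in>E - {e}. ord_sgn e' e) = (\<Prod>e'\<in>{e'\<in>E - {e}. (e', e) \<in> arc_order}. - 1)"
    by (rule prod.mono_neutral_cong_right) (use assms in \<open>auto simp: ord_sgn_def\<close>)
  moreover have "{e'\<in>E - {e}. (e', e) \<in> arc_order} = {e' \<in> E. e' \<noteq> e \<and> (e', e) \<in> arc_order}"
    by auto
  ultimately show ?thesis by (simp add: esgn_def)
qed

text \<open>The comparisons of \<open>e\<close> with \<open>F\<close> contribute the same factor to
  both signs on the left, and this factor squares to 1.\<close>

lemma esgn_Un_left:
  assumes "finite E" "finite F" "E \<inter> F = {}" "e \<in> E"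
  shows "esgn (E \<union> F) e * shuffle_sgn E F = esgn E e * shuffle_sgn (E - {e}) F"
proof -
  let ?q = "\<Prod>f\<in>F. ord_sgn f e"
  have "E \<union> F - {e} = (E - {e}) \<union> F" using assms(3,4) by auto
  then have "esgn (E \<union> F) e = esgn E e * ?q"
    using assms by (simp add: esgn_eq_prod) (rule prod.union_disjoint; auto)
  moreover have "shuffle_sgn E F = ?q * shuffle_sgn (E - {e}) F"
    using assms by (simp add: shuffle_sgn_def prod.remove)
  moreover have "?q * ?q = 1" by (rule prod_ord_sgn_sq)
  ultimately show ?thesis by (metis (no_types, lifting) mult.assoc mult.right_neutral)
qed

text \<open>Here the two signs compare \<open>f\<close> with each edge of \<open>E\<close> in
  opposite senses. Each comparison leaves a factor -1, which is the origin of the Koszul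
  sign.\<close>

lemma esgn_Un_right:
  assumes "finite E" "finite F" "E \<inter> F = {}" "f \<in> F"
  shows "esgn (E \<union> F) f * shuffle_sgn E F = (- 1) ^ card E * (esgn F f * shuffle_sgn E (F - {f}))"
proof -
  let ?q = "\<Prod>e\<in>E. ord_sgn f e"
  have "E \<union> F - {f} = (F - {f}) \<union> E" using assms(3,4) by auto
  then have "esgn (E \<union> F) f = esgn F f * (\<Prod>e\<in>E. ord_sgn e f)"
    using assms by (simp add: esgn_eq_prod) (rule prod.union_disjoint; auto)
  also have "(\<Prod>e\<in>E. ord_sgn e f) = (\<Prod>e\<in>E. (- 1) * ord_sgn f e)"
  proof (rule prod.cong[OF refl])
    fix e assume "e \<in> E"
    then have "e \<noteq> f" using assms(3,4) by auto
    then show "ord_sgn e f = - 1 * ord_sgn f e" using ord_sgn_swap[of e f] by simp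
  qed
  also have "\<dots> = (- 1) ^ card E * ?q"
    by (simp only: prod.distrib prod_constant)
  finally have 1: "esgn (E \<union> F) f = esgn F f * ((- 1) ^ card E * ?q)" .
  have 2: "shuffle_sgn E F = ?q * shuffle_sgn E (F - {f})"
    using assms by (simp add: shuffle_sgn_def prod.remove prod.distrib)
  have "esgn (E \<union> F) f * shuffle_sgn E F
      = (- 1) ^ card E * (esgn F f * shuffle_sgn E (F - {f})) * (?q * ?q)"
    unfolding 1 2 by (simp only: mult.assoc mult.left_commute mult.commute)
  then show ?thesis unfolding prod_ord_sgn_sq by simp
qed

text \<open>The shuffle sign reconciles the global order of arcs with the product orientation, in
  which the edges of the first factor come first.\<close>

definition cross :: "(('a, 'b) gcell set \<Rightarrow>\<^sub>0 rat) \<Rightarrow> (('a, 'b) gcell set \<Rightarrow>\<^sub>0 rat) \<Rightarrow> (('a, 'b) gcell set \<Rightarrow>\<^sub>0 rat)" where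
  "cross x y = qext (\<lambda>S. qext (\<lambda>T. qscale (shuffle_sgn (edges S) (edges T)) (qcell (S \<union> T))) y) x"

lemma qext_fun_add: "qext (\<lambda>S. F S + H S) x = qext F x + qext H x"
  by (simp add: qext_def qv.scale_right_distrib sum.distrib)

lemma qext_fun_scale: "qext (\<lambda>S. qscale r (F S)) x = qscale r (qext F x)"
  by (simp add: qext_def qv.scale_sum_right mult.commute)

lemma cross_cell: "cross (qcell S) (qcell T) = qscale (shuffle_sgn (edges S) (edges T)) (qcell (S \<union> T))"
  by (simp add: cross_def)

lemma qlinear_cross_left: "qlinear (\<lambda>x. cross x y)"
  unfolding cross_def by (rule qlinear_qext)

lemma qlinearI:
  assumes "\<And>x y. f (x + y) = f x + f y" "\<And>r x. f (qscale r x) = qscale r (f x)"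
  shows "qlinear f"
  unfolding Vector_Spaces.linear_iff using assms qv.vector_space_axioms by blast

lemma qlinear_cross_right: "qlinear (cross x)"
  by (rule qlinearI) (simp_all add: cross_def qext_simps qext_fun_add qext_fun_scale)

lemma qlinear_simps:
  assumes "qlinear f"
  shows "f 0 = 0" "f (x + y) = f x + f y" "f (x - y) = f x - f y" "f (- x) = - f x"
    "f (qscale r x) = qscale r (f x)" "f (sum g A) = (\<Sum>a\<in>A. f (g a))"
proof -
  interpret Vector_Spaces.linear qscale qscale f by fact
  show "f 0 = 0" "f (x + y) = f x + f y" "f (x - y) = f x - f y" "f (- x) = - f x"
    "f (qscale r x) = qscale r (f x)" "f (sum g A) = (\<Sum>a\<in>A. f (g a))"
    by (rule zero add diff neg scale sum)+
qed

lemmas cross_simps = qlinear_simps[OF qlinear_cross_left] qlinear_simps[OF qlinear_cross_right]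

lemma qlinear_compose: "qlinear f \<Longrightarrow> qlinear g \<Longrightarrow> qlinear (\<lambda>x. f (g x))"
  using Vector_Spaces.linear_compose[of qscale qscale g qscale f] by (simp add: comp_def)

lemma qlinear_add: "qlinear f \<Longrightarrow> qlinear g \<Longrightarrow> qlinear (\<lambda>x. f x + g x)"
  by (rule qlinearI) (simp_all add: qlinear_simps qv.scale_right_distrib)

lemma qlinear_diff: "qlinear f \<Longrightarrow> qlinear g \<Longrightarrow> qlinear (\<lambda>x. f x - g x)"
  by (rule qlinearI) (simp_all add: qlinear_simps qv.scale_right_diff_distrib)

lemma qlinear_ident: "qlinear (\<lambda>x. x)"
  by (rule qlinearI) simp_all

lemmas qlinear_intros = qlinear_add qlinear_diff qlinear_ident qlinear_qext qlinear_qbd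
  qlinear_compose[OF qlinear_qbd] qlinear_compose[OF qlinear_cross_left]
  qlinear_compose[OF qlinear_cross_right] qlinear_compose[OF qlinear_qext]

lemma qbilinear_eq_on_qchains:
  assumes "\<And>y. qlinear (\<lambda>x. f x y)" "\<And>x. qlinear (f x)" "\<And>y. qlinear (\<lambda>x. g x y)" "\<And>x. qlinear (g x)"
    and "\<And>S T. S \<in> X \<Longrightarrow> T \<in> Y \<Longrightarrow> f (qcell S) (qcell T) = g (qcell S) (qcell T)"
    and "x \<in> qchains X" "y \<in> qchains Y"
  shows "f x y = g x y"
proof -
  have "f (qcell S) y = g (qcell S) y" if "S \<in> X" for S
    by (rule qlinear_eq_on_qchains[OF assms(2) assms(4) _ assms(7)]) (rule assms(5)[OF that])
  then show ?thesis
    using qlinear_eq_on_qchains[OF assms(1)[of y] assms(3)[of y] _ assms(6)] by blast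
qed

lemma qbilinear_qchains_into:
  assumes "\<And>y. qlinear (\<lambda>x. f x y)" "\<And>x. qlinear (f x)"
    and "\<And>S T. S \<in> X \<Longrightarrow> T \<in> Y \<Longrightarrow> f (qcell S) (qcell T) \<in> U" "qv.subspace U"
    and "x \<in> qchains X" "y \<in> qchains Y"
  shows "f x y \<in> U"
proof -
  have "f (qcell S) y \<in> U" if "S \<in> X" for S
    by (rule qlinear_qchains_into[OF assms(2) _ assms(4) assms(6)]) (rule assms(3)[OF that])
  then show ?thesis
    using qlinear_qchains_into[OF assms(1)[of y] _ assms(4) assms(5)] by blast
qed

text \<open>The Koszul sign as a linear map, so that the Leibniz rule can be stated for chains of
  mixed dimension.\<close>

definition parity :: "(('a, 'b) gcell set \<Rightarrow>\<^sub>0 rat) \<Rightarrow> (('a, 'b) gcell set \<Rightarrow>\<^sub>0 rat)" where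
  "parity = qext (\<lambda>S. qscale ((- 1) ^ cube_dim S) (qcell S))"

lemma qlinear_parity: "qlinear parity"
  unfolding parity_def by (rule qlinear_qext)

lemma parity_cell: "parity (qcell S) = qscale ((- 1) ^ cube_dim S) (qcell S)"
  by (simp add: parity_def)

lemma parity_cells:
  assumes "x \<in> qchains (cells p X)"
  shows "parity x = qscale ((- 1) ^ p) x"
  by (rule qlinear_eq_on_qchains[OF qlinear_parity _ _ assms])
    (auto simp: parity_cell cells_def intro!: qlinearI simp: qv.scale_right_distrib mult.commute)

text \<open>Each edge of \<open>S \<union> T\<close> belongs to exactly one factor; by
  \<open>esgn_Un_left\<close> and \<open>esgn_Un_right\<close> the sums over \<open>edges S\<close>
  and \<open>edges T\<close> become the two Leibniz terms.\<close>

lemma qbd_cross_cell: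
  fixes S T :: "('a, 'b) gcell set"
  assumes "finite S" "finite T" "edges S \<inter> edges T = {}"
  shows "qbd G (cross (qcell S) (qcell T)) =
    cross (qbd G (qcell S)) (qcell T) + cross (parity (qcell S)) (qbd G (qcell T))"
proof -
  let ?E = "edges S" and ?F = "edges T"
  have fin: "finite ?E" "finite ?F" using assms finite_edges by auto
  let ?D = "\<lambda>e. qcell (face (head G) (S \<union> T) e) - qcell (face (tail G) (S \<union> T) e)"
  have E: "edges (S \<union> T) = ?E \<union> ?F" by (auto simp: edges_def)
  have fS: "face h (S \<union> T) e = face h S e \<union> T" if "e \<in> ?E" for h :: "'b \<Rightarrow> 'a" and e
    using that assms(3) by (auto simp: face_def edges_def)
  have fT: "face h (S \<union> T) e = S \<union> face h T e" if "e \<in> ?F" for h :: "'b \<Rightarrow> 'a" and e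
    using that assms(3) by (auto simp: face_def edges_def)
  have "qbd G (cross (qcell S) (qcell T))
      = (\<Sum>e\<in>?E \<union> ?F. qscale (esgn (?E \<union> ?F) e * shuffle_sgn ?E ?F) (?D e))"
    by (simp add: cross_cell qbd_simps qbd_cell E qv.scale_sum_right mult.commute)
  also have "\<dots> = (\<Sum>e\<in>?E. qscale (esgn (?E \<union> ?F) e * shuffle_sgn ?E ?F) (?D e))
      + (\<Sum>e\<in>?F. qscale (esgn (?E \<union> ?F) e * shuffle_sgn ?E ?F) (?D e))"
    by (rule sum.union_disjoint) (use fin assms(3) in auto)
  also have "(\<Sum>e\<in>?E. qscale (esgn (?E \<union> ?F) e * shuffle_sgn ?E ?F) (?D e))
      = cross (qbd G (qcell S)) (qcell T)"
    unfolding qbd_cell cross_simps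
    by (rule sum.cong)
      (use fin assms(3) in \<open>auto simp: cross_simps cross_cell esgn_Un_left fS qv.scale_right_diff_distrib\<close>)
  also have "(\<Sum>e\<in>?F. qscale (esgn (?E \<union> ?F) e * shuffle_sgn ?E ?F) (?D e))
      = cross (parity (qcell S)) (qbd G (qcell T))"
    unfolding qbd_cell parity_cell qlinear_simps(6)[OF qlinear_cross_right]
  proof (intro sum.cong refl)
    fix e assume e: "e \<in> ?F"
    show "qscale (esgn (?E \<union> ?F) e * shuffle_sgn ?E ?F) (?D e)
        = cross (qscale ((- 1) ^ cube_dim S) (qcell S)) (qscale (esgn ?F e)
            (qcell (face (head G) T e) - qcell (face (tail G) T e)))"
      unfolding esgn_Un_right[OF fin assms(3) e]
      by (simp add: cross_simps cross_cell fT[OF e] cube_dim_edges qv.scale_right_diff_distrib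
          mult.commute mult.left_commute)
  qed
  finally show ?thesis .
qed

text \<open>As \<open>L\<close> and \<open>R\<close> are disjoint, a union
  \<open>S \<union> T\<close> determines its parts by intersection with \<open>L\<close> and
  \<open>R\<close>. So a union can stand for a pair, and product chains have the same type as the
  factors.\<close>

locale disjoint_cells =
  fixes L R :: "('a, 'b) gcell set"
  assumes disj: "L \<inter> R = {}" and finL: "finite L" and finR: "finite R"
begin

lemma edges_disjoint: "S \<subseteq> L \<Longrightarrow> T \<subseteq> R \<Longrightarrow> edges S \<inter> edges T = {}"
  using disj by (auto simp: edges_def)

lemma union_parts: "S \<subseteq> L \<Longrightarrow> T \<subseteq> R \<Longrightarrow> (S \<union> T) \<inter> L = S \<and> (S \<union> T) \<inter> R = T"
  using disj by auto

lemma qbd_cross: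
  assumes "x \<in> qchains (Pow L)" "y \<in> qchains (Pow R)"
  shows "qbd G (cross x y) = cross (qbd G x) y + cross (parity x) (qbd G y)"
proof (rule qbilinear_eq_on_qchains[OF _ _ _ _ _ assms])
  fix S T assume "S \<in> Pow L" "T \<in> Pow R"
  then show "qbd G (cross (qcell S) (qcell T)) =
      cross (qbd G (qcell S)) (qcell T) + cross (parity (qcell S)) (qbd G (qcell T))"
    by (intro qbd_cross_cell edges_disjoint finite_subset[of S, OF _ finL] finite_subset[of T, OF _ finR]) auto
qed (auto intro!: qlinear_intros qlinear_cross_left qlinear_cross_right qlinear_parity)

lemma lookup_cross:
  assumes "x \<in> qchains (Pow L)" "y \<in> qchains (Pow R)" "S \<subseteq> L" "T \<subseteq> R"
  shows "Poly_Mapping.lookup (cross x y) (S \<union> T) =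
    shuffle_sgn (edges S) (edges T) * Poly_Mapping.lookup x S * Poly_Mapping.lookup y T"
proof -
  \<comment> \<open>Both sides are scalars; attaching them to the fixed cell \<open>{}\<close> makes
    them chain-valued, as the principle for bilinear maps requires.\<close>
  let ?f = "\<lambda>x y. qscale (Poly_Mapping.lookup (cross x y) (S \<union> T)) (qcell ({} :: ('a, 'b) gcell set))"
  let ?g = "\<lambda>x y. qscale (shuffle_sgn (edges S) (edges T) * Poly_Mapping.lookup x S *
    Poly_Mapping.lookup y T) (qcell ({} :: ('a, 'b) gcell set))"
  have "?f x y = ?g x y"
  proof (rule qbilinear_eq_on_qchains[OF _ _ _ _ _ assms(1,2)])
    fix A B assume AB: "A \<in> Pow L" "B \<in> Pow R"
    then have "A \<union> B = S \<union> T \<longleftrightarrow> A = S \<and> B = T"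
      using union_parts[of A B] union_parts[of S T] assms(3,4) by auto
    then show "?f (qcell A) (qcell B) = ?g (qcell A) (qcell B)"
      by (auto simp: cross_cell lookup_single when_def)
  qed (auto intro!: qlinearI simp: cross_simps lookup_add algebra_simps qv.scale_left_distrib)
  then have "Poly_Mapping.lookup (?f x y) {} = Poly_Mapping.lookup (?g x y) {}" by (rule arg_cong)
  then show ?thesis by simp
qed

end

section \<open>The Kuenneth formula\<close>

text \<open>Over a field every complex deformation retracts onto a complex with zero differential, and the
  cross product of two such retractions is again one.\<close>

definition chain_retract where
  "chain_retract G P \<phi> s \<longleftrightarrow> qlinear \<phi> \<and> qlinear s \<and>
    (\<forall>p. \<forall>x\<in>qchains (cells p P). \<phi> x \<in> qchains (cells p P) \<and> s x \<in> qchains (cells (Suc p) P) \<and>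
      qbd G (\<phi> x) = 0 \<and> \<phi> (qbd G x) = 0 \<and> \<phi> (\<phi> x) = \<phi> x \<and> x = \<phi> x + qbd G (s x) + s (qbd G x))"

lemma chain_retractD:
  assumes "chain_retract G P \<phi> s" "x \<in> qchains (cells p P)"
  shows "\<phi> x \<in> qchains (cells p P)" "s x \<in> qchains (cells (Suc p) P)" "qbd G (\<phi> x) = 0"
    "\<phi> (qbd G x) = 0" "\<phi> (\<phi> x) = \<phi> x" "\<phi> x + qbd G (s x) + s (qbd G x) = x"
  using assms unfolding chain_retract_def by (blast, blast, blast, blast, blast, metis)

lemma qbd_in_cells_pred:
  assumes "cube_complex G P" "x \<in> qchains (cells p P)"
  obtains "p = 0" "qbd G x = 0" | q where "p = Suc q" "qbd G x \<in> qchains (cells q P)"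
  using assms qbd_cells_0 qbd_in_cells by (cases p) blast+

lemma qchains_cells_sub: "x \<in> qchains (cells p P) \<Longrightarrow> x \<in> qchains P"
  using qchains_mono[of "cells p P" P] by (auto simp: cells_def)

text \<open>In each degree a chain is split into a representative of homology, a boundary, and a
  component complementary to the cycles; \<open>s\<close> lifts the boundary component through the
  boundary map.\<close>

lemma exists_chain_retract:
  fixes G :: "('a, 'b) pre_digraph"
  assumes P: "cube_complex G P"
  obtains \<phi> s where "chain_retract G P \<phi> s"
proof -
  interpret pr: vector_space_pair "qscale :: rat \<Rightarrow> (('a, 'b) gcell set \<Rightarrow>\<^sub>0 rat) \<Rightarrow> _"
    "qscale :: rat \<Rightarrow> (('a, 'b) gcell set \<Rightarrow>\<^sub>0 rat) \<Rightarrow> _" ..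
  let ?C = "\<lambda>p. qchains (cells p P)" and ?d = "qbd G"
  have dd: "?d (?d x) = 0" if "x \<in> ?C p" for x p
    using qbd_qbd[OF P qchains_cells_sub[OF that]] .
  have "\<exists>g. range g \<subseteq> ?C p \<and> qlinear g \<and> (\<forall>y\<in>?d ` ?C p. ?d (g y) = y)" for p
    using pr.linear_exists_right_inverse_on[OF qlinear_qbd subspace_qchains] by blast
  then obtain g where g: "\<And>p. range (g p) \<subseteq> ?C p" "\<And>p. qlinear (g p)"
    "\<And>p y. y \<in> ?d ` ?C p \<Longrightarrow> ?d (g p y) = y" by metis
  have "\<exists>\<pi>. qlinear \<pi> \<and> range \<pi> \<subseteq> ?d ` ?C (Suc p) \<and> (\<forall>u\<in>?d ` ?C (Suc p). \<pi> u = u)" for p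
    using qv.subspace_projection[OF subspace_boundaries] by metis
  then obtain \<pi>0 where \<pi>0: "\<And>p. qlinear (\<pi>0 p)" "\<And>p. range (\<pi>0 p) \<subseteq> ?d ` ?C (Suc p)"
    "\<And>p u. u \<in> ?d ` ?C (Suc p) \<Longrightarrow> \<pi>0 p u = u" by metis
  \<comment> \<open>For \<open>x\<close> in degree \<open>p\<close> the chain
    \<open>x - g p (qbd G x)\<close> is a cycle; \<open>\<pi>\<close> takes its boundary component
    and \<open>\<phi>'\<close> keeps the rest.\<close>
  define \<pi> where "\<pi> p x = \<pi>0 p (x - g p (?d x))" for p x
  define s' where "s' p x = g (Suc p) (\<pi> p x)" for p x
  define \<phi>' where "\<phi>' p x = x - \<pi> p x - g p (?d x)" for p x
  have lin_\<pi>: "qlinear (\<pi> p)" for p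
    unfolding \<pi>_def[abs_def]
    by (intro qlinear_compose[OF \<pi>0(1)] qlinear_intros qlinear_compose[OF g(2)])
  have lin_s': "qlinear (s' p)" for p
    unfolding s'_def[abs_def] by (intro qlinear_compose[OF g(2)] lin_\<pi>)
  have lin_\<phi>': "qlinear (\<phi>' p)" for p
    unfolding \<phi>'_def[abs_def] by (intro qlinear_intros lin_\<pi> qlinear_compose[OF g(2)])
  \<comment> \<open>Chains are not graded by their type, so the maps of the separate degrees are
    joined by prescribing them on cells according to \<open>cube_dim\<close>.\<close>
  define s where "s = qext (\<lambda>S. s' (cube_dim S) (qcell S))"
  define \<phi> where "\<phi> = qext (\<lambda>S. \<phi>' (cube_dim S) (qcell S))"
  have s: "s x = s' p x" and \<phi>: "\<phi> x = \<phi>' p x" if "x \<in> ?C p" for x p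
    by (rule qlinear_eq_on_qchains[OF _ _ _ that],
        auto simp: s_def \<phi>_def cells_def intro: qlinear_qext lin_s' lin_\<phi>')+
  have gC: "g p y \<in> ?C p" for p y using g(1) by blast
  have \<pi>B: "\<pi> p x \<in> ?d ` ?C (Suc p)" for p x
    unfolding \<pi>_def using \<pi>0(2)[of p] by blast
  have BC: "y \<in> ?C p" "?d y = 0" if "y \<in> ?d ` ?C (Suc p)" for y p
    using that qbd_in_cells[OF P] dd by auto
  have \<phi>C: "\<phi>' p x \<in> ?C p" if "x \<in> ?C p" for p x
    unfolding \<phi>'_def by (intro qchains_closed that gC BC(1)[OF \<pi>B])
  have dg: "?d (g p (?d x)) = ?d x" if "x \<in> ?C p" for p x using g(3) that by blast
  have d\<phi>: "?d (\<phi>' p x) = 0" if "x \<in> ?C p" for p x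
    using dg[OF that] BC(2)[OF \<pi>B] by (simp add: \<phi>'_def qbd_simps)
  have g0: "g p 0 = 0" for p using qlinear_simps(1)[OF g(2)] .
  have cyc: "\<pi> p y = \<pi>0 p y" "\<phi>' p y = y - \<pi>0 p y" if "?d y = 0" for p y
    using that g0 by (simp_all add: \<pi>_def \<phi>'_def)
  have "chain_retract G P \<phi> s"
    unfolding chain_retract_def
  proof (intro conjI allI ballI)
    fix p x assume x: "x \<in> ?C p"
    show "\<phi> x \<in> ?C p" using \<phi>[OF x] \<phi>C[OF x] by simp
    show "s x \<in> ?C (Suc p)" using s[OF x] gC by (simp add: s'_def)
    show "?d (\<phi> x) = 0" using \<phi>[OF x] d\<phi>[OF x] by simp
    have "\<pi>0 p (\<phi>' p x) = \<pi>0 p (x - g p (?d x)) - \<pi>0 p (\<pi> p x)"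
      by (simp add: \<phi>'_def qlinear_simps[OF \<pi>0(1)])
    also have "\<dots> = 0" using \<pi>0(3)[OF \<pi>B] by (simp add: \<pi>_def)
    finally show "\<phi> (\<phi> x) = \<phi> x"
      using \<phi>[OF x] \<phi>[OF \<phi>C[OF x]] cyc(2)[OF d\<phi>[OF x]] by simp
    \<comment> \<open>\<open>?d x\<close> lies one degree lower and is fixed by the projection to
      boundaries, so \<open>\<phi>\<close> kills it and \<open>s\<close> lifts it by
      \<open>g p\<close>. In degree 0 it is zero.\<close>
    have "\<phi> (?d x) = 0 \<and> s (?d x) = g p (?d x)"
      using qbd_in_cells_pred[OF P x]
    proof cases
      case 1
      then show ?thesis
        using g0 by (simp add: \<phi>_def s_def qext_simps)
    next
      case (2 q)
      have dx: "?d x \<in> ?d ` ?C (Suc q)" using x 2 by blast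
      show ?thesis
        using \<phi>[OF 2(2)] s[OF 2(2)] cyc[OF dd[OF x], of q] \<pi>0(3)[OF dx] 2(1) by (simp add: s'_def)
    qed
    moreover have "?d (s x) = \<pi> p x"
      using s[OF x] g(3)[OF \<pi>B] by (simp add: s'_def)
    ultimately show "\<phi> (?d x) = 0" "x = \<phi> x + ?d (s x) + s (?d x)"
      using \<phi>[OF x] by (simp_all add: \<phi>'_def)
  qed (auto simp: s_def \<phi>_def qlinear_qext)
  then show ?thesis using that by blast
qed

lemma q_dim_0 [simp]: "qv.dim {0} = 0"
  by (rule qv.dim_unique[OF _ _ qv.independent_empty]) auto

text \<open>The image of \<open>\<phi>\<close> complements the boundaries inside the cycles: the
  homotopy formula shows that they span, and \<open>\<phi>\<close> is the identity on its image but
  zero on boundaries.\<close>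

lemma hrank_chain_retract:
  assumes P: "cube_complex G P" and r: "chain_retract G P \<phi> s"
  shows "hrank G p P = int (qv.dim (\<phi> ` qchains (cells p P)))"
proof -
  let ?C = "\<lambda>p. qchains (cells p P)"
  note rD = chain_retractD[OF r]
  have lin: "qlinear \<phi>" using r by (simp add: chain_retract_def)
  let ?U = "\<phi> ` ?C p" and ?B = "qbd G ` ?C (Suc p)"
  have fin: "finite (cells p P)" using P by (simp add: cube_complex_def finite_cells)
  have BZ: "?B \<subseteq> cycles G p P" by (rule boundaries_subset_cycles[OF P])
  have UZ: "?U \<subseteq> cycles G p P" using rD by (auto simp: cycles_def)
  have ZC: "cycles G p P \<subseteq> ?C p" by (auto simp: cycles_def)
  have "cycles G p P = {x + y |x y. x \<in> ?U \<and> y \<in> ?B}"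
  proof
    show "cycles G p P \<subseteq> {x + y |x y. x \<in> ?U \<and> y \<in> ?B}"
    proof
      fix z assume "z \<in> cycles G p P"
      then have z: "z \<in> ?C p" "qbd G z = 0" by (auto simp: cycles_def)
      have "s 0 = 0" using r qlinear_simps(1) by (auto simp: chain_retract_def)
      then have "z = \<phi> z + qbd G (s z)" using rD(6)[OF z(1)] z(2) by simp
      then show "z \<in> {x + y |x y. x \<in> ?U \<and> y \<in> ?B}" using z(1) rD(2)[OF z(1)] by blast
    qed
    show "{x + y |x y. x \<in> ?U \<and> y \<in> ?B} \<subseteq> cycles G p P"
      using UZ BZ qv.subspace_add[OF subspace_cycles] by blast
  qed
  moreover have "?U \<inter> ?B = {0}"
  proof
    show "?U \<inter> ?B \<subseteq> {0}"
    proof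
      fix u assume "u \<in> ?U \<inter> ?B"
      then obtain x y where x: "x \<in> ?C p" "u = \<phi> x" and y: "y \<in> ?C (Suc p)" "u = qbd G y" by blast
      have "u = \<phi> u" using rD(5)[OF x(1)] x(2) by simp
      then show "u \<in> {0}" using rD(4)[OF y(1)] y(2) by simp
    qed
    show "{0} \<subseteq> ?U \<inter> ?B"
      using qv.subspace_0[OF subspace_qlinear_image[OF lin subspace_qchains]]
        qv.subspace_0[OF subspace_boundaries] by blast
  qed
  ultimately show ?thesis
    using q_dim_sum_Int[OF subspace_qlinear_image[OF lin subspace_qchains] subspace_boundaries
        subset_trans[OF UZ ZC] subset_trans[OF BZ ZC] fin]
    by (simp add: hrank_def bd_rank_def)
qed

text \<open>All conditions are linear in \<open>z\<close>, so on a product complex they need to be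
  verified only for cross products.\<close>

lemma subspace_retract_conditions:
  assumes F: "qlinear F" and H: "qlinear H" and A: "qv.subspace A" and B: "qv.subspace B"
  shows "qv.subspace {z. F z \<in> A \<and> H z \<in> B \<and> qbd G (F z) = 0 \<and> F (qbd G z) = 0 \<and> F (F z) = F z \<and>
    F z + qbd G (H z) + H (qbd G z) = z}" (is "qv.subspace ?U")
proof (rule qv.subspaceI)
  show "0 \<in> ?U"
    using qv.subspace_0[OF A] qv.subspace_0[OF B] qlinear_simps(1)[OF F] qlinear_simps(1)[OF H]
    by (simp add: qbd_simps)
  show "x + y \<in> ?U" if xy: "x \<in> ?U" "y \<in> ?U" for x y
  proof -
    have "F (x + y) + qbd G (H (x + y)) + H (qbd G (x + y))
        = (F x + qbd G (H x) + H (qbd G x)) + (F y + qbd G (H y) + H (qbd G y))"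
      by (simp only: qlinear_simps[OF F] qlinear_simps[OF H] qbd_simps) (simp only: ac_simps)
    also have "\<dots> = x + y" using xy by simp
    finally show ?thesis
      using xy qv.subspace_add[OF A] qv.subspace_add[OF B]
      by (simp add: qlinear_simps[OF F] qlinear_simps[OF H] qbd_simps)
  qed
  show "qscale c x \<in> ?U" if x: "x \<in> ?U" for c x
  proof -
    have "F (qscale c x) + qbd G (H (qscale c x)) + H (qbd G (qscale c x))
        = qscale c (F x + qbd G (H x) + H (qbd G x))"
      by (simp only: qlinear_simps[OF F] qlinear_simps[OF H] qbd_simps qv.scale_right_distrib)
    also have "\<dots> = qscale c x" using x by simp
    finally show ?thesis
      using x qv.subspace_scale[OF A] qv.subspace_scale[OF B]
      by (simp add: qlinear_simps[OF F] qlinear_simps[OF H] qbd_simps)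
  qed
qed

context disjoint_cells
begin

text \<open>A cell \<open>U\<close> within \<open>L \<union> R\<close> is its shuffle sign times the
  cross product of its two parts, which is why this sign appears.\<close>

definition tensor where
  "tensor \<alpha> \<beta> = qext (\<lambda>U. qscale (shuffle_sgn (edges (U \<inter> L)) (edges (U \<inter> R)))
     (cross (\<alpha> (qcell (U \<inter> L))) (\<beta> (qcell (U \<inter> R)))))"

lemma qlinear_tensor: "qlinear (tensor \<alpha> \<beta>)"
  unfolding tensor_def by (rule qlinear_qext)

lemma tensor_cross:
  assumes "qlinear \<alpha>" "qlinear \<beta>" "x \<in> qchains (Pow L)" "y \<in> qchains (Pow R)"
  shows "tensor \<alpha> \<beta> (cross x y) = cross (\<alpha> x) (\<beta> y)"
proof (rule qbilinear_eq_on_qchains[OF _ _ _ _ _ assms(3,4)])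
  fix S T assume "S \<in> Pow L" "T \<in> Pow R"
  then show "tensor \<alpha> \<beta> (cross (qcell S) (qcell T)) = cross (\<alpha> (qcell S)) (\<beta> (qcell T))"
    using union_parts[of S T]
    by (simp add: cross_cell tensor_def qext_simps shuffle_sgn_sq)
qed (auto intro!: qlinear_compose[OF qlinear_tensor] qlinear_cross_left qlinear_cross_right
    qlinear_compose[OF qlinear_cross_left assms(1)] qlinear_compose[OF qlinear_cross_right assms(2)])

end

locale product_complex = disjoint_cells L R for L R :: "('a, 'b) gcell set" +
  fixes G :: "('a, 'b) pre_digraph" and P Q :: "('a, 'b) gcell set set"
  assumes P: "cube_complex G P" "P \<subseteq> Pow L" and Q: "cube_complex G Q" "Q \<subseteq> Pow R"
begin

lemma cells_conf_prod:
  assumes "S \<in> cells p P" "T \<in> cells q Q"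
  shows "S \<union> T \<in> cells (p + q) (conf_prod P Q)"
proof -
  have "S \<subseteq> L" "T \<subseteq> R" using assms P(2) Q(2) by (auto simp: cells_def)
  moreover have "edges (S \<union> T) = edges S \<union> edges T" by (auto simp: edges_def)
  moreover have "finite S" "finite T" using assms P(1) Q(1) by (auto simp: cells_def cube_complex_def)
  ultimately have "cube_dim (S \<union> T) = cube_dim S + cube_dim T"
    using edges_disjoint[of S T] by (simp add: cube_dim_edges card_Un_disjoint finite_edges)
  then show ?thesis using assms by (auto simp: cells_def conf_prod_def)
qed

lemma cells_conf_prodE:
  assumes "U \<in> cells m (conf_prod P Q)"
  obtains p S T where "p \<le> m" "S \<in> cells p P" "T \<in> cells (m - p) Q" "U = S \<union> T"
proof -
  obtain S T where ST: "S \<in> P" "T \<in> Q" "U = S \<union> T"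
    using assms by (auto simp: cells_def conf_prod_def)
  then have "U \<in> cells (cube_dim S + cube_dim T) (conf_prod P Q)"
    using cells_conf_prod[of S "cube_dim S" T "cube_dim T"] by (simp add: cells_def)
  then have "m = cube_dim S + cube_dim T" using assms by (simp add: cells_def)
  then show ?thesis using that[of "cube_dim S" S T] ST by (simp add: cells_def)
qed

lemma cube_complex_conf_prod: "cube_complex G (conf_prod P Q)"
  unfolding cube_complex_def
proof (intro conjI ballI)
  have "conf_prod P Q = (\<lambda>(S, T). S \<union> T) ` (P \<times> Q)" by (auto simp: conf_prod_def)
  then show "finite (conf_prod P Q)" using P(1) Q(1) by (simp add: cube_complex_def)
  fix U assume "U \<in> conf_prod P Q"
  then obtain S T where ST: "S \<in> P" "T \<in> Q" "U = S \<union> T" by (auto simp: conf_prod_def)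
  then show "finite U" using P(1) Q(1) by (simp add: cube_complex_def)
  have disjST: "edges S \<inter> edges T = {}" using edges_disjoint ST P(2) Q(2) by blast
  fix e assume "e \<in> edges U"
  then consider "e \<in> edges S" "e \<notin> edges T" | "e \<in> edges T" "e \<notin> edges S"
    using ST disjST by (auto simp: edges_def)
  then have "face h U e \<in> conf_prod P Q" if "\<And>S. S \<in> P \<Longrightarrow> e \<in> edges S \<Longrightarrow> face h S e \<in> P"
    "\<And>T. T \<in> Q \<Longrightarrow> e \<in> edges T \<Longrightarrow> face h T e \<in> Q" for h :: "'b \<Rightarrow> 'a"
  proof cases
    case 1
    then have "face h U e = face h S e \<union> T" using ST by (auto simp: face_def edges_def)
    then show ?thesis using that(1)[OF ST(1) 1(1)] ST(2) by (auto simp: conf_prod_def)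
  next
    case 2
    then have "face h U e = S \<union> face h T e" using ST by (auto simp: face_def edges_def)
    then show ?thesis using that(2)[OF ST(2) 2(1)] ST(1) by (auto simp: conf_prod_def)
  qed
  then show "face (head G) U e \<in> conf_prod P Q" "face (tail G) U e \<in> conf_prod P Q"
    using P(1) Q(1) by (auto simp: cube_complex_def)
qed

lemma PL: "x \<in> qchains (cells p P) \<Longrightarrow> x \<in> qchains (Pow L)"
  using P(2) qchains_mono[of P "Pow L"] qchains_cells_sub by blast

lemma QR: "x \<in> qchains (cells p Q) \<Longrightarrow> x \<in> qchains (Pow R)"
  using Q(2) qchains_mono[of Q "Pow R"] qchains_cells_sub by blast

lemma cross_in_cells:
  assumes "x \<in> qchains (cells p P)" "y \<in> qchains (cells q Q)"
  shows "cross x y \<in> qchains (cells (p + q) (conf_prod P Q))"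
  by (rule qbilinear_qchains_into[OF _ _ _ _ assms])
    (auto intro!: qlinear_cross_left qlinear_cross_right qchains_closed cells_conf_prod simp: cross_cell)

lemma qcell_conf_prod:
  assumes "U \<in> cells m (conf_prod P Q)"
  obtains p S T where "p \<le> m" "S \<in> cells p P" "T \<in> cells (m - p) Q"
    "qcell U = qscale (shuffle_sgn (edges S) (edges T)) (cross (qcell S) (qcell T))"
proof -
  obtain p S T where "p \<le> m" "S \<in> cells p P" "T \<in> cells (m - p) Q" "U = S \<union> T"
    by (rule cells_conf_prodE[OF assms])
  then show ?thesis using that[of p S T] by (simp add: cross_cell shuffle_sgn_sq)
qed

lemma qbd_cross_cells:
  assumes "x \<in> qchains (cells p P)" "y \<in> qchains (cells q Q)"
  shows "qbd G (cross x y) = cross (qbd G x) y + qscale ((- 1) ^ p) (cross x (qbd G y))"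
  using qbd_cross[OF PL[OF assms(1)] QR[OF assms(2)]] parity_cells[OF assms(1)]
  by (simp add: cross_simps)

text \<open>The usual homotopy for a tensor product: contract the first factor by \<open>s\<close>,
  then the second by \<open>s'\<close> on what \<open>\<phi>\<close> leaves. The sign in
  \<open>parity\<close> cancels the one from the Leibniz rule.\<close>

lemma chain_retract_conf_prod:
  assumes r: "chain_retract G P \<phi> s" and r': "chain_retract G Q \<phi>' s'"
  shows "chain_retract G (conf_prod P Q) (tensor \<phi> \<phi>')
    (\<lambda>z. tensor s (\<lambda>y. y) z + tensor (\<lambda>x. parity (\<phi> x)) s' z)"
proof -
  let ?\<Phi> = "tensor \<phi> \<phi>'"
  let ?\<Sigma> = "\<lambda>z. tensor s (\<lambda>y. y) z + tensor (\<lambda>x. parity (\<phi> x)) s' z"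
  let ?C = "\<lambda>p. qchains (cells p P)" and ?D = "\<lambda>p. qchains (cells p Q)"
    and ?X = "\<lambda>p. qchains (cells p (conf_prod P Q))"
  have lin: "qlinear \<phi>" "qlinear s" "qlinear \<phi>'" "qlinear s'" "qlinear (\<lambda>x. parity (\<phi> x))"
    using r r' qlinear_compose[OF qlinear_parity] by (auto simp: chain_retract_def)
  have lin\<Phi>: "qlinear ?\<Phi>" and lin\<Sigma>: "qlinear ?\<Sigma>"
    by (auto intro!: qlinear_tensor qlinear_add)
  note rD = chain_retractD[OF r] and rD' = chain_retractD[OF r']
  have \<Phi>: "?\<Phi> (cross x y) = cross (\<phi> x) (\<phi>' y)"
    if "x \<in> qchains (Pow L)" "y \<in> qchains (Pow R)" for x y
    by (rule tensor_cross[OF lin(1,3) that])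
  have \<Sigma>: "?\<Sigma> (cross x y) = cross (s x) y + cross (parity (\<phi> x)) (s' y)"
    if "x \<in> qchains (Pow L)" "y \<in> qchains (Pow R)" for x y
    using tensor_cross[OF lin(2) qlinear_ident that] tensor_cross[OF lin(5,4) that] by simp
  have dL: "qbd G x \<in> qchains (Pow L)" if "x \<in> ?C p" for x p
    using qbd_in_complex[OF P(1) qchains_cells_sub[OF that]] qchains_mono[OF P(2)] by blast
  have dR: "qbd G x \<in> qchains (Pow R)" if "x \<in> ?D p" for x p
    using qbd_in_complex[OF Q(1) qchains_cells_sub[OF that]] qchains_mono[OF Q(2)] by blast
  have key: "?\<Phi> z \<in> ?X (p + q) \<and> ?\<Sigma> z \<in> ?X (Suc (p + q)) \<and> qbd G (?\<Phi> z) = 0 \<and>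
      ?\<Phi> (qbd G z) = 0 \<and> ?\<Phi> (?\<Phi> z) = ?\<Phi> z \<and> ?\<Phi> z + qbd G (?\<Sigma> z) + ?\<Sigma> (qbd G z) = z"
    if x: "x \<in> ?C p" and y: "y \<in> ?D q" and z: "z = cross x y" for x y z p q
  proof (intro conjI)
    have xL: "x \<in> qchains (Pow L)" "\<phi> x \<in> qchains (Pow L)"
      and yR: "y \<in> qchains (Pow R)" "\<phi>' y \<in> qchains (Pow R)"
      using PL QR x y rD(1)[OF x] rD'(1)[OF y] by blast+
    have par: "parity (\<phi> x) = qscale ((- 1) ^ p) (\<phi> x)" by (rule parity_cells[OF rD(1)[OF x]])
    have \<Phi>z: "?\<Phi> z = cross (\<phi> x) (\<phi>' y)" unfolding z by (rule \<Phi>[OF xL(1) yR(1)])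
    have \<Sigma>z: "?\<Sigma> z = cross (s x) y + qscale ((- 1) ^ p) (cross (\<phi> x) (s' y))"
      unfolding z \<Sigma>[OF xL(1) yR(1)] par by (simp add: cross_simps)
    show "?\<Phi> z \<in> ?X (p + q)"
      unfolding \<Phi>z by (rule cross_in_cells[OF rD(1)[OF x] rD'(1)[OF y]])
    show "?\<Sigma> z \<in> ?X (Suc (p + q))"
      unfolding \<Sigma>z using cross_in_cells[OF rD(2)[OF x] y] cross_in_cells[OF rD(1)[OF x] rD'(2)[OF y]]
      by (intro qchains_closed) auto
    show "qbd G (?\<Phi> z) = 0"
      unfolding \<Phi>z qbd_cross_cells[OF rD(1)[OF x] rD'(1)[OF y]]
      by (simp add: rD(3)[OF x] rD'(3)[OF y] cross_simps)
    show "?\<Phi> (?\<Phi> z) = ?\<Phi> z"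
      unfolding \<Phi>z \<Phi>[OF xL(2) yR(2)] by (simp add: rD(5)[OF x] rD'(5)[OF y])
    have dz: "qbd G z = cross (qbd G x) y + qscale ((- 1) ^ p) (cross x (qbd G y))"
      unfolding z by (rule qbd_cross_cells[OF x y])
    show "?\<Phi> (qbd G z) = 0"
      unfolding dz qlinear_simps[OF lin\<Phi>] \<Phi>[OF dL[OF x] yR(1)] \<Phi>[OF xL(1) dR[OF y]]
      by (simp add: rD(4)[OF x] rD'(4)[OF y] cross_simps)
    have "parity (\<phi> (qbd G x)) = 0" using rD(4)[OF x] qlinear_simps(1)[OF qlinear_parity] by simp
    then have "?\<Sigma> (qbd G z) = cross (s (qbd G x)) y + qscale ((- 1) ^ p) (cross (s x) (qbd G y))
        + cross (\<phi> x) (s' (qbd G y))"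
      unfolding dz qlinear_simps(2,5)[OF lin\<Sigma>] \<Sigma>[OF dL[OF x] yR(1)] \<Sigma>[OF xL(1) dR[OF y]] par
      by (simp add: cross_simps qv.scale_right_distrib algebra_simps flip: power_mult_distrib)
    moreover have "qbd G (?\<Sigma> z) = cross (qbd G (s x)) y - qscale ((- 1) ^ p) (cross (s x) (qbd G y))
        + cross (\<phi> x) (qbd G (s' y))"
      unfolding \<Sigma>z qbd_simps qbd_cross_cells[OF rD(2)[OF x] y] qbd_cross_cells[OF rD(1)[OF x] rD'(2)[OF y]]
      by (simp add: rD(3)[OF x] cross_simps flip: power_mult_distrib)
    \<comment> \<open>The two terms with \<open>cross (s x) (qbd G y)\<close> have opposite signs
      because \<open>s\<close> raises the degree by one. There remain the homotopy identity of the
      second factor, crossed with \<open>\<phi> x\<close>, and then that of the first, crossed with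
      \<open>y\<close>.\<close>
    ultimately have "?\<Phi> z + qbd G (?\<Sigma> z) + ?\<Sigma> (qbd G z)
        = cross (qbd G (s x) + s (qbd G x)) y + cross (\<phi> x) (\<phi>' y + qbd G (s' y) + s' (qbd G y))"
      unfolding \<Phi>z by (simp add: cross_simps)
    also have "\<dots> = cross (qbd G (s x) + s (qbd G x)) y + cross (\<phi> x) y"
      unfolding rD'(6)[OF y] ..
    also have "\<dots> = cross (\<phi> x + qbd G (s x) + s (qbd G x)) y" by (simp add: cross_simps)
    also have "\<dots> = z" unfolding rD(6)[OF x] z ..
    finally show "?\<Phi> z + qbd G (?\<Sigma> z) + ?\<Sigma> (qbd G z) = z" .
  qed
  let ?good = "\<lambda>m. {z. ?\<Phi> z \<in> ?X m \<and> ?\<Sigma> z \<in> ?X (Suc m) \<and> qbd G (?\<Phi> z) = 0 \<and>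
      ?\<Phi> (qbd G z) = 0 \<and> ?\<Phi> (?\<Phi> z) = ?\<Phi> z \<and> ?\<Phi> z + qbd G (?\<Sigma> z) + ?\<Sigma> (qbd G z) = z}"
  have sub: "qv.subspace (?good m)" for m
    by (rule subspace_retract_conditions[OF lin\<Phi> lin\<Sigma>]) auto
  have "z \<in> ?good m" if "z \<in> ?X m" for m z
  proof -
    have "qcell U \<in> ?good m" if U: "U \<in> cells m (conf_prod P Q)" for U
    proof -
      obtain p S T where ST: "p \<le> m" "S \<in> cells p P" "T \<in> cells (m - p) Q"
        "qcell U = qscale (shuffle_sgn (edges S) (edges T)) (cross (qcell S) (qcell T))"
        by (rule qcell_conf_prod[OF U])
      have "cross (qcell S) (qcell T) \<in> ?good m"
        using key[of "qcell S" p "qcell T" "m - p", OF _ _ refl] ST(1-3) by simp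
      then show ?thesis unfolding ST(4) by (rule qv.subspace_scale[OF sub])
    qed
    then show ?thesis by (rule qlinear_qchains_into[OF qlinear_ident _ sub that])
  qed
  then show ?thesis
    unfolding chain_retract_def using lin\<Phi> lin\<Sigma> by (intro conjI allI ballI) force+
qed

lemma cross_span:
  assumes "u \<in> qv.span B" "u' \<in> qv.span B'" "\<And>b b'. b \<in> B \<Longrightarrow> b' \<in> B' \<Longrightarrow> cross b b' \<in> qv.span Z"
  shows "cross u u' \<in> qv.span Z"
proof -
  have "cross b u' \<in> qv.span Z" if "b \<in> B" for b
    using assms(2)
    by (induction rule: qv.span_induct_alt)
      (auto simp: cross_simps intro!: qv.span_add qv.span_scale qv.span_zero assms(3) that)
  with assms(1) show ?thesis
    by (induction rule: qv.span_induct_alt)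
      (auto simp: cross_simps intro!: qv.span_add qv.span_scale qv.span_zero)
qed

text \<open>Read off coefficients at \<open>S \<union> T\<close>. For fixed \<open>T\<close> the
  independence of \<open>B p\<close> removes the sum over \<open>u\<close>; the independence of
  \<open>B' (m - p)\<close> then removes the sum over \<open>u'\<close>.\<close>

lemma cross_independent:
  assumes B: "\<And>p. B p \<subseteq> qchains (cells p P)" "\<And>p. qv.independent (B p)" "\<And>p. finite (B p)"
    and B': "\<And>p. B' p \<subseteq> qchains (cells p Q)" "\<And>p. qv.independent (B' p)" "\<And>p. finite (B' p)"
    and zero: "(\<Sum>(p, u, u')\<in>Sigma {..m} (\<lambda>p. B p \<times> B' (m - p)). qscale (c (p, u, u')) (cross u u')) = 0"
    and i: "p \<le> m" "u \<in> B p" "u' \<in> B' (m - p)"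
  shows "c (p, u, u') = 0"
proof -
  have *: "(\<Sum>u\<in>B p. (\<Sum>u'\<in>B' (m - p). c (p, u, u') * Poly_Mapping.lookup u' T) * Poly_Mapping.lookup u S) = 0"
    if T: "T \<in> Pow R" for S T
  proof (cases "S \<in> cells p P")
    case True
    then have S: "S \<in> Pow L" using P(2) by (auto simp: cells_def)
    let ?e = "shuffle_sgn (edges S) (edges T)"
    let ?f = "\<lambda>q. \<Sum>u\<in>B q. \<Sum>u'\<in>B' (m - q). c (q, u, u') * Poly_Mapping.lookup u S * Poly_Mapping.lookup u' T"
    have lk: "Poly_Mapping.lookup (cross u u') (S \<union> T) = ?e * Poly_Mapping.lookup u S * Poly_Mapping.lookup u' T"
      if "u \<in> B q" "u' \<in> B' (m - q)" for q u u'
      by (rule lookup_cross) (use that B(1) B'(1) PL QR S T in blast)+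
    \<comment> \<open>A cell \<open>S\<close> of dimension \<open>p\<close> does not occur in basis
      elements of other degrees, so only the summand \<open>p\<close> survives.\<close>
    have f0: "?f q = 0" if "q \<noteq> p" for q
    proof (intro sum.neutral ballI)
      fix u u' assume "u \<in> B q" "u' \<in> B' (m - q)"
      moreover have "S \<notin> cells q P" using True that by (auto simp: cells_def)
      ultimately have "Poly_Mapping.lookup u S = 0"
        using subsetD[OF B(1)[of q], of u] unfolding qchains_iff by blast
      then show "c (q, u, u') * Poly_Mapping.lookup u S * Poly_Mapping.lookup u' T = 0" by simp
    qed
    have "0 = (\<Sum>(q, u, u')\<in>Sigma {..m} (\<lambda>p. B p \<times> B' (m - p)).
        c (q, u, u') * Poly_Mapping.lookup (cross u u') (S \<union> T))"
      using arg_cong[OF zero, of "\<lambda>x. Poly_Mapping.lookup x (S \<union> T)"]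
      by (simp add: lookup_sum case_prod_unfold)
    also have "\<dots> = (\<Sum>(q, u, u')\<in>Sigma {..m} (\<lambda>p. B p \<times> B' (m - p)).
        ?e * (c (q, u, u') * Poly_Mapping.lookup u S * Poly_Mapping.lookup u' T))"
      by (rule sum.cong) (auto simp: lk)
    also have "\<dots> = (\<Sum>q\<le>m. \<Sum>(u, u')\<in>B q \<times> B' (m - q).
        ?e * (c (q, u, u') * Poly_Mapping.lookup u S * Poly_Mapping.lookup u' T))"
      by (subst sum.Sigma) (auto simp: B(3) B'(3) case_prod_unfold)
    also have "\<dots> = ?e * (\<Sum>q\<le>m. ?f q)"
      by (simp add: sum.cartesian_product[symmetric] sum_distrib_left)
    also have "(\<Sum>q\<le>m. ?f q) = ?f p"
      by (subst sum.remove[of _ p]) (use i(1) f0 in auto)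
    finally have "?e * (?e * ?f p) = 0" by simp
    then have "?f p = 0" by (simp add: mult.assoc[symmetric] shuffle_sgn_sq)
    then show ?thesis by (simp add: sum_distrib_left sum_distrib_right mult.assoc mult.commute mult.left_commute)
  next
    case False
    then have "Poly_Mapping.lookup u S = 0" if "u \<in> B p" for u
      using subsetD[OF B(1)[of p] that] unfolding qchains_iff by blast
    then show ?thesis by simp
  qed
  have "(\<Sum>u'\<in>B' (m - p). c (p, u, u') * Poly_Mapping.lookup u' T) = 0" for T
  proof (cases "T \<in> Pow R")
    case True
    have "(\<Sum>u\<in>B p. qscale (\<Sum>u'\<in>B' (m - p). c (p, u, u') * Poly_Mapping.lookup u' T) u) = 0"
      by (rule poly_mapping_eqI) (simp add: lookup_sum *[OF True])
    then show ?thesis by (rule qv.independentD[OF B(2,3) subset_refl _ i(2)])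
  next
    case False
    then have "Poly_Mapping.lookup u' T = 0" if "u' \<in> B' (m - p)" for u'
      using QR[OF subsetD[OF B'(1) that]] unfolding qchains_iff by blast
    then show ?thesis by simp
  qed
  then have "(\<Sum>u'\<in>B' (m - p). qscale (c (p, u, u')) u') = 0"
    by (intro poly_mapping_eqI) (simp add: lookup_sum)
  then show ?thesis by (rule qv.independentD[OF B'(2,3) subset_refl _ i(3)])
qed

lemma finite_independent_qchains:
  assumes "qv.independent B" "B \<subseteq> qchains X" "finite X"
  shows "finite B"
  using qv.independent_span_bound[of "qcell ` X" B] assms qchains_eq_span[of X] by auto

text \<open>All Betti numbers are dimensions of images of retractions, and the products of basis
  elements for \<open>\<phi>\<close> and \<open>\<phi>'\<close> form a basis of the image of
  \<open>tensor \<phi> \<phi>'\<close>.\<close>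

theorem hrank_conf_prod:
  "hrank G m (conf_prod P Q) = (\<Sum>p\<le>m. hrank G p P * hrank G (m - p) Q)"
proof -
  let ?C = "\<lambda>p. qchains (cells p P)" and ?D = "\<lambda>p. qchains (cells p Q)"
    and ?X = "qchains (cells m (conf_prod P Q))"
  obtain \<phi> s where r: "chain_retract G P \<phi> s" by (rule exists_chain_retract[OF P(1)])
  obtain \<phi>' s' where r': "chain_retract G Q \<phi>' s'" by (rule exists_chain_retract[OF Q(1)])
  let ?\<Phi> = "tensor \<phi> \<phi>'"
  have lin: "qlinear \<phi>" "qlinear \<phi>'" using r r' by (auto simp: chain_retract_def)
  have fin: "finite (cells p P)" "finite (cells p Q)" for p
    using P(1) Q(1) by (auto simp: cube_complex_def finite_cells)
  note rX = chain_retract_conf_prod[OF r r']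
  have "\<exists>B. B \<subseteq> \<phi> ` ?C p \<and> qv.independent B \<and> \<phi> ` ?C p \<subseteq> qv.span B \<and> card B = qv.dim (\<phi> ` ?C p)" for p
    using qv.basis_exists by metis
  then obtain B where B: "\<And>p. B p \<subseteq> \<phi> ` ?C p" "\<And>p. qv.independent (B p)"
    "\<And>p. \<phi> ` ?C p \<subseteq> qv.span (B p)" "\<And>p. card (B p) = qv.dim (\<phi> ` ?C p)" by metis
  have "\<exists>B. B \<subseteq> \<phi>' ` ?D p \<and> qv.independent B \<and> \<phi>' ` ?D p \<subseteq> qv.span B \<and> card B = qv.dim (\<phi>' ` ?D p)" for p
    using qv.basis_exists by metis
  then obtain B' where B': "\<And>p. B' p \<subseteq> \<phi>' ` ?D p" "\<And>p. qv.independent (B' p)"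
    "\<And>p. \<phi>' ` ?D p \<subseteq> qv.span (B' p)" "\<And>p. card (B' p) = qv.dim (\<phi>' ` ?D p)" by metis
  have BC: "B p \<subseteq> ?C p" and BD: "B' p \<subseteq> ?D p" for p
    using B(1)[of p] B'(1)[of p] chain_retractD(1)[OF r] chain_retractD(1)[OF r'] by auto
  have finB: "finite (B p)" "finite (B' p)" for p
    using finite_independent_qchains[OF B(2) BC fin(1)] finite_independent_qchains[OF B'(2) BD fin(2)]
    by auto
  let ?I = "Sigma {..m} (\<lambda>p. B p \<times> B' (m - p))" and ?r = "\<lambda>(p :: nat, u, u'). cross u u'"
  have finI: "finite ?I" using finB by auto
  have cardI: "card ?I = (\<Sum>p\<le>m. card (B p) * card (B' (m - p)))"
    by (subst card_SigmaI) (auto simp: finB card_cartesian_product)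
  have finX: "finite (cells m (conf_prod P Q))"
    using cube_complex_conf_prod by (simp add: cube_complex_def finite_cells)
  let ?V = "?\<Phi> ` ?X"
  have VX: "?V \<subseteq> ?X" using chain_retractD(1)[OF rX] by blast
  have "?V \<subseteq> qv.span (?r ` ?I)"
  proof
    fix z assume "z \<in> ?V"
    then obtain x where x: "z = ?\<Phi> x" "x \<in> ?X" by blast
    show "z \<in> qv.span (?r ` ?I)" unfolding x(1)
    proof (rule qlinear_qchains_into[OF qlinear_tensor _ qv.subspace_span x(2)])
      fix U assume U: "U \<in> cells m (conf_prod P Q)"
      obtain p S T where ST: "p \<le> m" "S \<in> cells p P" "T \<in> cells (m - p) Q"
        "qcell U = qscale (shuffle_sgn (edges S) (edges T)) (cross (qcell S) (qcell T))"
        by (rule qcell_conf_prod[OF U])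
      have "?\<Phi> (cross (qcell S) (qcell T)) = cross (\<phi> (qcell S)) (\<phi>' (qcell T))"
        by (rule tensor_cross[OF lin]) (use ST P(2) Q(2) in \<open>auto simp: cells_def\<close>)
      moreover have "cross (\<phi> (qcell S)) (\<phi>' (qcell T)) \<in> qv.span (?r ` ?I)"
      proof (rule cross_span)
        show "\<phi> (qcell S) \<in> qv.span (B p)" using B(3)[of p] ST(2) by auto
        show "\<phi>' (qcell T) \<in> qv.span (B' (m - p))" using B'(3)[of "m - p"] ST(3) by auto
        show "cross b b' \<in> qv.span (?r ` ?I)" if "b \<in> B p" "b' \<in> B' (m - p)" for b b'
          by (rule qv.span_base, rule image_eqI[of _ _ "(p, b, b')"]) (use that ST(1) in auto)
      qed
      ultimately show "?\<Phi> (qcell U) \<in> qv.span (?r ` ?I)"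
        unfolding ST(4) qlinear_simps(5)[OF qlinear_tensor] by (simp add: qv.span_scale)
    qed
  qed
  then have "qv.dim ?V \<le> card ?I"
    using qv.dim_le_card[of ?V "?r ` ?I"] card_image_le[OF finI, of ?r] finI by force
  \<comment> \<open>Independence modulo the zero space is applied to the family of products: it
    counts indices, so coincidences among the products are excluded as well.\<close>
  moreover have "card ?I + qv.dim {0 :: ('a, 'b) gcell set \<Rightarrow>\<^sub>0 rat} \<le> qv.dim ?V"
  proof (rule qv.card_independent_mod_le[of "{0}" ?V "qcell ` cells m (conf_prod P Q)" ?I ?r])
    show sV: "qv.subspace ?V" by (rule subspace_qlinear_image[OF qlinear_tensor subspace_qchains])
    show "{0} \<subseteq> ?V" using qv.subspace_0[OF sV] by simp
    show "?V \<subseteq> qv.span (qcell ` cells m (conf_prod P Q))" using VX qchains_eq_span by blast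
    show "?r i \<in> ?V" if iI: "i \<in> ?I" for i
    proof -
      obtain p u u' where i: "i = (p, u, u')" "p \<le> m" "u \<in> B p" "u' \<in> B' (m - p)"
        using iI by auto
      have u: "u \<in> ?C p" "\<phi> u = u" and u': "u' \<in> ?D (m - p)" "\<phi>' u' = u'"
        using i BC BD B(1)[of p] B'(1)[of "m - p"] chain_retractD(5)[OF r] chain_retractD(5)[OF r'] by auto
      have "?\<Phi> (cross u u') = cross u u'"
        using tensor_cross[OF lin PL[OF u(1)] QR[OF u'(1)]] u(2) u'(2) by simp
      moreover have "cross u u' \<in> ?X" using cross_in_cells[OF u(1) u'(1)] i(2) by simp
      ultimately show ?thesis using i(1) by (metis (mono_tags, lifting) case_prod_conv image_eqI)
    qed
    show "c i = 0" if "(\<Sum>i\<in>?I. qscale (c i) (?r i)) \<in> {0}" and iI: "i \<in> ?I" for c i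
    proof -
      obtain p u u' where i: "i = (p, u, u')" "p \<le> m" "u \<in> B p" "u' \<in> B' (m - p)"
        using iI by auto
      show ?thesis unfolding i(1)
        by (rule cross_independent[OF BC B(2) finB(1) BD B'(2) finB(2) _ i(2-4)])
          (use that(1) in \<open>simp add: case_prod_unfold\<close>)
    qed
  qed (use finX finI in auto)
  ultimately have "qv.dim ?V = (\<Sum>p\<le>m. card (B p) * card (B' (m - p)))"
    using cardI by simp
  then show ?thesis
    by (simp add: hrank_chain_retract[OF cube_complex_conf_prod rX] hrank_chain_retract[OF P(1) r]
        hrank_chain_retract[OF Q(1) r'] B(4) B'(4))
qed

end

section \<open>Relative acyclicity\<close>

text \<open>Vanishing rational homology of the pair in all degrees at once: every relative cycle is
  a relative boundary. The ungraded form spares the induction along a leg any bookkeeping of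
  degrees.\<close>

definition rel_acyclic :: "('a, 'b) pre_digraph \<Rightarrow> ('a, 'b) gcell set set \<Rightarrow> ('a, 'b) gcell set set \<Rightarrow> bool" where
  "rel_acyclic G X Y \<longleftrightarrow> (\<forall>x\<in>qchains X. qbd G x \<in> qchains Y \<longrightarrow>
     (\<exists>y\<in>qchains X. x - qbd G y \<in> qchains Y))"

definition dim_part :: "nat \<Rightarrow> (('a, 'b) gcell set \<Rightarrow>\<^sub>0 rat) \<Rightarrow> (('a, 'b) gcell set \<Rightarrow>\<^sub>0 rat)" where
  "dim_part p = qext (\<lambda>S. if cube_dim S = p then qcell S else 0)"

lemma qlinear_dim_part: "qlinear (dim_part p)"
  unfolding dim_part_def by (rule qlinear_qext)

lemma dim_part_in_cells: "x \<in> qchains X \<Longrightarrow> dim_part p x \<in> qchains (cells p X)"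
  unfolding dim_part_def by (rule qext_in_qchains) (auto simp: cells_def qchains_closed(5))

lemma dim_part_cells:
  assumes "x \<in> qchains (cells q X)"
  shows "dim_part p x = (if q = p then x else 0)"
  by (rule qlinear_eq_on_qchains[OF qlinear_dim_part _ _ assms])
    (auto simp: dim_part_def cells_def intro: qlinearI)

lemma qbd_dim_part:
  assumes X: "cube_complex G X" and x: "x \<in> qchains X"
  shows "qbd G (dim_part (Suc p) x) = dim_part p (qbd G x)"
proof (rule qlinear_eq_on_qchains[OF _ _ _ x])
  fix S assume S: "S \<in> X"
  then have S': "qcell S \<in> qchains (cells (cube_dim S) X)" by (simp add: cells_def)
  have d0: "dim_part p 0 = 0" by (rule qlinear_simps(1)[OF qlinear_dim_part])
  show "qbd G (dim_part (Suc p) (qcell S)) = dim_part p (qbd G (qcell S))"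
    using qbd_in_cells_pred[OF X S']
    by cases (simp_all add: dim_part_cells[OF S'] dim_part_cells d0 qbd_simps)
qed (auto intro!: qlinear_intros qlinear_dim_part qlinear_compose[OF qlinear_dim_part])

text \<open>Acyclicity of the pair says that the cycles of \<open>X\<close> are those of
  \<open>Y\<close> plus boundaries of \<open>X\<close>, and that a cycle of \<open>Y\<close>
  bounding in \<open>X\<close> bounds in \<open>Y\<close>. The dimension formula turns this into
  equality of ranks.\<close>

lemma rel_acyclic_hrank:
  assumes X: "cube_complex G X" and Y: "cube_complex G Y" "Y \<subseteq> X" and acyc: "rel_acyclic G X Y"
  shows "hrank G p X = hrank G p Y"
proof -
  \<comment> \<open>The ungraded bounding chain is replaced by its component of degree
    \<open>Suc p\<close>.\<close>
  have graded: "\<exists>y\<in>qchains (cells (Suc p) X). x - qbd G y \<in> qchains (cells p Y)"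
    if x: "x \<in> qchains (cells p X)" and dx: "qbd G x \<in> qchains Y" for x p
  proof -
    obtain y where y: "y \<in> qchains X" "x - qbd G y \<in> qchains Y"
      using acyc qchains_cells_sub[OF x] dx by (auto simp: rel_acyclic_def)
    have "x - qbd G (dim_part (Suc p) y) = dim_part p (x - qbd G y)"
      using dim_part_cells[OF x, of p]
      by (simp add: qbd_dim_part[OF X y(1)] qlinear_simps[OF qlinear_dim_part])
    then show ?thesis using dim_part_in_cells y by metis
  qed
  have cY: "qchains (cells p Y) \<subseteq> qchains (cells p X)" for p
    by (rule qchains_mono[OF cells_mono[OF Y(2)]])
  let ?B = "qbd G ` qchains (cells (Suc p) X)"
  have BZ: "?B \<subseteq> cycles G p X" by (rule boundaries_subset_cycles[OF X])
  have ZC: "cycles G p X \<subseteq> qchains (cells p X)" by (auto simp: cycles_def)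
  have ZY: "cycles G p Y \<subseteq> cycles G p X" using cY by (auto simp: cycles_def)
  have "cycles G p X = {x + y |x y. x \<in> cycles G p Y \<and> y \<in> ?B}"
  proof
    show "cycles G p X \<subseteq> {x + y |x y. x \<in> cycles G p Y \<and> y \<in> ?B}"
    proof
      fix x assume x: "x \<in> cycles G p X"
      then obtain y where y: "y \<in> qchains (cells (Suc p) X)" "x - qbd G y \<in> qchains (cells p Y)"
        using graded[of x p] by (auto simp: cycles_def qchains_closed(5))
      moreover have "qbd G (x - qbd G y) = 0"
        using x qbd_qbd[OF X qchains_cells_sub[OF y(1)]] by (simp add: cycles_def qbd_simps)
      ultimately have "x - qbd G y \<in> cycles G p Y" by (simp add: cycles_def)
      moreover have "x = (x - qbd G y) + qbd G y" by simp
      ultimately show "x \<in> {x + y |x y. x \<in> cycles G p Y \<and> y \<in> ?B}" using y(1) by blast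
    qed
    show "{x + y |x y. x \<in> cycles G p Y \<and> y \<in> ?B} \<subseteq> cycles G p X"
      using ZY BZ qv.subspace_add[OF subspace_cycles] by blast
  qed
  moreover have "cycles G p Y \<inter> ?B = qbd G ` qchains (cells (Suc p) Y)"
  proof
    show "cycles G p Y \<inter> ?B \<subseteq> qbd G ` qchains (cells (Suc p) Y)"
    proof
      fix z assume "z \<in> cycles G p Y \<inter> ?B"
      then obtain x where x: "x \<in> qchains (cells (Suc p) X)" "z = qbd G x" "z \<in> qchains Y"
        using qchains_cells_sub by (auto simp: cycles_def)
      then obtain y where y: "y \<in> qchains (cells (Suc (Suc p)) X)" "x - qbd G y \<in> qchains (cells (Suc p) Y)"
        using graded[of x "Suc p"] by auto
      have "z = qbd G (x - qbd G y)"
        using x(2) qbd_qbd[OF X qchains_cells_sub[OF y(1)]] by (simp add: qbd_simps)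
      then show "z \<in> qbd G ` qchains (cells (Suc p) Y)" using y(2) by blast
    qed
    show "qbd G ` qchains (cells (Suc p) Y) \<subseteq> cycles G p Y \<inter> ?B"
      using boundaries_subset_cycles[OF Y(1)] cY by blast
  qed
  moreover have "finite (cells p X)" using X by (simp add: cube_complex_def finite_cells)
  ultimately show ?thesis
    using q_dim_sum_Int[OF subspace_cycles[of G p Y] subspace_boundaries subset_trans[OF ZY ZC] subset_trans[OF BZ ZC]]
    by (simp add: hrank_def bd_rank_def)
qed

section \<open>Configurations on a graph\<close>

lemma conf_complex_iff:
  "S \<in> conf_complex n G \<longleftrightarrow> S \<subseteq> graph_cells G \<and> finite S \<and> card S = n \<and>
     pairwise (\<lambda>\<sigma> \<tau>. disjnt (closed_cell G \<sigma>) (closed_cell G \<tau>)) S"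
  by (simp add: conf_complex_def)

lemma self_in_closed_cell: "\<sigma> \<in> closed_cell G \<sigma>"
  by (cases \<sigma>) auto

lemma insert_conf_complex_iff:
  assumes "\<sigma> \<notin> T"
  shows "insert \<sigma> T \<in> conf_complex n G \<longleftrightarrow> n > 0 \<and> \<sigma> \<in> graph_cells G \<and> T \<in> conf_complex (n - 1) G \<and>
    (\<forall>\<tau>\<in>T. disjnt (closed_cell G \<sigma>) (closed_cell G \<tau>))"
  using assms by (auto simp: conf_complex_iff pairwise_insert disjnt_sym)

lemma closed_cell_cong: "tail G = tail H \<Longrightarrow> head G = head H \<Longrightarrow> closed_cell G = closed_cell H"
  by (rule ext, rename_tac c, case_tac c) auto

lemma finite_graph_cells: "fin_digraph G \<Longrightarrow> finite (graph_cells G)"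
  by (simp add: graph_cells_def fin_digraph.finite_verts fin_digraph.finite_arcs)

lemma conf_complex_Pow: "conf_complex n G \<subseteq> Pow (graph_cells G)"
  by (auto simp: conf_complex_def)

text \<open>An end point has a smaller closure than its edge, so all disjointness conditions
  persist; they also show that the end point is not yet occupied, which preserves the number of
  particles.\<close>

lemma replace_edge_conf_complex:
  assumes S: "S \<in> conf_complex n G" "Edge e \<in> S"
    and u: "Vertex u \<in> closed_cell G (Edge e)" "u \<in> verts G"
  shows "insert (Vertex u) (S - {Edge e}) \<in> conf_complex n G"
proof -
  let ?T = "S - {Edge e}"
  have "insert (Edge e) ?T \<in> conf_complex n G" using S by (simp add: insert_absorb)
  then have T: "n > 0" "?T \<in> conf_complex (n - 1) G"
    "\<And>\<tau>. \<tau> \<in> ?T \<Longrightarrow> disjnt (closed_cell G (Edge e)) (closed_cell G \<tau>)"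
    by (subst (asm) insert_conf_complex_iff; simp)+
  have "Vertex u \<notin> ?T" using T(3)[of "Vertex u"] u(1) self_in_closed_cell by (auto simp: disjnt_def)
  moreover have "disjnt (closed_cell G (Vertex u)) (closed_cell G \<tau>)" if "\<tau> \<in> ?T" for \<tau>
    using T(3)[OF that] u(1) by (auto simp: disjnt_def)
  ultimately show ?thesis
    using T(1,2) u(2) by (simp add: insert_conf_complex_iff graph_cells_def)
qed

lemma cube_complex_conf_complex:
  assumes G: "fin_digraph G"
  shows "cube_complex G (conf_complex n G)"
  unfolding cube_complex_def
proof (intro conjI ballI)
  interpret fin_digraph G by fact
  show "finite (conf_complex n G)"
    using finite_subset[OF conf_complex_Pow] finite_graph_cells[OF G] by blast
  fix S assume S: "S \<in> conf_complex n G"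
  then show "finite S" by (simp add: conf_complex_iff)
  fix e assume e: "e \<in> edges S"
  then have "e \<in> arcs G" using S by (auto simp: conf_complex_iff edges_def graph_cells_def)
  then show "face (head G) S e \<in> conf_complex n G" "face (tail G) S e \<in> conf_complex n G"
    using replace_edge_conf_complex[OF S] e by (auto simp: face_def edges_def)
qed

lemma cube_boundary_cong: "tail G = tail H \<Longrightarrow> head G = head H \<Longrightarrow> cube_boundary G = cube_boundary H"
  by (rule ext) (simp add: cube_boundary_def)

lemma qbd_cong: "tail G = tail H \<Longrightarrow> head G = head H \<Longrightarrow> qbd G = qbd H"
  unfolding qbd_def by (drule (1) cube_boundary_cong) simp

lemma cube_complex_cong: "tail G = tail H \<Longrightarrow> head G = head H \<Longrightarrow> cube_complex G X = cube_complex H X"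
  by (simp add: cube_complex_def)

lemma hrank_cong: "tail G = tail H \<Longrightarrow> head G = head H \<Longrightarrow> hrank G p X = hrank H p X"
  using qbd_cong[of G H] by (simp add: hrank_def cycles_def bd_rank_def)

lemma conf_complex_0: "conf_complex 0 G = {{}}"
  by (auto simp: conf_complex_iff)

section \<open>Deleting a vertex, and what an occupied vertex or edge leaves free\<close>

definition incident :: "('a, 'b) pre_digraph \<Rightarrow> 'a \<Rightarrow> 'b set" where
  "incident G v = {a \<in> arcs G. tail G a = v \<or> head G a = v}"

text \<open>A path of \<open>k\<close> edges from \<open>v\<close> without branching: each vertex
  passed has exactly one edge left and is then deleted. The last vertex may branch, since the
  induction on the number of particles consumes one edge per particle.\<close>

fun leg :: "nat \<Rightarrow> ('a, 'b) pre_digraph \<Rightarrow> 'a \<Rightarrow> bool" where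
  "leg 0 G v \<longleftrightarrow> v \<in> verts G"
| "leg (Suc k) G v \<longleftrightarrow> v \<in> verts G \<and> (\<exists>e w. w \<noteq> v \<and> incident G v = {e} \<and>
     {tail G e, head G e} = {v, w} \<and> leg k (tilde G v) w)"

lemma verts_tilde: "verts (tilde G v) = verts G - {v}"
  and arcs_tilde: "arcs (tilde G v) = arcs G - incident G v"
  and tail_tilde [simp]: "tail (tilde G v) = tail G"
  and head_tilde [simp]: "head (tilde G v) = head G"
  by (auto simp: pre_digraph.del_vert_def incident_def)

lemma fin_digraph_tilde: "fin_digraph G \<Longrightarrow> fin_digraph (tilde G v)"
  by (rule fin_digraph.fin_digraph_del_vert)

lemma closed_cell_tilde: "closed_cell (tilde G v) = closed_cell G"
  by (rule closed_cell_cong) simp_all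

lemma graph_cells_tilde: "graph_cells (tilde G v) = graph_cells G - insert (Vertex v) (Edge ` incident G v)"
  by (auto simp: graph_cells_def verts_tilde arcs_tilde)

lemma conf_complex_tilde:
  "conf_complex n (tilde G v) = {S \<in> conf_complex n G. S \<inter> insert (Vertex v) (Edge ` incident G v) = {}}"
  unfolding conf_complex_iff[abs_def] closed_cell_tilde graph_cells_tilde set_eq_iff by (simp add: conf_complex_def) blast

lemma closed_cell_incident: "\<sigma> \<in> graph_cells G \<Longrightarrow> Vertex v \<in> closed_cell G \<sigma> \<longleftrightarrow> \<sigma> \<in> insert (Vertex v) (Edge ` incident G v)"
  by (cases \<sigma>) (auto simp: graph_cells_def incident_def)

lemma conf_complex_tilde': "conf_complex n (tilde G v) = {S \<in> conf_complex n G. \<forall>\<sigma>\<in>S. Vertex v \<notin> closed_cell G \<sigma>}"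
  unfolding conf_complex_tilde using closed_cell_incident[of _ G v] by (auto simp: conf_complex_iff)

text \<open>A particle at \<open>v\<close> excludes exactly the cells whose closure contains
  \<open>v\<close>, so the other particles move on \<open>tilde G v\<close>. The converse is
  \<open>vertex_in_conf_complex\<close>.\<close>

lemma insert_vertex_conf_complex:
  assumes v: "v \<in> verts G" and T: "T \<in> conf_complex n (tilde G v)"
  shows "insert (Vertex v) T \<in> conf_complex (Suc n) G"
proof -
  have "\<forall>\<tau>\<in>T. Vertex v \<notin> closed_cell G \<tau>" "T \<in> conf_complex n G"
    using T by (auto simp: conf_complex_tilde')
  moreover from this have "Vertex v \<notin> T" using self_in_closed_cell by blast
  ultimately show ?thesis
    using v by (simp add: insert_conf_complex_iff graph_cells_def)
qed

lemma vertex_in_conf_complex: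
  assumes S: "S \<in> conf_complex (Suc n) G" "Vertex v \<in> S"
  shows "S - {Vertex v} \<in> conf_complex n (tilde G v)"
proof -
  have "insert (Vertex v) (S - {Vertex v}) \<in> conf_complex (Suc n) G" using S by (simp add: insert_absorb)
  then show ?thesis
    by (subst (asm) insert_conf_complex_iff) (auto simp: conf_complex_tilde' disjnt_def)
qed

text \<open>A particle on an edge blocks both end points, so the other particles move on the graph
  without them. The converse is \<open>edge_in_conf_complex\<close>.\<close>

lemma insert_edge_conf_complex:
  assumes e: "e \<in> arcs G" "closed_cell G (Edge e) = {Edge e, Vertex v, Vertex w}"
    and T: "T \<in> conf_complex n (tilde (tilde G v) w)"
  shows "insert (Edge e) T \<in> conf_complex (Suc n) G"
proof -
  have T': "\<forall>\<tau>\<in>T. Vertex v \<notin> closed_cell G \<tau> \<and> Vertex w \<notin> closed_cell G \<tau>" "T \<in> conf_complex n G"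
    using T by (auto simp: conf_complex_tilde' closed_cell_tilde)
  have eT: "Edge e \<notin> T" using T'(1) e(2) by auto
  moreover have "Edge e \<notin> closed_cell G \<tau>" if "\<tau> \<in> T" for \<tau>
    using that eT by (cases \<tau>) auto
  ultimately show ?thesis
    using T' e by (simp add: insert_conf_complex_iff graph_cells_def del: closed_cell.simps)
qed

lemma edge_in_conf_complex:
  assumes e: "closed_cell G (Edge e) = {Edge e, Vertex v, Vertex w}"
    and S: "S \<in> conf_complex (Suc n) G" "Edge e \<in> S"
  shows "S - {Edge e} \<in> conf_complex n (tilde (tilde G v) w)"
proof -
  have "insert (Edge e) (S - {Edge e}) \<in> conf_complex (Suc n) G" using S by (simp add: insert_absorb)
  then show ?thesis
    by (subst (asm) insert_conf_complex_iff)
      (auto simp: conf_complex_tilde' closed_cell_tilde disjnt_def e simp del: closed_cell.simps)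
qed

text \<open>Chains decompose uniquely as \<open>x0 + (V a + E b)\<close>: no particle at the leaf,
  one at \<open>v\<close>, or one on \<open>e\<close>. For a relative cycle, \<open>a\<close> is a
  cycle of \<open>?P\<close> relative to \<open>?Q\<close>, to which the induction hypothesis for
  the shorter leg applies.\<close>

theorem leg_rel_acyclic:
  fixes G :: "('a, 'b) pre_digraph"
  assumes "leg k G v" "fin_digraph G"
  shows "rel_acyclic G (conf_complex k G) (conf_complex k (tilde G v))"
  using assms
proof (induction k arbitrary: G v)
  case 0
  show ?case unfolding rel_acyclic_def conf_complex_0
    by (auto intro!: bexI[of _ 0] simp: qbd_simps qchains_closed(5))
next
  case (Suc k)
  then obtain e w where v: "v \<in> verts G" and w: "w \<noteq> v" and inc: "incident G v = {e}"
    and e: "{tail G e, head G e} = {v, w}" and leg: "leg k (tilde G v) w" by auto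
  let ?G' = "tilde G v" and ?G'' = "tilde (tilde G v) w"
  let ?X = "conf_complex (Suc k) G" and ?Y = "conf_complex (Suc k) ?G'"
    and ?P = "conf_complex k ?G'" and ?Q = "conf_complex k ?G''"
  have fin': "fin_digraph ?G'" by (rule fin_digraph_tilde[OF Suc.prems(2)])
  have IH: "rel_acyclic G ?P ?Q"
    using Suc.IH[OF leg fin'] qbd_cong[of ?G' G] by (simp add: rel_acyclic_def)
  have wG': "w \<in> verts ?G'" using leg by (cases k) auto
  have eG: "e \<in> arcs G" using inc by (auto simp: incident_def)
  have ce: "closed_cell G (Edge e) = {Edge e, Vertex v, Vertex w}" using e by auto
  have X: "cube_complex G ?X" by (rule cube_complex_conf_complex[OF Suc.prems(2)])
  have Y: "cube_complex G ?Y" and Pc: "cube_complex G ?P"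
    using cube_complex_conf_complex[OF fin'] cube_complex_cong[of ?G' G] by auto
  let ?L = "{Vertex v, Edge e}" and ?R = "graph_cells ?G'"
  interpret disjoint_cells ?L ?R
    by unfold_locales (use finite_graph_cells[OF fin'] inc in \<open>auto simp: graph_cells_tilde\<close>)
  define V E W :: "(('a, 'b) gcell set \<Rightarrow>\<^sub>0 rat) \<Rightarrow> _" where "V = cross (qcell {Vertex v})" and "E = cross (qcell {Edge e})"
    and "W = cross (qcell {Vertex w})"
  have lin: "qlinear V" "qlinear E" "qlinear W" by (simp_all add: V_def E_def W_def qlinear_cross_right)
  have PR: "qchains ?P \<subseteq> qchains (Pow ?R)" by (rule qchains_mono[OF conf_complex_Pow])
  have QP: "qchains ?Q \<subseteq> qchains ?P"
    by (rule qchains_mono) (auto simp: conf_complex_tilde[of _ ?G'])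
  have YX: "qchains ?Y \<subseteq> qchains ?X" by (rule qchains_mono) (auto simp: conf_complex_tilde)
  have VP: "V a \<in> qchains ?X" if "a \<in> qchains ?P" for a
    by (rule qlinear_qchains_into[OF lin(1) _ _ that])
      (auto simp: V_def cross_cell intro!: qchains_closed insert_vertex_conf_complex[OF v])
  have EQ: "E b \<in> qchains ?X" if "b \<in> qchains ?Q" for b
    by (rule qlinear_qchains_into[OF lin(2) _ _ that])
      (auto simp: E_def cross_cell intro!: qchains_closed insert_edge_conf_complex[OF eG ce])
  have WQ: "W b \<in> qchains ?Y" if "b \<in> qchains ?Q" for b
    by (rule qlinear_qchains_into[OF lin(3) _ _ that])
      (auto simp: W_def cross_cell intro!: qchains_closed insert_vertex_conf_complex[OF wG'])
  \<comment> \<open>The sign records whether \<open>e\<close> is directed towards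
    \<open>v\<close>.\<close>
  define \<sigma> :: rat where "\<sigma> = (if head G e = v then 1 else - 1)"
  have \<sigma>\<sigma>: "\<sigma> * \<sigma> = 1" by (simp add: \<sigma>_def)
  have edges: "edges {Vertex v} = {}" "edges {Edge e} = {e}" by (auto simp: edges_def)
  have dE0: "qbd G (qcell {Edge e}) = qscale \<sigma> (qcell {Vertex v}) - qscale \<sigma> (qcell {Vertex w})"
    using e w by (auto simp: qbd_cell edges esgn_eq_prod face_def \<sigma>_def doubleton_eq_iff)
  have dV: "qbd G (V a) = V (qbd G a)" if "a \<in> qchains ?P" for a
    unfolding V_def by (subst qbd_cross)
      (use that PR in \<open>auto simp: qbd_cell edges cube_dim_edges parity_cell cross_simps\<close>)
  have dE: "qbd G (E b) = qscale \<sigma> (V b) - qscale \<sigma> (W b) - E (qbd G b)" if "b \<in> qchains ?P" for b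
    unfolding E_def V_def W_def by (subst qbd_cross)
      (use that PR in \<open>auto simp: dE0 edges cube_dim_edges parity_cell cross_simps\<close>)
  have decomp: "\<exists>x0 a b. x0 \<in> qchains ?Y \<and> a \<in> qchains ?P \<and> b \<in> qchains ?Q \<and> x = x0 + (V a + E b)"
    if "x \<in> qchains ?X" for x
  proof -
    let ?U = "{x0 + z |x0 z. x0 \<in> qchains ?Y \<and> z \<in> {y + z |y z. y \<in> V ` qchains ?P \<and> z \<in> E ` qchains ?Q}}"
    have inU: "x0 + (V a + E b) \<in> ?U" if "x0 \<in> qchains ?Y" "a \<in> qchains ?P" "b \<in> qchains ?Q" for x0 a b
      using that by blast
    have V0: "V 0 = 0" and E0: "E 0 = 0" using qlinear_simps(1) lin by auto
    have "x \<in> ?U"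
    proof (rule qlinear_qchains_into[OF qlinear_ident _ _ that])
      show "qv.subspace ?U"
        by (intro qv.subspace_sums subspace_qchains subspace_qlinear_image lin)
      fix S assume S: "S \<in> ?X"
      consider "Vertex v \<in> S" | "Edge e \<in> S" | "Vertex v \<notin> S" "Edge e \<notin> S" by blast
      then show "qcell S \<in> ?U"
      proof cases
        case 1
        let ?T = "S - {Vertex v}"
        have "?T \<in> ?P" by (rule vertex_in_conf_complex[OF S 1])
        moreover have "qcell S = 0 + (V (qcell ?T) + E 0)"
          using 1 by (simp add: V_def cross_cell E0 edges shuffle_sgn_def insert_absorb)
        ultimately show ?thesis using inU[of 0 "qcell ?T" 0] by (simp add: qchains_closed(5))
      next
        case 2
        let ?T = "S - {Edge e}"
        let ?c = "shuffle_sgn {e} (edges ?T)"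
        have T: "?T \<in> ?Q" by (rule edge_in_conf_complex[OF ce S 2])
        have "qcell S = 0 + (V 0 + E (qscale ?c (qcell ?T)))"
          using 2 by (simp add: E_def cross_simps cross_cell V0 edges shuffle_sgn_sq insert_absorb)
        then show ?thesis
          using inU[of 0 0 "qscale ?c (qcell ?T)"] T by (simp add: qchains_closed)
      next
        case 3
        then have "S \<in> ?Y" using S inc by (auto simp: conf_complex_tilde)
        moreover have "qcell S = qcell S + (V 0 + E 0)" by (simp add: V0 E0)
        ultimately show ?thesis using inU[of "qcell S" 0 0] by (simp add: qchains_closed(5))
      qed
    qed
    then show ?thesis by blast
  qed
  \<comment> \<open>Cells containing \<open>Vertex v\<close> or \<open>Edge e\<close> never lie in
    \<open>?Y\<close>, so the coefficients of \<open>a\<close> and \<open>b\<close> are read off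
    there.\<close>
  have unique: "a = 0 \<and> b = 0"
    if z: "z \<in> qchains ?Y" "V a + E b \<in> qchains ?Y" and ab: "a \<in> qchains ?P" "b \<in> qchains ?P" for z a b
  proof -
    have ab': "a \<in> qchains (Pow ?R)" "b \<in> qchains (Pow ?R)" using ab PR by auto
    have lV: "Poly_Mapping.lookup (V a) ({c} \<union> T) = (if c = Vertex v then Poly_Mapping.lookup a T else 0)"
      if "T \<subseteq> ?R" "c \<in> ?L" for c T
      unfolding V_def using that w
      by (subst lookup_cross[OF _ ab'(1)]) (auto simp: lookup_single edges shuffle_sgn_def)
    have lE: "Poly_Mapping.lookup (E b) ({c} \<union> T)
        = (if c = Edge e then shuffle_sgn {e} (edges T) * Poly_Mapping.lookup b T else 0)"
      if "T \<subseteq> ?R" "c \<in> ?L" for c T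
      unfolding E_def using that
      by (subst lookup_cross[OF _ ab'(2)]) (auto simp: lookup_single edges)
    have notY: "{c} \<union> T \<notin> ?Y" if "c \<in> ?L" for c T
      using that disj by (auto simp: conf_complex_iff)
    have z0: "Poly_Mapping.lookup (V a + E b) ({c} \<union> T) = 0" if "c \<in> ?L" for c T
      using z(2) notY[OF that] unfolding qchains_iff by blast
    have "Poly_Mapping.lookup a T = 0 \<and> Poly_Mapping.lookup b T = 0" for T
    proof (cases "T \<subseteq> ?R")
      case True
      have "Poly_Mapping.lookup a T = 0"
        using z0[of "Vertex v" T] lV[OF True, of "Vertex v"] lE[OF True, of "Vertex v"] by (simp add: lookup_add)
      moreover have "shuffle_sgn {e} (edges T) * Poly_Mapping.lookup b T = 0"
        using z0[of "Edge e" T] lV[OF True, of "Edge e"] lE[OF True, of "Edge e"] by (simp add: lookup_add)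
      then have "Poly_Mapping.lookup b T = 0"
        using shuffle_sgn_sq[of "{e}" "edges T"] by auto
      ultimately show ?thesis ..
    next
      case False
      then show ?thesis using ab' unfolding qchains_iff by blast
    qed
    then show ?thesis by (simp add: poly_mapping_eqI)
  qed
  show ?case
    unfolding rel_acyclic_def
  proof (intro ballI impI)
    fix x assume x: "x \<in> qchains ?X" and dx: "qbd G x \<in> qchains ?Y"
    obtain x0 a b where x0: "x0 \<in> qchains ?Y" and a: "a \<in> qchains ?P" and b: "b \<in> qchains ?Q"
      and xeq: "x = x0 + (V a + E b)" using decomp[OF x] by blast
    have bP: "b \<in> qchains ?P" using b QP by blast
    have da: "qbd G a \<in> qchains ?P" and db: "qbd G b \<in> qchains ?P"
      using qbd_in_complex[OF Pc] a bP by auto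
    \<comment> \<open>The part of the boundary of \<open>x\<close> with a particle at
      \<open>v\<close> or on \<open>e\<close> must vanish; this links the boundary of
      \<open>a\<close> to \<open>b\<close>.\<close>
    have "V (qbd G a + qscale \<sigma> b) + E (- qbd G b) = qbd G x - (qbd G x0 - qscale \<sigma> (W b))"
      unfolding xeq by (simp add: qbd_simps dV[OF a] dE[OF bP] qlinear_simps[OF lin(1)] qlinear_simps[OF lin(2)])
    also have "\<dots> \<in> qchains ?Y"
      by (intro qchains_closed dx qbd_in_complex[OF Y x0] WQ[OF b])
    finally have "qbd G a + qscale \<sigma> b = 0 \<and> - qbd G b = 0"
      by (intro unique[OF x0]) (auto intro!: qchains_closed da db bP)
    then have da': "qbd G a = - qscale \<sigma> b" by (simp add: eq_neg_iff_add_eq_0)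
    have "qbd G a \<in> qchains ?Q" unfolding da' by (intro qchains_closed b)
    then obtain y where y: "y \<in> qchains ?P" "a - qbd G y \<in> qchains ?Q"
      using IH a by (auto simp: rel_acyclic_def)
    \<comment> \<open>Passing from \<open>a\<close> to \<open>a2\<close> clears the vertex
      \<open>w\<close>, so the particle at \<open>v\<close> can be moved along \<open>e\<close> to
      \<open>w\<close>. This motion is \<open>E a2\<close>, and its end \<open>W a2\<close> lies in
      \<open>?Y\<close>.\<close>
    define a2 where "a2 = a - qbd G y"
    let ?yy = "V y + qscale \<sigma> (E a2)"
    have a2: "a2 \<in> qchains ?Q" using y(2) by (simp add: a2_def)
    have "qbd G a2 = - qscale \<sigma> b"
      using da' qbd_qbd[OF Pc y(1)] by (simp add: a2_def qbd_simps)
    then have "qbd G (E a2) = qscale \<sigma> (V a2) - qscale \<sigma> (W a2) + qscale \<sigma> (E b)"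
      using dE[of a2] a2 QP by (auto simp: qlinear_simps[OF lin(2)])
    then have "qbd G ?yy = V (qbd G y) + (V a2 - W a2 + E b)"
      by (simp add: qbd_simps dV[OF y(1)] qv.scale_right_diff_distrib qv.scale_right_distrib \<sigma>\<sigma>)
    moreover have "V a = V (qbd G y) + V a2"
      using qlinear_simps(2)[OF lin(1), of "qbd G y" a2] by (simp add: a2_def)
    ultimately have "x - qbd G ?yy = x0 + W a2" unfolding xeq by simp
    then have "x - qbd G ?yy \<in> qchains ?Y" using x0 WQ[OF a2] by (simp add: qchains_closed(1))
    moreover have "?yy \<in> qchains ?X" by (intro qchains_closed VP EQ y a2)
    ultimately show "\<exists>y\<in>qchains ?X. x - qbd G y \<in> qchains ?Y" by blast
  qed
qed

corollary leg_hrank: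
  assumes "leg k G v" "fin_digraph G"
  shows "hrank G p (conf_complex k (tilde G v)) = hrank G p (conf_complex k G)"
proof -
  have "cube_complex G (conf_complex k (tilde G v))"
    using cube_complex_conf_complex[OF fin_digraph_tilde[OF assms(2), of v]] cube_complex_cong[of "tilde G v" G] by simp
  moreover have "conf_complex k (tilde G v) \<subseteq> conf_complex k G" by (auto simp: conf_complex_tilde)
  ultimately show ?thesis
    using rel_acyclic_hrank[OF cube_complex_conf_complex[OF assms(2)] _ _ leg_rel_acyclic[OF assms]] by simp
qed

section \<open>Legs of sufficiently subdivided graphs\<close>

lemma leg_mono: "leg n G v \<Longrightarrow> k \<le> n \<Longrightarrow> leg k G v"
proof (induction k arbitrary: n G v)
  case 0
  then show ?case by (cases n) auto
next
  case (Suc k)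
  then obtain n' where n': "n = Suc n'" by (cases n) auto
  show ?case using Suc.prems Suc.IH[of n'] unfolding n' leg.simps by blast
qed

text \<open>A leg of \<open>k\<close> edges has \<open>k + 1\<close> distinct vertices. This
  guarantees room for \<open>k\<close> particles, hence a nonempty configuration space.\<close>

lemma leg_card_verts: "leg k G v \<Longrightarrow> fin_digraph G \<Longrightarrow> k < card (verts G)"
proof (induction k arbitrary: G v)
  case 0
  then show ?case by (auto simp: card_gt_0_iff fin_digraph.finite_verts)
next
  case (Suc k)
  then obtain w where "v \<in> verts G" "leg k (tilde G v) w" by auto
  moreover from this have "k < card (verts (tilde G v))"
    using Suc.IH[of "tilde G v"] fin_digraph_tilde[OF Suc.prems(2)] by blast
  ultimately show ?case by (simp add: verts_tilde)
qed

lemma valence_tilde: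
  assumes "fin_digraph G" "z \<noteq> v" "\<And>a. a \<in> incident G v \<Longrightarrow> tail G a \<noteq> z \<and> head G a \<noteq> z"
  shows "valence (tilde G v) z = valence G z"
proof -
  have "in_arcs (tilde G v) z = in_arcs G z" "out_arcs (tilde G v) z = out_arcs G z"
    using assms(3) by (auto simp: in_arcs_def out_arcs_def arcs_tilde)
  then show ?thesis by (simp add: valence_def in_degree_def out_degree_def)
qed

lemma valence_tilde_neighbour:
  assumes G: "fin_digraph G" and w: "w \<noteq> v" "incident G v = {e}" "{tail G e, head G e} = {v, w}"
  shows "valence G w = Suc (valence (tilde G v) w)"
proof -
  interpret fin_digraph G by fact
  have e: "e \<in> arcs G" using w(2) by (auto simp: incident_def)
  consider "head G e = w" "tail G e = v" | "head G e = v" "tail G e = w"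
    using w(3) by (auto simp: doubleton_eq_iff)
  then show ?thesis
  proof cases
    case 1
    have "in_arcs G w = insert e (in_arcs (tilde G v) w)" "e \<notin> in_arcs (tilde G v) w"
      "out_arcs G w = out_arcs (tilde G v) w"
      using 1 e w by (auto simp: in_arcs_def out_arcs_def arcs_tilde)
    moreover have "finite (in_arcs (tilde G v) w)"
      using fin_digraph.finite_in_arcs[OF fin_digraph_tilde[OF G]] .
    ultimately show ?thesis by (simp add: valence_def in_degree_def out_degree_def)
  next
    case 2
    have "out_arcs G w = insert e (out_arcs (tilde G v) w)" "e \<notin> out_arcs (tilde G v) w"
      "in_arcs G w = in_arcs (tilde G v) w"
      using 2 e w by (auto simp: in_arcs_def out_arcs_def arcs_tilde)
    moreover have "finite (out_arcs (tilde G v) w)"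
      using fin_digraph.finite_out_arcs[OF fin_digraph_tilde[OF G]] .
    ultimately show ?thesis by (simp add: valence_def in_degree_def out_degree_def)
  qed
qed

lemma valence_1_incident:
  assumes G: "fin_digraph G" and v: "valence G v = 1"
  obtains e w where "w \<noteq> v" "incident G v = {e}" "{tail G e, head G e} = {v, w}" "w \<in> verts G" "v \<in> verts G" "e \<in> arcs G"
proof -
  interpret fin_digraph G by fact
  have fin: "finite (in_arcs G v)" "finite (out_arcs G v)" by auto
  have inc: "incident G v = in_arcs G v \<union> out_arcs G v" by (auto simp: incident_def)
  have "card (in_arcs G v) + card (out_arcs G v) = 1"
    using v by (simp add: valence_def in_degree_def out_degree_def)
  then consider "card (in_arcs G v) = 1" "out_arcs G v = {}" | "in_arcs G v = {}" "card (out_arcs G v) = 1"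
    using fin by (metis add_cancel_right_right add_is_1 card_0_eq One_nat_def)
  then show ?thesis
  proof cases
    case 1
    then obtain e where e: "in_arcs G v = {e}" by (auto simp: card_1_singleton_iff)
    then have "e \<in> arcs G" "head G e = v" by (auto simp: in_arcs_def)
    moreover from this have "tail G e \<noteq> v" using 1(2) by auto
    ultimately show ?thesis using that[of "tail G e" e] inc e 1(2) by (auto simp: insert_commute)
  next
    case 2
    then obtain e where e: "out_arcs G v = {e}" by (auto simp: card_1_singleton_iff)
    then have "e \<in> arcs G" "tail G e = v" by (auto simp: out_arcs_def)
    moreover from this have "head G e \<noteq> v" using 2(1) by auto
    ultimately show ?thesis using that[of "head G e" e] inc e 2(1) by auto
  qed
qed

lemma edge_path_tilde:
  assumes "edge_path (tilde G v) u p w"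
  shows "edge_path G u p w"
proof -
  have "tail (both_ways (tilde G v)) = tail (both_ways G)" "head (both_ways (tilde G v)) = head (both_ways G)"
    by (auto simp: both_ways_def fun_eq_iff)
  then have "pre_digraph.cas (both_ways (tilde G v)) u p w \<longleftrightarrow> pre_digraph.cas (both_ways G) u p w" for u
    by (induction p arbitrary: u) (simp_all add: pre_digraph.cas.simps)
  then show ?thesis
    using assms by (auto simp: edge_path_def pre_digraph.awalk_def both_ways_def verts_tilde arcs_tilde)
qed

lemma edge_path_Cons:
  assumes "fin_digraph G" "e \<in> arcs G" "{tail G e, head G e} = {u, w}" "edge_path G w p z"
  shows "\<exists>b. edge_path G u ((e, b) # p) z"
proof -
  interpret fin_digraph G by fact
  show ?thesis
  proof (cases "tail G e = u")
    case True
    then have "head G e = w" using assms(3) by (auto simp: doubleton_eq_iff)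
    then have "edge_path G u ((e, True) # p) z"
      using True assms(2,4)
      by (auto simp: edge_path_def pre_digraph.awalk_def both_ways_def pre_digraph.cas.simps)
    then show ?thesis ..
  next
    case False
    then have "head G e = u" "tail G e = w" using assms(3) by (auto simp: doubleton_eq_iff)
    then have "edge_path G u ((e, False) # p) z"
      using assms(2,4)
      by (auto simp: edge_path_def pre_digraph.awalk_def both_ways_def pre_digraph.cas.simps)
    then show ?thesis ..
  qed
qed

lemma edge_path_Nil: "u \<in> verts G \<Longrightarrow> edge_path G u [] u"
  by (simp add: edge_path_def pre_digraph.awalk_def both_ways_def pre_digraph.cas.simps)

lemma edge_path_in_verts:
  assumes "fin_digraph G" "edge_path G u p z"
  shows "z \<in> verts G"
  using assms(2)
proof (induction p arbitrary: u)
  case Nil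
  then show ?case by (auto simp: edge_path_def pre_digraph.awalk_def both_ways_def pre_digraph.cas.simps)
next
  case (Cons eb p)
  interpret fin_digraph G by fact
  obtain e b where eb: "eb = (e, b)" by fastforce
  have "edge_path G (if b then head G e else tail G e) p z"
    using Cons.prems unfolding eb
    by (auto simp: edge_path_def pre_digraph.awalk_def both_ways_def pre_digraph.cas.simps split: if_splits)
  then show ?case by (rule Cons.IH)
qed

text \<open>Vertices met in fewer than \<open>m\<close> steps have valence 2. Deleting the start
  therefore leaves its neighbour with valence 1, and the argument repeats with paths shorter by one
  edge.\<close>

lemma leg_if_long_paths:
  assumes "fin_digraph K" "valence K x = 1"
    "\<And>y p. edge_path K x p y \<Longrightarrow> y \<noteq> x \<Longrightarrow> valence K y \<noteq> 2 \<Longrightarrow> m \<le> length p"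
  shows "leg m K x"
  using assms
proof (induction m arbitrary: K x)
  case 0
  then show ?case using valence_1_incident[of K x] by (metis leg.simps(1))
next
  case (Suc m)
  obtain e y where y: "y \<noteq> x" and inc: "incident K x = {e}" and e: "{tail K e, head K e} = {x, y}"
    and verts: "y \<in> verts K" "x \<in> verts K" and eK: "e \<in> arcs K"
    using valence_1_incident[OF Suc.prems(1,2)] by metis
  let ?K = "tilde K x"
  have "leg m ?K y"
  proof (cases m)
    case 0
    then show ?thesis using verts y by (simp add: verts_tilde)
  next
    case (Suc m')
    obtain b where b: "edge_path K x [(e, b)] y"
      using edge_path_Cons[OF Suc.prems(1) eK e edge_path_Nil[OF verts(1)]] by blast
    have "valence K y = 2"
    proof (rule ccontr)
      assume "valence K y \<noteq> 2"
      from Suc.prems(3)[OF b y this] show False using \<open>m = Suc m'\<close> by simp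
    qed
    then have val: "valence ?K y = 1"
      using valence_tilde_neighbour[OF Suc.prems(1) y inc e] by simp
    show ?thesis
    proof (rule Suc.IH[OF fin_digraph_tilde[OF Suc.prems(1)] val])
      fix z p assume z: "edge_path ?K y p z" "z \<noteq> y" "valence ?K z \<noteq> 2"
      have "z \<in> verts ?K" by (rule edge_path_in_verts[OF fin_digraph_tilde[OF Suc.prems(1)] z(1)])
      then have zx: "z \<noteq> x" by (simp add: verts_tilde)
      \<comment> \<open>Deleting \<open>x\<close> affects the valence of its neighbour
        \<open>y\<close> alone, and \<open>z\<close> differs from \<open>y\<close>.\<close>
      have "valence K z \<noteq> 2"
        using valence_tilde[OF Suc.prems(1) zx] z(2,3) inc e zx by auto
      moreover obtain b where "edge_path K x ((e, b) # p) z"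
        using edge_path_Cons[OF Suc.prems(1) eK e edge_path_tilde[OF z(1)]] by blast
      ultimately show "m \<le> length p" using Suc.prems(3)[of "(e, b) # p" z] zx by simp
    qed
  qed
  then show ?case using verts y inc e by auto
qed

text \<open>The edge from \<open>v\<close> to the inserted vertex \<open>w\<close> is the first of
  the leg. In \<open>tilde G v\<close> the vertex \<open>w\<close> has valence 1, so the subdivision
  of that graph supplies the other \<open>n - 1\<close> edges.\<close>

lemma leg_if_sufficiently_subdivided:
  assumes G: "fin_digraph G" and v: "valence G v = 1" and ex: "extra_subdivided_at G v"
    and sub: "sufficiently_subdivided n (tilde G v)" and n: "n \<ge> 1"
  shows "leg n G v"
proof -
  obtain m where m: "n = Suc m" using n by (cases n) auto
  obtain e w where w: "w \<noteq> v" "incident G v = {e}" "{tail G e, head G e} = {v, w}"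
    "w \<in> verts G" "v \<in> verts G" "e \<in> arcs G"
    using valence_1_incident[OF G v] by metis
  have "valence G w = 2" using ex w(3,6) by (auto simp: extra_subdivided_at_def)
  then have val: "valence (tilde G v) w = 1" using valence_tilde_neighbour[OF G w(1-3)] by simp
  have "leg m (tilde G v) w"
    by (rule leg_if_long_paths[OF fin_digraph_tilde[OF G] val])
      (use sub val m in \<open>force simp: sufficiently_subdivided_def\<close>)
  then show ?thesis using w m by auto
qed

section \<open>Connectedness of configuration spaces\<close>

definition adj :: "('a, 'b) pre_digraph \<Rightarrow> ('a \<times> 'a) set" where
  "adj G = {(u, w). \<exists>e\<in>arcs G. {tail G e, head G e} = {u, w}}"

lemma connected_adj:
  assumes "Digraph_Component.connected G" "u \<in> verts G" "w \<in> verts G"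
  shows "(u, w) \<in> (adj G)\<^sup>*"
proof -
  have "(u, w) \<in> rtrancl_on (verts (with_proj (mk_symmetric G))) (arcs_ends (with_proj (mk_symmetric G)))"
    using assms by (auto simp: connected_def strongly_connected_def reachable_def)
  then have "(u, w) \<in> (arcs_ends (with_proj (mk_symmetric G)))\<^sup>*"
    by (rule rtrancl_on_rtranclI)
  moreover have "arcs_ends (with_proj (mk_symmetric G)) \<subseteq> adj G"
    by (auto simp: arcs_ends_def arc_to_ends_def parcs_mk_symmetric adj_def)
  ultimately show ?thesis using rtrancl_mono by blast
qed

text \<open>Connectedness in the linear form of homologous 0-cells, as needed for homology in degree
  0; chains of moves compose by adding boundaries.\<close>

definition same_component :: "('a, 'b) pre_digraph \<Rightarrow> nat \<Rightarrow> 'a set \<Rightarrow> 'a set \<Rightarrow> bool" where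
  "same_component G k U U' \<longleftrightarrow>
    qcell (Vertex ` U) - qcell (Vertex ` U') \<in> qbd G ` qchains (cells 1 (conf_complex k G))"

lemma same_component_refl: "same_component G k U U"
  using qv.subspace_0[OF subspace_boundaries] by (simp add: same_component_def)

lemma same_component_trans:
  "same_component G k U U' \<Longrightarrow> same_component G k U' U'' \<Longrightarrow> same_component G k U U''"
  unfolding same_component_def
  by (drule (1) qv.subspace_add[OF subspace_boundaries]) (simp only: add_diff_eq diff_add_cancel)

lemma card_exchange: "finite U \<Longrightarrow> u \<in> U \<Longrightarrow> w \<notin> U \<Longrightarrow> card (insert w (U - {u})) = card U"
  using card_Suc_Diff1[of U u] by simp

text \<open>The motion is the 1-cell with one particle on the edge and the others at rest on
  \<open>U - {u}\<close>; as \<open>w\<close> is not in \<open>U\<close>, the closed edge avoids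
  them.\<close>

lemma same_component_move:
  assumes G: "fin_digraph G" and U: "U \<subseteq> verts G" "card U = k" and uw: "(u, w) \<in> adj G" "u \<in> U" "w \<notin> U"
  shows "same_component G k U (insert w (U - {u}))"
proof -
  interpret fin_digraph G by fact
  obtain e where e: "e \<in> arcs G" "{tail G e, head G e} = {u, w}" using uw(1) by (auto simp: adj_def)
  have finU: "finite U" using U(1) finite_subset finite_verts by blast
  let ?T = "Vertex ` (U - {u}) :: ('a, 'b) gcell set" and ?S = "insert (Edge e) (Vertex ` (U - {u}))"
  have T: "?T \<in> conf_complex (k - 1) G"
    using U uw(2) finU by (auto simp: conf_complex_iff graph_cells_def card_image inj_on_def pairwise_def)
  have "k > 0" using U(2) uw(2) finU by (auto simp: card_gt_0_iff)
  moreover have "tail G e \<notin> U - {u}" "head G e \<notin> U - {u}" using e(2) uw(3) by (auto simp: doubleton_eq_iff)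
  ultimately have "?S \<in> conf_complex k G"
    using T e(1) by (subst insert_conf_complex_iff) (auto simp: graph_cells_def)
  moreover have edges: "edges ?S = {e}" by (auto simp: edges_def)
  ultimately have S: "qcell ?S \<in> qchains (cells 1 (conf_complex k G))"
    by (simp add: cells_def cube_dim_edges)
  have Se: "?S - {Edge e} = ?T" by auto
  have U': "Vertex ` U = insert (Vertex u) ?T" using uw(2) by auto
  have "qbd G (qcell ?S) = qcell (insert (Vertex (head G e)) ?T) - qcell (insert (Vertex (tail G e)) ?T)"
    unfolding qbd_cell edges by (simp add: esgn_eq_prod face_def Se)
  then have "qcell (Vertex ` U) - qcell (Vertex ` insert w (U - {u})) =
      qbd G (if head G e = u then qcell ?S else - qcell ?S)"
    using e(2) unfolding U' by (auto simp: doubleton_eq_iff qbd_simps)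
  moreover have "(if head G e = u then qcell ?S else - qcell ?S) \<in> qchains (cells 1 (conf_complex k G))"
    using S by (simp add: qchains_closed(3))
  ultimately show ?thesis unfolding same_component_def by blast
qed

text \<open>A particle blocked by another one hands over its journey to the blocking particle and then takes its place.\<close>

lemma same_component_walk:
  assumes G: "fin_digraph G" and walk: "(u, w) \<in> (adj G)\<^sup>*"
  shows "U \<subseteq> verts G \<Longrightarrow> card U = k \<Longrightarrow> u \<in> U \<Longrightarrow> w \<notin> U \<Longrightarrow> same_component G k U (insert w (U - {u}))"
  using walk
proof (induction arbitrary: U rule: converse_rtrancl_induct)
  case base
  then show ?case by simp
next
  case (step u u')
  interpret fin_digraph G by fact
  have finU: "finite U" using step.prems(1) finite_subset finite_verts by blast
  have adjv: "x \<in> verts G" "y \<in> verts G" if "(x, y) \<in> adj G" for x y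
    using that by (auto simp: adj_def doubleton_eq_iff)
  have wv: "w \<in> verts G"
    using step.hyps adjv by (metis rtranclE)
  show ?case
  proof (cases "u' \<in> U")
    case False
    let ?U = "insert u' (U - {u})"
    have move: "same_component G k U ?U"
      by (rule same_component_move[OF G step.prems(1,2) step.hyps(1) step.prems(3) False])
    show ?thesis
    proof (cases "u' = w")
      case True
      then show ?thesis using move by simp
    next
      case neq: False
      have "?U \<subseteq> verts G" using step.prems(1) adjv[OF step.hyps(1)] by auto
      moreover have "card ?U = k"
        using card_exchange[OF finU step.prems(3) False] step.prems(2) by simp
      ultimately have "same_component G k ?U (insert w (?U - {u'}))"
        using step.IH[of ?U] step.prems(4) neq by auto
      moreover have "?U - {u'} = U - {u}" using False by auto
      ultimately show ?thesis using same_component_trans[OF move] by simp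
    qed
  next
    case True
    show ?thesis
    \<comment> \<open>Loops of the graph put pairs \<open>(u, u)\<close> into \<open>adj\<close>;
      such a step moves nothing.\<close>
    proof (cases "u' = u")
      case True
      then show ?thesis using step.IH[OF step.prems(1,2) _ step.prems(4)] step.prems(3) by simp
    next
      case neq: False
      let ?U = "insert w (U - {u'})"
      have s1: "same_component G k U ?U"
        by (rule step.IH[OF step.prems(1,2) True step.prems(4)])
      have U2: "?U \<subseteq> verts G" "u \<in> ?U" "u' \<notin> ?U" using step.prems wv True neq by auto
      have "card ?U = k"
        using card_exchange[OF finU True step.prems(4)] step.prems(2) by simp
      then have "same_component G k ?U (insert u' (?U - {u}))"
        by (rule same_component_move[OF G U2(1) _ step.hyps(1) U2(2,3)])
      moreover have "insert u' (?U - {u}) = insert w (U - {u})"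
        using True neq step.prems(3,4) by auto
      ultimately show ?thesis using same_component_trans[OF s1] by simp
    qed
  qed
qed

text \<open>Induction on the number of particles outside \<open>U'\<close>: one of them is sent
  along a path of the connected graph to a free place of \<open>U'\<close>.\<close>

lemma same_component_connected:
  assumes G: "fin_digraph G" "Digraph_Component.connected G"
  shows "U \<subseteq> verts G \<Longrightarrow> card U = k \<Longrightarrow> U' \<subseteq> verts G \<Longrightarrow> card U' = k \<Longrightarrow> same_component G k U U'"
proof (induction "card (U - U')" arbitrary: U)
  case 0
  have fin: "finite U" "finite U'"
    using "0.prems" finite_subset fin_digraph.finite_verts[OF G(1)] by blast+
  then have "U \<subseteq> U'" using "0.hyps" by simp
  then have "U = U'" using fin "0.prems" by (simp add: card_subset_eq)
  then show ?case by (simp add: same_component_refl)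
next
  case (Suc m)
  have fin: "finite U" "finite U'"
    using Suc.prems finite_subset fin_digraph.finite_verts[OF G(1)] by blast+
  obtain u where u: "u \<in> U" "u \<notin> U'" using Suc.hyps(2) by (metis Diff_iff all_not_in_conv card.empty nat.distinct(1))
  obtain w where w: "w \<in> U'" "w \<notin> U"
    using u fin Suc.prems by (metis card_subset_eq subsetI)
  let ?U = "insert w (U - {u})"
  have "same_component G k U ?U"
    by (rule same_component_walk[OF G(1) _ Suc.prems(1,2) u(1) w(2)])
      (use connected_adj[OF G(2)] u w Suc.prems in auto)
  moreover have "same_component G k ?U U'"
  proof (rule Suc.hyps(1))
    have "?U - U' = (U - U') - {u}" using w by auto
    then show "m = card (?U - U')" using Suc.hyps(2) u fin by simp
    show "card ?U = k"
      using card_exchange[OF fin(1) u(1) w(2)] Suc.prems(2) by simp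
  qed (use Suc.prems w in auto)
  ultimately show ?case by (rule same_component_trans)
qed

lemma q_dim_qchains_singleton: "qv.dim (qchains {S}) = 1"
  by (simp add: dim_qchains)

text \<open>The 0-chains are the direct sum of the multiples of one configuration and the
  boundaries: all configurations are homologous, and the augmentation kills boundaries but not that
  configuration. The bound on \<open>k\<close> makes a configuration exist.\<close>

theorem hrank_0_conf_complex:
  fixes G :: "('a, 'b) pre_digraph"
  assumes G: "fin_digraph G" "Digraph_Component.connected G" and k: "k \<le> card (verts G)"
  shows "hrank G 0 (conf_complex k G) = 1"
proof -
  let ?X = "conf_complex k G"
  let ?C = "\<lambda>p. qchains (cells p ?X)"
  let ?B = "qbd G ` ?C (Suc 0)"
  have X: "cube_complex G ?X" by (rule cube_complex_conf_complex[OF G(1)])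
  have finV: "finite (verts G)" using G(1) by (simp add: fin_digraph.finite_verts)
  obtain U0 where U0: "U0 \<subseteq> verts G" "card U0 = k" using k obtain_subset_with_card_n by metis
  let ?S0 = "Vertex ` U0 :: ('a, 'b) gcell set"
  have vert: "\<exists>U. S = Vertex ` U \<and> U \<subseteq> verts G \<and> card U = k" if S: "S \<in> cells 0 ?X" for S
  proof -
    have "finite S" "S \<subseteq> graph_cells G" "card S = k" "edges S = {}"
      using S finite_edges[of S] by (auto simp: cells_def conf_complex_iff cube_dim_edges)
    then have "S = Vertex ` {u. Vertex u \<in> S}" "{u. Vertex u \<in> S} \<subseteq> verts G"
      by (auto simp: graph_cells_def edges_def)
    moreover from this(1) have "card {u. Vertex u \<in> S} = k"
      using \<open>card S = k\<close> by (metis (no_types, lifting) card_image gcell.inject(1) inj_onI)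
    ultimately show ?thesis by blast
  qed
  have S0: "?S0 \<in> cells 0 ?X"
  proof -
    have "finite U0" using U0(1) finV finite_subset by blast
    moreover have "edges ?S0 = {}" by (auto simp: edges_def)
    ultimately show ?thesis
      using U0 by (auto simp: cells_def conf_complex_iff graph_cells_def card_image inj_on_def pairwise_def cube_dim_edges)
  qed
  have cyc: "cycles G 0 ?X = ?C 0" using qbd_cells_0[OF X] by (auto simp: cycles_def)
  have BC: "?B \<subseteq> ?C 0" using qbd_in_cells[OF X, of _ 0] by auto
  have SC: "qchains {?S0} \<subseteq> ?C 0" by (rule qchains_mono) (use S0 in simp)
  have "?C 0 = {x + y |x y. x \<in> qchains {?S0} \<and> y \<in> ?B}" (is "_ = ?R")
  proof
    show "?C 0 \<subseteq> ?R"
    proof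
      fix x assume x: "x \<in> ?C 0"
      show "x \<in> ?R"
      proof (rule qlinear_qchains_into[OF qlinear_ident _ _ x])
        show "qv.subspace ?R" by (intro qv.subspace_sums subspace_qchains subspace_boundaries)
        fix S assume "S \<in> cells 0 ?X"
        then obtain U where U: "S = Vertex ` U" "U \<subseteq> verts G" "card U = k" using vert by blast
        have "qcell S - qcell ?S0 \<in> ?B"
          using same_component_connected[OF G U(2,3) U0] U(1) by (simp add: same_component_def)
        moreover have "qcell S = qcell ?S0 + (qcell S - qcell ?S0)" by simp
        ultimately show "qcell S \<in> ?R" using qcell_in_qchains[of ?S0 "{?S0}"] by blast
      qed
    qed
    show "?R \<subseteq> ?C 0" using SC BC qchains_closed(1) by blast
  qed
  moreover have "qchains {?S0} \<inter> ?B = {0}"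
  proof
    show "qchains {?S0} \<inter> ?B \<subseteq> {0}"
    proof
      fix x assume "x \<in> qchains {?S0} \<inter> ?B"
      then obtain y where x: "x \<in> qchains {?S0}" and y: "x = qbd G y" "y \<in> ?C (Suc 0)" by blast
      \<comment> \<open>The augmentation, with the cell \<open>{}\<close> standing for the scalar 1
        so that its values are chains.\<close>
      define aug where "aug = qext (\<lambda>S. qcell ({} :: ('a, 'b) gcell set))"
      have lin: "qlinear aug" unfolding aug_def by (rule qlinear_qext)
      have "aug (qbd G y) \<in> {0}"
        by (rule qlinear_qchains_into[OF qlinear_compose[OF lin qlinear_qbd] _ _ y(2)])
          (auto simp: qbd_cell qlinear_simps[OF lin], simp add: aug_def)
      moreover have "x = qscale (Poly_Mapping.lookup x ?S0) (qcell ?S0)"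
        using x by (intro poly_mapping_eqI) (auto simp: qchains_iff lookup_single when_def)
      then have "aug x = qscale (Poly_Mapping.lookup x ?S0) (qcell {})"
        by (metis aug_def qext_cell qext_simps(5))
      moreover have "qcell ({} :: ('a, 'b) gcell set) \<noteq> 0"
        by (metis lookup_single_eq lookup_zero zero_neq_one)
      ultimately have "Poly_Mapping.lookup x ?S0 = 0"
        using y(1) by simp
      then show "x \<in> {0}"
        using \<open>x = qscale (Poly_Mapping.lookup x ?S0) (qcell ?S0)\<close> by simp
    qed
    show "{0} \<subseteq> qchains {?S0} \<inter> ?B"
      using qv.subspace_0[OF subspace_boundaries] by (simp add: qchains_closed(5))
  qed
  moreover have "finite (cells 0 ?X)" using X by (simp add: cube_complex_def finite_cells)
  ultimately show ?thesis
    using q_dim_sum_Int[OF subspace_qchains subspace_boundaries SC BC] q_dim_qchains_singleton[of ?S0]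
    by (simp add: hrank_def bd_rank_def cyc)
qed

section \<open>The decomposition for a wedge\<close>

text \<open>Needed for a particle resting at \<open>v\<close> and for the complex of no particles,
  whose only cell is \<open>{}\<close>.\<close>

lemma hrank_singleton:
  fixes G :: "('a, 'b) pre_digraph"
  assumes "edges S = {}"
  shows "hrank G p {S} = (if p = 0 then 1 else 0)"
proof -
  have cells: "cells p {S} = (if p = 0 then {S} else {})" for p
    using assms by (auto simp: cells_def cube_dim_edges)
  have "bd_rank G p {S} = 0" for p
  proof -
    have "qbd G x \<in> {0}" if "x \<in> qchains (cells p {S})" for x
      by (rule qlinear_qchains_into[OF qlinear_qbd _ _ that]) (use assms in \<open>auto simp: qbd_cell cells_def\<close>)
    then have "qbd G ` qchains (cells p {S}) = {0}"
      using qv.subspace_0[OF subspace_boundaries[of G "cells p {S}"]] by blast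
    then show ?thesis by (simp add: bd_rank_def)
  qed
  then show ?thesis by (simp add: hrank_eq cells)
qed

text \<open>The closure of a cell stays in its subgraph, so cells of disjoint subgraphs never
  collide. Overall disjointness together with the two particle counts therefore characterises the
  product.\<close>

lemma conf_prod_conf_complex:
  assumes H: "wf_digraph H1" "wf_digraph H2" "closed_cell H1 = closed_cell G" "closed_cell H2 = closed_cell G"
    and disj: "graph_cells H1 \<inter> graph_cells H2 = {}"
  shows "conf_prod (conf_complex i H1) (conf_complex j H2) =
    {S. S \<subseteq> graph_cells H1 \<union> graph_cells H2 \<and> finite S \<and> card (S \<inter> graph_cells H1) = i \<and>
      card (S \<inter> graph_cells H2) = j \<and> pairwise (\<lambda>\<sigma> \<tau>. disjnt (closed_cell G \<sigma>) (closed_cell G \<tau>)) S}"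
    (is "?L = ?R")
proof
  have cl: "closed_cell G \<sigma> \<subseteq> graph_cells H" if "wf_digraph H" "closed_cell H = closed_cell G" "\<sigma> \<in> graph_cells H"
    for H \<sigma>
  proof -
    interpret wf_digraph H by fact
    show ?thesis unfolding that(2)[symmetric] using that(3) by (cases \<sigma>) (auto simp: graph_cells_def)
  qed
  show "?L \<subseteq> ?R"
  proof
    fix U assume "U \<in> ?L"
    then obtain S T where ST: "S \<in> conf_complex i H1" "T \<in> conf_complex j H2" "U = S \<union> T"
      by (auto simp: conf_prod_def)
    have S: "S \<subseteq> graph_cells H1" "finite S" "card S = i" and T: "T \<subseteq> graph_cells H2" "finite T" "card T = j"
      using ST by (auto simp: conf_complex_iff)
    then have "U \<inter> graph_cells H1 = S" "U \<inter> graph_cells H2 = T" using disj ST(3) by auto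
    moreover have "disjnt (closed_cell G \<sigma>) (closed_cell G \<tau>)" if "\<sigma> \<in> S" "\<tau> \<in> T" for \<sigma> \<tau>
    proof -
      have "closed_cell G \<sigma> \<subseteq> graph_cells H1" "closed_cell G \<tau> \<subseteq> graph_cells H2"
        using cl[OF H(1,3)] cl[OF H(2,4)] that S(1) T(1) by blast+
      then show ?thesis using disj unfolding disjnt_def by blast
    qed
    then have "pairwise (\<lambda>\<sigma> \<tau>. disjnt (closed_cell G \<sigma>) (closed_cell G \<tau>)) U"
      using ST H(3,4) by (auto simp: conf_complex_iff pairwise_def disjnt_sym)
    ultimately show "U \<in> ?R" using S T ST(3) by auto
  qed
  show "?R \<subseteq> ?L"
  proof
    fix U assume U: "U \<in> ?R"
    then have "U = (U \<inter> graph_cells H1) \<union> (U \<inter> graph_cells H2)" by auto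
    moreover have "U \<inter> graph_cells H1 \<in> conf_complex i H1" "U \<inter> graph_cells H2 \<in> conf_complex j H2"
      using U H(3,4) by (auto simp: conf_complex_iff pairwise_def)
    ultimately show "U \<in> ?L" unfolding conf_prod_def by blast
  qed
qed

text \<open>The subdivision hypotheses enter in the form \<open>leg n\<close>: it lets the tilde
  graphs replace the graphs in Betti numbers and provides enough vertices for all particles.\<close>

locale wedge =
  fixes G G1 G2 :: "('a, 'b) pre_digraph" and v :: 'a and n :: nat and e1 e2 :: 'b
  assumes n: "n \<ge> 1"
    and graph: "fin_digraph G"
    and subgraphs: "subgraph G1 G" "subgraph G2 G"
    and union: "verts G1 \<union> verts G2 = verts G" "arcs G1 \<union> arcs G2 = arcs G"
    and inter: "verts G1 \<inter> verts G2 = {v}" "arcs G1 \<inter> arcs G2 = {}"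
    and connected: "Digraph_Component.connected G1" "Digraph_Component.connected G2"
    and inc: "incident G1 v = {e1}" "incident G2 v = {e2}"
    and leg: "leg n G1 v" "leg n G2 v"
begin

lemma tail_head [simp]: "tail G1 = tail G" "tail G2 = tail G" "head G1 = head G" "head G2 = head G"
  using subgraphs by (auto simp: subgraph_def compatible_def)

lemma fin_G12: "fin_digraph G1" "fin_digraph G2"
proof -
  have "finite (verts G)" "finite (arcs G)" using graph by (simp_all add: fin_digraph.finite_verts fin_digraph.finite_arcs)
  then have "finite (verts G1)" "finite (arcs G1)" "finite (verts G2)" "finite (arcs G2)"
    using union by (metis finite_Un)+
  moreover have "wf_digraph G1" "wf_digraph G2" using subgraphs by (auto simp: subgraph_def)
  ultimately show "fin_digraph G1" "fin_digraph G2" using wf_digraph.fin_digraphI by blast+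
qed

abbreviation "T1 \<equiv> tilde G1 v"
abbreviation "T2 \<equiv> tilde G2 v"

lemma fin_T12: "fin_digraph T1" "fin_digraph T2"
  by (simp_all add: fin_G12 fin_digraph_tilde)

abbreviation "L \<equiv> graph_cells T1"
abbreviation "R \<equiv> graph_cells T2"

lemma closed_cells [simp]:
  "closed_cell G1 = closed_cell G" "closed_cell G2 = closed_cell G"
  "closed_cell T1 = closed_cell G" "closed_cell T2 = closed_cell G"
  by (rule closed_cell_cong; simp)+

lemma cells_G1: "graph_cells G1 = {Vertex v, Edge e1} \<union> L"
  and cells_G2: "graph_cells G2 = {Vertex v, Edge e2} \<union> R"
  and cells_G: "graph_cells G = {Vertex v, Edge e1, Edge e2} \<union> L \<union> R"
  and cells_disj: "L \<inter> R = {}" "e1 \<noteq> e2" "Vertex v \<notin> L \<union> R" "Edge e1 \<notin> L \<union> R" "Edge e2 \<notin> L \<union> R"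
proof -
  have e: "e1 \<in> arcs G1" "e2 \<in> arcs G2" "v \<in> verts G1" "v \<in> verts G2"
    using inc inter(1) by (auto simp: incident_def)
  have cells: "graph_cells G = graph_cells G1 \<union> graph_cells G2" "graph_cells G1 \<inter> graph_cells G2 = {Vertex v}"
    using union inter by (auto simp: graph_cells_def)
  have in1: "Vertex v \<in> graph_cells G1" "Edge e1 \<in> graph_cells G1" and in2: "Vertex v \<in> graph_cells G2" "Edge e2 \<in> graph_cells G2"
    using e by (auto simp: graph_cells_def)
  have L: "L = graph_cells G1 - {Vertex v, Edge e1}" and R: "R = graph_cells G2 - {Vertex v, Edge e2}"
    using inc by (auto simp: graph_cells_tilde)
  have ne: "Edge e1 \<notin> graph_cells G2" "Edge e2 \<notin> graph_cells G1" using cells(2) in1 in2 by auto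
  show "graph_cells G1 = {Vertex v, Edge e1} \<union> L" using L in1 by auto
  show "graph_cells G2 = {Vertex v, Edge e2} \<union> R" using R in2 by auto
  show "graph_cells G = {Vertex v, Edge e1, Edge e2} \<union> L \<union> R" using cells(1) L R in1 in2 by auto
  show "L \<inter> R = {}" using cells(2) L R by auto
  show "e1 \<noteq> e2" using e inter(2) by auto
  show "Vertex v \<notin> L \<union> R" "Edge e1 \<notin> L \<union> R" "Edge e2 \<notin> L \<union> R" using ne L R by auto
qed

lemma v_in_closed: "Vertex v \<in> closed_cell G (Edge e1)" "Vertex v \<in> closed_cell G (Edge e2)"
  using inc by (auto simp: incident_def)

abbreviation "D \<equiv> conf_complex n G"

text \<open>The closed cells of \<open>v\<close>, \<open>e1\<close> and \<open>e2\<close> all contain \<open>v\<close>, so at most one of them is occupied.\<close>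

lemma D_cases:
  assumes S: "S \<in> D"
  obtains (none) "Vertex v \<notin> S" "Edge e1 \<notin> S" "Edge e2 \<notin> S" "card (S \<inter> L) + card (S \<inter> R) = n"
  | (v) "Vertex v \<in> S" "Edge e1 \<notin> S" "Edge e2 \<notin> S" "Suc (card (S \<inter> L) + card (S \<inter> R)) = n"
  | (e1) "Vertex v \<notin> S" "Edge e1 \<in> S" "Edge e2 \<notin> S" "Suc (card (S \<inter> L) + card (S \<inter> R)) = n"
  | (e2) "Vertex v \<notin> S" "Edge e1 \<notin> S" "Edge e2 \<in> S" "Suc (card (S \<inter> L) + card (S \<inter> R)) = n"
proof -
  have Sf: "S \<subseteq> graph_cells G" "finite S" "card S = n"
    and pw: "\<And>\<sigma> \<tau>. \<sigma> \<in> S \<Longrightarrow> \<tau> \<in> S \<Longrightarrow> \<sigma> \<noteq> \<tau> \<Longrightarrow> disjnt (closed_cell G \<sigma>) (closed_cell G \<tau>)"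
    using S by (auto simp: conf_complex_iff pairwise_def)
  let ?V = "{Vertex v, Edge e1, Edge e2}"
  have "S = (S \<inter> ?V) \<union> ((S \<inter> L) \<union> (S \<inter> R))" using Sf(1) cells_G by auto
  moreover have "card ((S \<inter> ?V) \<union> ((S \<inter> L) \<union> (S \<inter> R))) = card (S \<inter> ?V) + card ((S \<inter> L) \<union> (S \<inter> R))"
    by (rule card_Un_disjoint) (use Sf(2) cells_disj in auto)
  moreover have "card ((S \<inter> L) \<union> (S \<inter> R)) = card (S \<inter> L) + card (S \<inter> R)"
    by (rule card_Un_disjoint) (use Sf(2) cells_disj in auto)
  ultimately have card: "card (S \<inter> ?V) + (card (S \<inter> L) + card (S \<inter> R)) = n" using Sf(3) by simp
  have one: "\<sigma> = \<tau>" if "\<sigma> \<in> S \<inter> ?V" "\<tau> \<in> S \<inter> ?V" for \<sigma> \<tau>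
  proof (rule ccontr)
    assume "\<sigma> \<noteq> \<tau>"
    then have "disjnt (closed_cell G \<sigma>) (closed_cell G \<tau>)" using pw that by blast
    moreover have "Vertex v \<in> closed_cell G \<rho>" if "\<rho> \<in> ?V" for \<rho>
      using that v_in_closed self_in_closed_cell[of "Vertex v" G] by blast
    ultimately show False using that unfolding disjnt_def by blast
  qed
  show ?thesis
  proof (cases "S \<inter> ?V = {}")
    case True
    then have "Vertex v \<notin> S" "Edge e1 \<notin> S" "Edge e2 \<notin> S" "card (S \<inter> L) + card (S \<inter> R) = n"
      using card by auto
    from none[OF this] show ?thesis .
  next
    case False
    then obtain \<sigma> where \<sigma>: "S \<inter> ?V = {\<sigma>}" using one by blast
    then have c: "Suc (card (S \<inter> L) + card (S \<inter> R)) = n" using card by simp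
    have mem: "x \<in> S \<longleftrightarrow> x = \<sigma>" if "x \<in> ?V" for x using \<sigma> that by blast
    note mem = mem[of "Vertex v", simplified] mem[of "Edge e1", simplified] mem[of "Edge e2", simplified]
    have "\<sigma> \<in> ?V" using \<sigma> by blast
    then consider "\<sigma> = Vertex v" | "\<sigma> = Edge e1" | "\<sigma> = Edge e2" by auto
    then show ?thesis
    proof cases
      case 1
      have "Vertex v \<in> S" "Edge e1 \<notin> S" "Edge e2 \<notin> S" unfolding mem 1 by simp_all
      from v[OF this c] show ?thesis .
    next
      case 2
      have "Vertex v \<notin> S" "Edge e1 \<in> S" "Edge e2 \<notin> S" unfolding mem 2 using cells_disj(2) by simp_all
      from e1[OF this c] show ?thesis .
    next
      case 3
      have "Vertex v \<notin> S" "Edge e1 \<notin> S" "Edge e2 \<in> S" unfolding mem 3 using cells_disj(2) by simp_all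
      from e2[OF this c] show ?thesis .
    qed
  qed
qed

section \<open>Descriptions of the pieces by particle counts\<close>

lemma wf_G12: "wf_digraph G1" "wf_digraph G2" "wf_digraph T1" "wf_digraph T2"
  by (rule fin_digraph.axioms(1), rule fin_G12 fin_T12)+

lemma disj_cells:
  "graph_cells G1 \<inter> R = {}" "L \<inter> graph_cells G2 = {}"
  using cells_G1 cells_G2 cells_disj by auto

lemma D_if_parts:
  assumes "S \<subseteq> graph_cells G" "finite S" "pairwise (\<lambda>\<sigma> \<tau>. disjnt (closed_cell G \<sigma>) (closed_cell G \<tau>)) S"
    and "S \<subseteq> A \<union> B" "A \<inter> B = {}" "card (S \<inter> A) + card (S \<inter> B) = n"
  shows "S \<in> D"
proof -
  have "S = (S \<inter> A) \<union> (S \<inter> B)" using assms(4) by auto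
  moreover have "card ((S \<inter> A) \<union> (S \<inter> B)) = card (S \<inter> A) + card (S \<inter> B)"
    by (rule card_Un_disjoint) (use assms(2,5) in auto)
  ultimately have "card S = n" using assms(6) by simp
  then show ?thesis using assms(1-3) by (simp add: conf_complex_iff)
qed

lemma D_split:
  assumes "S \<in> D" "S \<subseteq> A \<union> B" "A \<inter> B = {}"
  shows "card (S \<inter> A) + card (S \<inter> B) = n"
proof -
  have "S = (S \<inter> A) \<union> (S \<inter> B)" using assms(2) by auto
  moreover have "card ((S \<inter> A) \<union> (S \<inter> B)) = card (S \<inter> A) + card (S \<inter> B)"
    by (rule card_Un_disjoint) (use assms in \<open>auto simp: conf_complex_iff\<close>)
  ultimately show ?thesis using assms(1) by (simp add: conf_complex_iff)
qed

text \<open>The particles off \<open>R\<close> number \<open>n - k\<close> automatically and may use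
  \<open>L\<close>, \<open>v\<close> and \<open>e1\<close>. What remains is the count on
  \<open>R\<close> and the absence from \<open>e2\<close>.\<close>

lemma piece_A_eq:
  assumes "k \<le> n"
  shows "piece_A n G1 G2 v k = {S \<in> D. Edge e2 \<notin> S \<and> card (S \<inter> R) = k}"
  unfolding piece_A_def conf_prod_conf_complex[OF wf_G12(1,4) closed_cells(1,4) disj_cells(1)]
proof (intro Set.set_eqI iffI CollectI; elim CollectE conjE)
  fix S assume S: "S \<subseteq> graph_cells G1 \<union> R" "finite S" "card (S \<inter> graph_cells G1) = n - k" "card (S \<inter> R) = k"
    "pairwise (\<lambda>\<sigma> \<tau>. disjnt (closed_cell G \<sigma>) (closed_cell G \<tau>)) S"
  have "S \<in> D"
    by (rule D_if_parts[of S "graph_cells G1" R]) (use S assms disj_cells(1) cells_G cells_G1 in auto)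
  moreover have "Edge e2 \<notin> S" using S(1) cells_G1 cells_disj by auto
  ultimately show "S \<in> D \<and> Edge e2 \<notin> S \<and> card (S \<inter> R) = k" using S(4) by simp
next
  fix S assume S: "S \<in> D" "Edge e2 \<notin> S" "card (S \<inter> R) = k"
  have sub: "S \<subseteq> graph_cells G1 \<union> R" using S(1,2) cells_G cells_G1 by (auto simp: conf_complex_iff)
  then show "S \<subseteq> graph_cells G1 \<union> R \<and> finite S \<and> card (S \<inter> graph_cells G1) = n - k \<and> card (S \<inter> R) = k \<and>
    pairwise (\<lambda>\<sigma> \<tau>. disjnt (closed_cell G \<sigma>) (closed_cell G \<tau>)) S"
    using D_split[OF S(1) sub disj_cells(1)] S by (simp add: conf_complex_iff)
qed

lemma piece_A'_eq:
  assumes "k \<le> n"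
  shows "piece_A' n G1 G2 v k = {S \<in> D. Edge e1 \<notin> S \<and> card (S \<inter> L) = n - k}"
  unfolding piece_A'_def conf_prod_conf_complex[OF wf_G12(3,2) closed_cells(3,2) disj_cells(2)]
proof (intro Set.set_eqI iffI CollectI; elim CollectE conjE)
  fix S assume S: "S \<subseteq> L \<union> graph_cells G2" "finite S" "card (S \<inter> L) = n - k" "card (S \<inter> graph_cells G2) = k"
    "pairwise (\<lambda>\<sigma> \<tau>. disjnt (closed_cell G \<sigma>) (closed_cell G \<tau>)) S"
  have "S \<in> D"
    by (rule D_if_parts[of S L "graph_cells G2"]) (use S assms disj_cells(2) cells_G cells_G2 in auto)
  moreover have "Edge e1 \<notin> S" using S(1) cells_G2 cells_disj by auto
  ultimately show "S \<in> D \<and> Edge e1 \<notin> S \<and> card (S \<inter> L) = n - k" using S(3) by simp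
next
  fix S assume S: "S \<in> D" "Edge e1 \<notin> S" "card (S \<inter> L) = n - k"
  have sub: "S \<subseteq> L \<union> graph_cells G2" using S(1,2) cells_G cells_G2 by (auto simp: conf_complex_iff)
  then show "S \<subseteq> L \<union> graph_cells G2 \<and> finite S \<and> card (S \<inter> L) = n - k \<and> card (S \<inter> graph_cells G2) = k \<and>
    pairwise (\<lambda>\<sigma> \<tau>. disjnt (closed_cell G \<sigma>) (closed_cell G \<tau>)) S"
    using D_split[OF S(1) sub disj_cells(2)] S assms by (simp add: conf_complex_iff)
qed

lemma conf_complex_G2: "conf_complex n G2 = {S \<in> D. Edge e1 \<notin> S \<and> card (S \<inter> L) = 0}"
proof (intro Set.set_eqI iffI CollectI; (elim CollectE conjE)?)
  fix S assume "S \<in> conf_complex n G2"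
  then have S: "S \<subseteq> graph_cells G2" "S \<in> D" using cells_G cells_G2 by (auto simp: conf_complex_iff)
  then have "Edge e1 \<notin> S" "S \<inter> L = {}" using cells_G2 cells_disj by auto
  then show "S \<in> D \<and> Edge e1 \<notin> S \<and> card (S \<inter> L) = 0" using S(2) by simp
next
  fix S assume S: "S \<in> D" "Edge e1 \<notin> S" "card (S \<inter> L) = 0"
  then have "S \<inter> L = {}" by (simp add: conf_complex_iff)
  then have "S \<subseteq> graph_cells G2" using S(1,2) cells_G cells_G2 by (auto simp: conf_complex_iff)
  then show "S \<in> conf_complex n G2" using S(1) by (simp add: conf_complex_iff)
qed

text \<open>The unions over \<open>j\<close> collapse to inequalities: the A'_j allow 1 to
  \<open>n - k - 1\<close> particles on \<open>L\<close>, configurations on the second graph allow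
  0, and the A_j allow \<open>k + 1\<close> to \<open>n - 1\<close> on \<open>R\<close>.\<close>

lemma piece_B_iff:
  assumes k: "k < n"
  shows "S \<in> piece_B n G1 G2 v k \<longleftrightarrow> S \<in> D \<and> (Edge e1 \<notin> S \<and> card (S \<inter> L) + k < n \<or>
    Edge e2 \<notin> S \<and> k < card (S \<inter> R) \<and> card (S \<inter> R) < n)"
    (is "_ \<longleftrightarrow> ?rhs")
proof -
  let ?J = "{k + 1..n - 1}"
  have "(\<exists>j\<in>?J. S \<in> piece_A' n G1 G2 v j \<or> S \<in> piece_A n G1 G2 v j) \<longleftrightarrow>
      (\<exists>j\<in>?J. S \<in> D \<and> (Edge e1 \<notin> S \<and> card (S \<inter> L) = n - j \<or> Edge e2 \<notin> S \<and> card (S \<inter> R) = j))"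
    by (rule bex_cong) (auto simp: piece_A_eq piece_A'_eq)
  then have iff: "S \<in> piece_B n G1 G2 v k \<longleftrightarrow> S \<in> D \<and> (Edge e1 \<notin> S \<and> card (S \<inter> L) = 0 \<or>
      (\<exists>j\<in>?J. Edge e1 \<notin> S \<and> card (S \<inter> L) = n - j \<or> Edge e2 \<notin> S \<and> card (S \<inter> R) = j))"
    unfolding piece_B_def conf_complex_G2 by blast
  show ?thesis
  proof
    assume "S \<in> piece_B n G1 G2 v k"
    then have SD: "S \<in> D" and "Edge e1 \<notin> S \<and> card (S \<inter> L) = 0 \<or>
        (\<exists>j\<in>?J. Edge e1 \<notin> S \<and> card (S \<inter> L) = n - j \<or> Edge e2 \<notin> S \<and> card (S \<inter> R) = j)"
      unfolding iff by blast+
    then consider "Edge e1 \<notin> S" "card (S \<inter> L) = 0"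
      | j where "j \<in> ?J" "Edge e1 \<notin> S" "card (S \<inter> L) = n - j"
      | "card (S \<inter> R) \<in> ?J" "Edge e2 \<notin> S"
      by (elim disjE bexE conjE; blast)
    then show ?rhs
    proof cases
      case 1
      then show ?thesis using SD k by simp
    next
      case 2
      then have "card (S \<inter> L) + k < n" by (simp, linarith)
      then show ?thesis using SD 2 by simp
    next
      case 3
      then have "k < card (S \<inter> R) \<and> card (S \<inter> R) < n" by (simp, linarith)
      then show ?thesis using SD 3 by simp
    qed
  next
    assume rhs: ?rhs
    show "S \<in> piece_B n G1 G2 v k"
    proof (cases "Edge e1 \<notin> S \<and> card (S \<inter> L) + k < n")
      case True
      then have "card (S \<inter> L) = 0 \<or> n - card (S \<inter> L) \<in> ?J \<and> card (S \<inter> L) = n - (n - card (S \<inter> L))" by auto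
      then show ?thesis unfolding iff using True rhs by blast
    next
      case False
      then have "card (S \<inter> R) \<in> ?J" "Edge e2 \<notin> S" using rhs by auto
      then show ?thesis unfolding iff using rhs by blast
    qed
  qed
qed

text \<open>If a particle is on \<open>e2\<close>, or all are on \<open>R\<close>, then
  \<open>e1\<close> is free and fewer than \<open>n\<close> particles are on \<open>L\<close>.
  Otherwise \<open>e2\<close> is free and the count on \<open>R\<close> is below \<open>n\<close>,
  which is covered by some A_j.\<close>

lemma piece_A_Un_B_0: "piece_A n G1 G2 v 0 \<union> piece_B n G1 G2 v 0 = D"
proof -
  have n0: "0 < n" using n by simp
  have "Edge e2 \<notin> S \<and> card (S \<inter> R) = 0 \<or> Edge e1 \<notin> S \<and> card (S \<inter> L) + 0 < n \<or>
      Edge e2 \<notin> S \<and> 0 < card (S \<inter> R) \<and> card (S \<inter> R) < n" if "S \<in> D" for S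
    using that by (cases rule: D_cases) (simp; linarith)+
  then show ?thesis
    unfolding set_eq_iff Un_iff piece_B_iff[OF n0] piece_A_eq[OF le0] mem_Collect_eq by blast
qed

lemma piece_B_step:
  assumes "1 \<le> k" "k \<le> n - 1"
  shows "piece_B n G1 G2 v (k - 1) = piece_A' n G1 G2 v k \<union> piece_B' n G1 G2 v k"
proof -
  have "{k - 1 + 1..n - 1} = insert k {k + 1..n - 1}" using assms by auto
  then show ?thesis by (auto simp: piece_B_def piece_B'_def)
qed

lemma piece_B_last: "piece_B n G1 G2 v (n - 1) = conf_complex n G2"
  using n by (simp add: piece_B_def)

text \<open>With \<open>k\<close> particles on \<open>R\<close>, membership in the second set forces
  \<open>e1\<close> free and fewer than \<open>n - k\<close> particles on \<open>L\<close>. As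
  \<open>e2\<close> is free too, the missing particle can only be at \<open>v\<close>.\<close>

lemma piece_A_Int_B:
  assumes "k \<le> n - 1"
  shows "piece_A n G1 G2 v k \<inter> piece_B n G1 G2 v k =
    conf_prod {{Vertex v}} (conf_prod (conf_complex (n - k - 1) T1) (conf_complex k T2))" (is "?X = ?Y")
proof -
  have k: "k \<le> n" and kn: "k < n" using assms n by simp_all
  have "?X = {S \<in> D. Vertex v \<in> S \<and> card (S \<inter> L) = n - k - 1 \<and> card (S \<inter> R) = k}" (is "_ = ?Z")
  proof (intro Set.set_eqI iffI)
    fix S assume "S \<in> ?X"
    then have S: "S \<in> D" "Edge e2 \<notin> S" "card (S \<inter> R) = k" "Edge e1 \<notin> S" "card (S \<inter> L) + k < n"
      using kn by (auto simp: piece_A_eq[OF k] piece_B_iff[OF kn])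
    from S(1) show "S \<in> ?Z"
      by (cases rule: D_cases) (use S in auto)
  next
    fix S assume S: "S \<in> ?Z"
    then have "S \<in> D" by simp
    then show "S \<in> ?X"
      by (cases rule: D_cases) (use S kn in \<open>auto simp: piece_A_eq[OF k] piece_B_iff[OF kn]\<close>)
  qed
  also have "\<dots> = ?Y"
  proof (intro Set.set_eqI iffI)
    fix S assume S: "S \<in> ?Z"
    then have SD: "S \<in> D" and vS: "Vertex v \<in> S" by auto
    have not: "Edge e1 \<notin> S" "Edge e2 \<notin> S" using SD by (cases rule: D_cases; use vS in auto)+
    let ?U = "S - {Vertex v}"
    have "?U \<subseteq> L \<union> R" using SD not cells_G by (auto simp: conf_complex_iff)
    moreover have "?U \<inter> L = S \<inter> L" "?U \<inter> R = S \<inter> R" using cells_disj by auto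
    moreover have "pairwise (\<lambda>\<sigma> \<tau>. disjnt (closed_cell G \<sigma>) (closed_cell G \<tau>)) ?U"
      using SD by (auto simp: conf_complex_iff pairwise_def)
    ultimately have "?U \<in> conf_prod (conf_complex (n - k - 1) T1) (conf_complex k T2)"
      using S SD unfolding conf_prod_conf_complex[OF wf_G12(3,4) closed_cells(3,4) cells_disj(1)]
      by (auto simp: conf_complex_iff)
    moreover have "S = {Vertex v} \<union> ?U" using vS by auto
    ultimately show "S \<in> ?Y" unfolding conf_prod_def[of "{{Vertex v}}"] by blast
  next
    fix S assume "S \<in> ?Y"
    then obtain U where S: "S = insert (Vertex v) U"
      and "U \<in> conf_prod (conf_complex (n - k - 1) T1) (conf_complex k T2)"
      by (auto simp: conf_prod_def[of "{{Vertex v}}"])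
    then have U: "U \<subseteq> L \<union> R" "finite U" "card (U \<inter> L) = n - k - 1" "card (U \<inter> R) = k"
      "pairwise (\<lambda>\<sigma> \<tau>. disjnt (closed_cell G \<sigma>) (closed_cell G \<tau>)) U"
      unfolding conf_prod_conf_complex[OF wf_G12(3,4) closed_cells(3,4) cells_disj(1)] by auto
    have LR: "S \<inter> L = U \<inter> L" "S \<inter> R = U \<inter> R" using S cells_disj by auto
    have vU: "Vertex v \<notin> U" using U(1) cells_disj by auto
    have "card U = card (U \<inter> L) + card (U \<inter> R)"
      using U(1,2) cells_disj(1) card_Un_disjoint[of "U \<inter> L" "U \<inter> R"] by (simp add: Int_Un_distrib[symmetric] inf.absorb1) blast
    then have cU: "card S = n" using S vU U(2-4) assms n by simp
    \<comment> \<open>The cells touching \<open>v\<close> are \<open>v\<close>, \<open>e1\<close>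
      and \<open>e2\<close>, and none of them belongs to \<open>L\<close> or
      \<open>R\<close>.\<close>
    have far: "Vertex v \<notin> closed_cell G \<tau>" if "\<tau> \<in> U" for \<tau>
    proof -
      have "\<tau> \<in> L \<or> \<tau> \<in> R" using that U(1) by auto
      then show ?thesis
        using closed_cell_incident[of \<tau> G1 v] closed_cell_incident[of \<tau> G2 v] cells_G1 cells_G2 cells_disj inc
        by (auto simp del: closed_cell.simps)
    qed
    have "S \<in> D"
      unfolding conf_complex_iff
      using S U cU far cells_G by (auto simp: pairwise_insert disjnt_def)
    then show "S \<in> ?Z" using S U LR by simp
  qed
  finally show ?thesis .
qed

text \<open>With \<open>n - k\<close> particles on \<open>L\<close> the first alternative of
  \<open>piece_B_iff\<close> fails, so \<open>e2\<close> is free and at least \<open>k\<close>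
  particles are on \<open>R\<close>. This exhausts all \<open>n\<close> particles.\<close>

lemma piece_A'_Int_B':
  assumes "1 \<le> k" "k \<le> n - 1"
  shows "piece_A' n G1 G2 v k \<inter> piece_B' n G1 G2 v k = conf_prod (conf_complex (n - k) T1) (conf_complex k T2)"
    (is "?X = ?Y")
proof -
  have k: "k \<le> n" and kn: "k < n" using assms n by simp_all
  have "?X = {S \<in> D. Vertex v \<notin> S \<and> Edge e1 \<notin> S \<and> Edge e2 \<notin> S \<and> card (S \<inter> L) = n - k \<and> card (S \<inter> R) = k}"
    (is "_ = ?Z")
  proof (intro Set.set_eqI iffI)
    fix S assume "S \<in> ?X"
    then have S: "S \<in> D" "Edge e1 \<notin> S" "card (S \<inter> L) = n - k"
      and B: "Edge e2 \<notin> S \<and> card (S \<inter> R) = k \<or> card (S \<inter> L) + k < n \<or> Edge e2 \<notin> S \<and> k < card (S \<inter> R)"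
      unfolding Int_iff Un_iff piece_A_eq[OF k] piece_A'_eq[OF k] piece_B_iff[OF kn] piece_B'_def mem_Collect_eq
      by blast+
    have "\<not> card (S \<inter> L) + k < n" using S(3) kn by simp
    then have "Edge e2 \<notin> S \<and> k \<le> card (S \<inter> R)" using B by (elim disjE conjE) simp_all
    then have S': "Edge e2 \<notin> S" "k \<le> card (S \<inter> R)" by blast+
    from S(1) show "S \<in> ?Z"
    proof (cases rule: D_cases)
      case none
      then have "card (S \<inter> R) = k" using S(3) S'(2) kn by linarith
      then show ?thesis using S none by simp
    next
      case v
      then have False using S(3) S'(2) kn by linarith
      then show ?thesis ..
    qed (use S(2) S'(1) in simp_all)
  next
    fix S assume "S \<in> ?Z"
    then show "S \<in> ?X" by (auto simp: piece_A_eq[OF k] piece_A'_eq[OF k] piece_B'_def)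
  qed
  also have "\<dots> = ?Y"
    unfolding conf_prod_conf_complex[OF wf_G12(3,4) closed_cells(3,4) cells_disj(1)]
  proof (intro Set.set_eqI iffI CollectI; elim CollectE conjE)
    fix S assume S: "S \<subseteq> L \<union> R" "finite S" "card (S \<inter> L) = n - k" "card (S \<inter> R) = k"
      "pairwise (\<lambda>\<sigma> \<tau>. disjnt (closed_cell G \<sigma>) (closed_cell G \<tau>)) S"
    have "S \<in> D"
      by (rule D_if_parts[of S L R]) (use S assms cells_disj(1) cells_G in auto)
    then show "S \<in> D \<and> Vertex v \<notin> S \<and> Edge e1 \<notin> S \<and> Edge e2 \<notin> S \<and> card (S \<inter> L) = n - k \<and> card (S \<inter> R) = k"
      using S cells_disj by auto
  next
    fix S assume S: "S \<in> D" "Vertex v \<notin> S" "Edge e1 \<notin> S" "Edge e2 \<notin> S" "card (S \<inter> L) = n - k" "card (S \<inter> R) = k"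
    then show "S \<subseteq> L \<union> R \<and> finite S \<and> card (S \<inter> L) = n - k \<and> card (S \<inter> R) = k \<and>
      pairwise (\<lambda>\<sigma> \<tau>. disjnt (closed_cell G \<sigma>) (closed_cell G \<tau>)) S"
      using cells_G by (auto simp: conf_complex_iff)
  qed
  finally show ?thesis .
qed

section \<open>Betti numbers of the pieces and their sum\<close>

abbreviation "b1 p k \<equiv> hrank G p (conf_complex k G1)"
abbreviation "b2 p k \<equiv> hrank G p (conf_complex k G2)"

lemma hrank_T1: "k \<le> n \<Longrightarrow> hrank G p (conf_complex k T1) = b1 p k"
  using leg_hrank[OF leg_mono[OF leg(1)] fin_G12(1), of k p] hrank_cong[of G1 G] by simp

lemma hrank_T2: "k \<le> n \<Longrightarrow> hrank G p (conf_complex k T2) = b2 p k"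
  using leg_hrank[OF leg_mono[OF leg(2)] fin_G12(2), of k p] hrank_cong[of G2 G] by simp

lemma hrank_0: "k \<le> n \<Longrightarrow> b1 0 k = 1" "k \<le> n \<Longrightarrow> b2 0 k = 1"
  using hrank_0_conf_complex[OF fin_G12(1) connected(1), of k] leg_card_verts[OF leg(1) fin_G12(1)] hrank_cong[of G1 G]
    hrank_0_conf_complex[OF fin_G12(2) connected(2), of k] leg_card_verts[OF leg(2) fin_G12(2)] hrank_cong[of G2 G]
  by simp_all

lemma product_complexes:
  "product_complex (graph_cells G1) R G (conf_complex i G1) (conf_complex j T2)"
  "product_complex L (graph_cells G2) G (conf_complex i T1) (conf_complex j G2)"
  "product_complex L R G (conf_complex i T1) (conf_complex j T2)"
  using disj_cells cells_disj(1) finite_graph_cells[OF fin_G12(1)] finite_graph_cells[OF fin_G12(2)]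
    finite_graph_cells[OF fin_T12(1)] finite_graph_cells[OF fin_T12(2)]
    conf_complex_Pow[of i G1] conf_complex_Pow[of j G2] conf_complex_Pow[of i T1] conf_complex_Pow[of j T2]
    cube_complex_conf_complex[OF fin_G12(1)] cube_complex_conf_complex[OF fin_G12(2)]
    cube_complex_conf_complex[OF fin_T12(1)] cube_complex_conf_complex[OF fin_T12(2)]
    cube_complex_cong[of G1 G] cube_complex_cong[of G2 G] cube_complex_cong[of T1 G] cube_complex_cong[of T2 G]
  by (simp_all add: product_complex_def product_complex_axioms_def disjoint_cells_def)

text \<open>The Kuenneth sum in degree 2 for \<open>i\<close> and \<open>j\<close> particles, with
  both Betti numbers in degree 0 replaced by 1.\<close>

abbreviation "F i j \<equiv> b2 2 j + b1 1 i * b2 1 j + b1 2 i"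

lemma hrank_2_products:
  assumes "i \<le> n" "j \<le> n"
  shows "hrank G 2 (conf_prod (conf_complex i G1) (conf_complex j T2)) = F i j"
    "hrank G 2 (conf_prod (conf_complex i T1) (conf_complex j G2)) = F i j"
    "hrank G 2 (conf_prod (conf_complex i T1) (conf_complex j T2)) = F i j"
  using assms
  by (simp_all add: product_complex.hrank_conf_prod[OF product_complexes(1)]
      product_complex.hrank_conf_prod[OF product_complexes(2)]
      product_complex.hrank_conf_prod[OF product_complexes(3)]
      hrank_T1 hrank_T2 hrank_0 numeral_2_eq_2 atMost_Suc)

text \<open>The resting particle is a factor that is a single point, so it does not change the Betti
  numbers.\<close>

lemma hrank_2_vertex_product:
  assumes "i \<le> n" "j \<le> n"
  shows "hrank G 2 (conf_prod {{Vertex v}} (conf_prod (conf_complex i T1) (conf_complex j T2))) = F i j"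
proof -
  interpret p: product_complex L R G "conf_complex i T1" "conf_complex j T2" by (rule product_complexes(3))
  have e: "edges {Vertex v :: ('a, 'b) gcell} = {}" by (auto simp: edges_def)
  interpret q: product_complex "{Vertex v}" "L \<union> R" G "{{Vertex v}}" "conf_prod (conf_complex i T1) (conf_complex j T2)"
  proof unfold_locales
    show "conf_prod (conf_complex i T1) (conf_complex j T2) \<subseteq> Pow (L \<union> R)"
      using p.P(2) p.Q(2) by (auto simp: conf_prod_def)
  qed (use cells_disj p.finL p.finR p.cube_complex_conf_prod e in \<open>auto simp: cube_complex_def\<close>)
  show ?thesis
    using hrank_2_products(3)[OF assms]
    by (simp add: q.hrank_conf_prod hrank_singleton[OF e] numeral_2_eq_2 atMost_Suc)
qed

lemma finite_pieces:
  assumes "k \<le> n"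
  shows "finite (piece_A n G1 G2 v k)" "finite (piece_A' n G1 G2 v k)" "finite (piece_B n G1 G2 v k)" "finite (piece_B' n G1 G2 v k)"
proof -
  have "finite D" using cube_complex_conf_complex[OF graph, of n] by (simp add: cube_complex_def)
  moreover have "piece_A n G1 G2 v k \<subseteq> D" "piece_A' n G1 G2 v k \<subseteq> D" "piece_B n G1 G2 v k \<subseteq> D" "piece_B' n G1 G2 v k \<subseteq> D"
    using assms by (auto simp: piece_A_eq piece_A'_eq piece_B'_def piece_B_def conf_complex_G2)
  ultimately show "finite (piece_A n G1 G2 v k)" "finite (piece_A' n G1 G2 v k)" "finite (piece_B n G1 G2 v k)" "finite (piece_B' n G1 G2 v k)"
    using finite_subset by blast+
qed

theorem hrank_2_wedge:
  assumes mv: "\<And>m k. m \<ge> 2 \<Longrightarrow> k \<le> n - 1 \<Longrightarrow>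
      mv_boundary_trivial G m (piece_A n G1 G2 v k) (piece_B n G1 G2 v k)"
    and mv': "\<And>m k. m \<ge> 2 \<Longrightarrow> 1 \<le> k \<Longrightarrow> k \<le> n - 1 \<Longrightarrow>
      mv_boundary_trivial G m (piece_A' n G1 G2 v k) (piece_B' n G1 G2 v k)"
  shows "hrank G 2 D = b2 2 n + b1 2 n + (\<Sum>k = 1..n. (b1 1 k - b1 1 (k - 1)) * b2 1 (n - k))"
proof -
  let ?A = "piece_A n G1 G2 v" and ?A' = "piece_A' n G1 G2 v" and ?B = "piece_B n G1 G2 v" and ?B' = "piece_B' n G1 G2 v"
  \<comment> \<open>The gain from attaching A_k: the piece itself minus the intersection, in which
    one particle of the first factor has been moved to rest at \<open>v\<close>.\<close>
  define g where "g k = F (n - k) k - F (n - k - 1) k" for k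
  have X: "hrank G 2 (?A k \<union> ?B k) = hrank G 2 (?B k) + g k" if k: "k \<le> n - 1" for k
  proof -
    have k': "k \<le> n" using k by simp
    have "hrank G 2 (?A k \<union> ?B k) + hrank G 2 (?A k \<inter> ?B k) = hrank G 2 (?A k) + hrank G 2 (?B k)"
      by (rule mv_hrank[OF mv[OF _ k] finite_pieces(1,3)[OF k']])
    moreover have "hrank G 2 (?A k) = F (n - k) k"
      unfolding piece_A_def by (rule hrank_2_products(1)) (use k' in auto)
    moreover have "hrank G 2 (?A k \<inter> ?B k) = F (n - k - 1) k"
      unfolding piece_A_Int_B[OF k] by (rule hrank_2_vertex_product) (use k' in auto)
    ultimately show ?thesis by (simp add: g_def)
  qed
  \<comment> \<open>A'_k and its intersection with B'_k have the same second Betti number, so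
    attaching A'_k changes nothing.\<close>
  have X': "hrank G 2 (?B (k - 1)) = hrank G 2 (?A k \<union> ?B k)" if k: "1 \<le> k" "k \<le> n - 1" for k
  proof -
    have k': "k \<le> n" using k by simp
    have "hrank G 2 (?A' k \<union> ?B' k) + hrank G 2 (?A' k \<inter> ?B' k) = hrank G 2 (?A' k) + hrank G 2 (?B' k)"
      by (rule mv_hrank[OF mv'[OF _ k] finite_pieces(2,4)[OF k']])
    moreover have "hrank G 2 (?A' k) = F (n - k) k"
      unfolding piece_A'_def by (rule hrank_2_products(2)) (use k' in auto)
    moreover have "hrank G 2 (?A' k \<inter> ?B' k) = F (n - k) k"
      unfolding piece_A'_Int_B'[OF k] by (rule hrank_2_products(3)) (use k' in auto)
    ultimately have "hrank G 2 (?A' k \<union> ?B' k) = hrank G 2 (?B' k)" by simp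
    then show ?thesis unfolding piece_B_step[OF k] by (simp add: piece_B'_def)
  qed
  \<comment> \<open>Induction down the filtration, from \<open>k = n - 1\<close>, where B_k consists
    of the configurations on the second graph, to \<open>k = 0\<close>, where the union is
    everything; \<open>i\<close> is \<open>n - 1 - k\<close>.\<close>
  have "hrank G 2 (?A (n - 1 - i) \<union> ?B (n - 1 - i)) = b2 2 n + (\<Sum>k = n - 1 - i..n - 1. g k)" if "i \<le> n - 1" for i
    using that
  proof (induction i)
    case 0
    show ?case using X[of "n - 1"] piece_B_last by simp
  next
    case (Suc i)
    let ?k = "n - 1 - i"
    have k: "1 \<le> ?k" "?k \<le> n - 1" "n - 1 - Suc i = ?k - 1" using Suc.prems by auto
    have "{?k - 1..n - 1} = insert (?k - 1) {?k..n - 1}" using k by auto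
    then have "(\<Sum>k = ?k - 1..n - 1. g k) = g (?k - 1) + (\<Sum>k = ?k..n - 1. g k)"
      using k(1) by (simp del: diff_diff_left)
    moreover have "hrank G 2 (?A (?k - 1) \<union> ?B (?k - 1)) = hrank G 2 (?B (?k - 1)) + g (?k - 1)"
      by (rule X) (use k in auto)
    ultimately show ?case unfolding k(3) X'[OF k(1,2)] using Suc.IH Suc.prems by linarith
  qed
  from this[of "n - 1"] have "hrank G 2 D = b2 2 n + (\<Sum>k = 0..n - 1. g k)"
    by (simp add: piece_A_Un_B_0)
  \<comment> \<open>The new index counts particles on the first graph, as in the statement.\<close>
  also have "(\<Sum>k = 0..n - 1. g k) = (\<Sum>k = 1..n. g (n - k))"
    by (rule sum.reindex_bij_witness[of _ "\<lambda>k. n - k" "\<lambda>k. n - k"]) (use n in auto)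
  also have "\<dots> = (\<Sum>k = 1..n. (b1 1 k - b1 1 (k - 1)) * b2 1 (n - k) + (b1 2 k - b1 2 (k - 1)))"
    by (rule sum.cong) (auto simp: g_def algebra_simps)
  also have "\<dots> = (\<Sum>k = 1..n. (b1 1 k - b1 1 (k - 1)) * b2 1 (n - k)) + (\<Sum>k = 1..n. b1 2 k - b1 2 (k - 1))"
    by (rule sum.distrib)
  \<comment> \<open>The second Betti numbers of the second graph have cancelled within each
    \<open>g\<close>; those of the first telescope down to the point complex with 0
    particles.\<close>
  also have "(\<Sum>k = 1..n. b1 2 k - b1 2 (k - 1)) = b1 2 n - b1 2 0"
    using sum_telescope''[of 0 n "b1 2"] by simp
  also have "b1 2 0 = 0"
    unfolding conf_complex_0 by (subst hrank_singleton) (auto simp: edges_def)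
  finally show ?thesis by simp
qed

end

lemma betti_eq_hrank: "fin_digraph G \<Longrightarrow> int (betti p k G) = hrank G p (conf_complex k G)"
  unfolding betti_def by (rule hrank_eq_group_rank[OF cube_complex_conf_complex])

text \<open>The identity is stated over the integers because differences of Betti numbers in
  \<open>nat\<close> would be truncated.\<close>

theorem mainTheorem4:
  fixes \<Gamma> \<Gamma>1 \<Gamma>2 :: "('a, 'b) pre_digraph" and v :: 'a and n :: nat
  assumes n: "n \<ge> 1"
    and graph: "fin_digraph \<Gamma>"
    and subgraphs: "subgraph \<Gamma>1 \<Gamma>" "subgraph \<Gamma>2 \<Gamma>"
    and union: "verts \<Gamma>1 \<union> verts \<Gamma>2 = verts \<Gamma>" "arcs \<Gamma>1 \<union> arcs \<Gamma>2 = arcs \<Gamma>"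
    and inter: "verts \<Gamma>1 \<inter> verts \<Gamma>2 = {v}" "arcs \<Gamma>1 \<inter> arcs \<Gamma>2 = {}"
    and connected: "Digraph_Component.connected \<Gamma>1" "Digraph_Component.connected \<Gamma>2"
    and valence: "valence \<Gamma>1 v = 1" "valence \<Gamma>2 v = 1"
    and extra: "extra_subdivided_at \<Gamma>1 v" "extra_subdivided_at \<Gamma>2 v"
    and subdivided: "sufficiently_subdivided n \<Gamma>"
      "sufficiently_subdivided n \<Gamma>1" "sufficiently_subdivided n \<Gamma>2"
      "sufficiently_subdivided n (tilde \<Gamma>1 v)" "sufficiently_subdivided n (tilde \<Gamma>2 v)"
    and mv: "\<And>m k. m \<ge> 2 \<Longrightarrow> k \<le> n - 1 \<Longrightarrow>
      mv_boundary_trivial \<Gamma> m (piece_A n \<Gamma>1 \<Gamma>2 v k) (piece_B n \<Gamma>1 \<Gamma>2 v k)"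
    and mv': "\<And>m k. m \<ge> 2 \<Longrightarrow> 1 \<le> k \<Longrightarrow> k \<le> n - 1 \<Longrightarrow>
      mv_boundary_trivial \<Gamma> m (piece_A' n \<Gamma>1 \<Gamma>2 v k) (piece_B' n \<Gamma>1 \<Gamma>2 v k)"
  shows "int (betti 2 n \<Gamma>) = int (betti 2 n \<Gamma>2) + int (betti 2 n \<Gamma>1)
    + (\<Sum>k = 1..n. (int (betti 1 k \<Gamma>1) - int (betti 1 (k - 1) \<Gamma>1)) * int (betti 1 (n - k) \<Gamma>2))"
proof -
  have sub: "fin_digraph \<Gamma>1" "fin_digraph \<Gamma>2"
    "tail \<Gamma>1 = tail \<Gamma>" "head \<Gamma>1 = head \<Gamma>" "tail \<Gamma>2 = tail \<Gamma>" "head \<Gamma>2 = head \<Gamma>"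
  proof -
    have "finite (verts \<Gamma>1 \<union> verts \<Gamma>2)" "finite (arcs \<Gamma>1 \<union> arcs \<Gamma>2)"
      using graph union by (simp_all add: fin_digraph.finite_verts fin_digraph.finite_arcs)
    moreover have "wf_digraph \<Gamma>1" "wf_digraph \<Gamma>2" using subgraphs by (auto simp: subgraph_def)
    ultimately show "fin_digraph \<Gamma>1" "fin_digraph \<Gamma>2" using wf_digraph.fin_digraphI by auto
  qed (use subgraphs in \<open>auto simp: subgraph_def compatible_def\<close>)
  obtain e1 where e1: "incident \<Gamma>1 v = {e1}" using valence_1_incident[OF sub(1) valence(1)] by metis
  obtain e2 where e2: "incident \<Gamma>2 v = {e2}" using valence_1_incident[OF sub(2) valence(2)] by metis
  interpret wedge \<Gamma> \<Gamma>1 \<Gamma>2 v n e1 e2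
    by (rule wedge.intro[OF n graph subgraphs union inter connected e1 e2])
      (rule leg_if_sufficiently_subdivided[OF sub(1) valence(1) extra(1) subdivided(4) n]
        leg_if_sufficiently_subdivided[OF sub(2) valence(2) extra(2) subdivided(5) n])+
  have b: "int (betti p k \<Gamma>1) = hrank \<Gamma> p (conf_complex k \<Gamma>1)" "int (betti p k \<Gamma>2) = hrank \<Gamma> p (conf_complex k \<Gamma>2)" for p k
    by (simp_all add: betti_eq_hrank[OF sub(1)] betti_eq_hrank[OF sub(2)]
        hrank_cong[OF sub(3,4)] hrank_cong[OF sub(5,6)])
  show ?thesis
    unfolding b betti_eq_hrank[OF graph] by (rule hrank_2_wedge[OF mv mv'])
qed

end
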